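(* Every p-componentwise simply connected set $S\subseteq\mathbb{R}^2$ whose Beer index $\operatorname{b}(S)$ is defined satisfies $\operatorname{b}(S)\leq 180\,\operatorname{c}(S)$.
   Context: $\lambda_k$ denotes $k$-dimensional Lebesgue measure; "measurable" means Lebesgue measurable. For points $A,B$, $\overline{AB}$ is the closed line segment with endpoints $A,B$. For $S\subseteq\mathbb{R}^2$ let $\operatorname{Seg}(S)=\{(A,B)\in S\times S:\overline{AB}\subseteq S\}\subseteq(\mathbb{R}^2)^2$. The Beer index is $\operatorname{b}(S)=\lambda_4(\operatorname{Seg}(S))/\lambda_2(S)^2$; it is defined if and only if $S$ is measurable with finite positive measure and $\operatorname{Seg}(S)$ is measurable. Let $\operatorname{smc}(S)$ be the supremum of the measures of convex subsets of $S$ (all convex subsets of $\mathbb{R}^2$ are measurable), and let the convexity ratio be $\operatorname{c}(S)=\operatorname{smc}(S)/\lambda_2(S)$. A polygonal line is a curve consisting of finitely many line segments joining consecutive points of a finite sequence. The p-components of $S$ are the equivalence classes of the relation "$A$ and $B$ can be connected by a polygonal line contained in $S$" on $S$. $S$ is p-componentwise simply connected if every p-component of $S$ is simply connected. *)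

theory Defs
  imports "HOL-Analysis.Analysis"
begin

definition Seg :: "(real^2) set \<Rightarrow> ((real^2) \<times> (real^2)) set" where
  "Seg S = {(A, B). A \<in> S \<and> B \<in> S \<and> closed_segment A B \<subseteq> S}"

text \<open>Four-dimensional Lebesgue measure is \<^term>\<open>lebesgue\<close> on the Euclidean space
  \<^typ>\<open>(real^2) \<times> (real^2)\<close>.\<close>

definition beer_index_defined :: "(real^2) set \<Rightarrow> bool" where
  "beer_index_defined S \<longleftrightarrow>
     S \<in> lmeasurable \<and> measure lebesgue S > 0 \<and> Seg S \<in> sets lebesgue"

definition beer_index :: "(real^2) set \<Rightarrow> real" where
  "beer_index S = measure lebesgue (Seg S) / (measure lebesgue S)\<^sup>2"

text \<open>The real-valued supremum is only meaningful when the measures of the convex subsets of the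
  set are bounded; this is the case for every \<^term>\<open>S \<in> lmeasurable\<close>,
  see \<open>smc_bdd_above\<close> below.\<close>

definition smc :: "(real^2) set \<Rightarrow> real" where
  "smc S = (SUP C\<in>{C. convex C \<and> C \<subseteq> S}. measure lebesgue C)"

definition convexity_ratio :: "(real^2) set \<Rightarrow> real" where
  "convexity_ratio S = smc S / measure lebesgue S"

lemma convex_sets_lebesgue:
  fixes C :: "'a::euclidean_space set"
  assumes "convex C"
  shows "C \<in> sets lebesgue"
proof -
  have "interior C \<in> sets lebesgue"
    by (simp add: lebesgue_openin)
  moreover have "C - interior C \<in> sets lebesgue"
    using negligible_subset[OF negligible_convex_frontier[OF assms], of "C - interior C"]
      closure_subset[of C]
    by (auto simp: frontier_def intro!: negligible_imp_sets)
  ultimately have "interior C \<union> (C - interior C) \<in> sets lebesgue"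
    by (rule sets.Un)
  then show ?thesis
    using interior_subset[of C] by (simp add: Un_absorb1)
qed

lemma smc_bdd_above:
  assumes "S \<in> lmeasurable"
  shows "bdd_above (measure lebesgue ` {C. convex C \<and> C \<subseteq> S})"
  using assms by (intro bdd_aboveI2[where M = "measure lebesgue S"] measure_mono_fmeasurable)
    (auto intro: convex_sets_lebesgue)

text \<open>A polygonal line is given by its nonempty list of vertices. The requirement
  \<^term>\<open>set ps \<subseteq> S\<close> only matters for a single vertex, where there are no segments.\<close>

definition polygonal_line_in :: "(real^2) set \<Rightarrow> (real^2) list \<Rightarrow> bool" where
  "polygonal_line_in S ps \<longleftrightarrow> ps \<noteq> [] \<and> set ps \<subseteq> S \<and>
     (\<forall>i. Suc i < length ps \<longrightarrow> closed_segment (ps ! i) (ps ! Suc i) \<subseteq> S)"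

definition p_connected_rel :: "(real^2) set \<Rightarrow> ((real^2) \<times> (real^2)) set" where
  "p_connected_rel S = {(A, B). A \<in> S \<and> B \<in> S \<and>
     (\<exists>ps. polygonal_line_in S ps \<and> hd ps = A \<and> last ps = B)}"

lemma equiv_p_connected_rel: "equiv S (p_connected_rel S)"
proof (rule equivI)
  show "p_connected_rel S \<subseteq> S \<times> S"
    by (auto simp: p_connected_rel_def)
  show "refl_on S (p_connected_rel S)"
  proof (rule refl_onI)
    fix A assume "A \<in> S"
    then have "polygonal_line_in S [A] \<and> hd [A] = A \<and> last [A] = A"
      by (simp add: polygonal_line_in_def)
    with \<open>A \<in> S\<close> show "(A, A) \<in> p_connected_rel S"
      unfolding p_connected_rel_def by blast
  qed
  show "sym (p_connected_rel S)"
  proof (rule symI)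
    fix A B assume "(A, B) \<in> p_connected_rel S"
    then obtain ps where AB: "A \<in> S" "B \<in> S" and ps: "polygonal_line_in S ps"
      "hd ps = A" "last ps = B"
      by (auto simp: p_connected_rel_def)
    have "closed_segment (rev ps ! i) (rev ps ! Suc i) \<subseteq> S" if i: "Suc i < length ps" for i
    proof -
      define j where "j = length ps - Suc (Suc i)"
      have j: "Suc j < length ps" "rev ps ! i = ps ! Suc j" "rev ps ! Suc i = ps ! j"
        using i by (auto simp: j_def rev_nth Suc_diff_Suc)
      show ?thesis
        using ps(1) j by (auto simp: polygonal_line_in_def closed_segment_commute)
    qed
    then have "polygonal_line_in S (rev ps) \<and> hd (rev ps) = B \<and> last (rev ps) = A"
      using ps by (auto simp: polygonal_line_in_def hd_rev last_rev)
    with AB show "(B, A) \<in> p_connected_rel S"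
      unfolding p_connected_rel_def by blast
  qed
  show "trans (p_connected_rel S)"
  proof (rule transI)
    fix A B C assume "(A, B) \<in> p_connected_rel S" "(B, C) \<in> p_connected_rel S"
    then obtain ps qs where AC: "A \<in> S" "B \<in> S" "C \<in> S"
      and ps: "polygonal_line_in S ps" "hd ps = A" "last ps = B"
      and qs: "polygonal_line_in S qs" "hd qs = B" "last qs = C"
      by (auto simp: p_connected_rel_def)
    have ne: "ps \<noteq> []" "qs \<noteq> []"
      using ps qs by (auto simp: polygonal_line_in_def)
    have "closed_segment ((ps @ qs) ! i) ((ps @ qs) ! Suc i) \<subseteq> S"
      if i: "Suc i < length (ps @ qs)" for i
    proof -
      consider "Suc i < length ps" | "Suc i = length ps" | "length ps \<le> i"
        by linarith
      then show ?thesis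
      proof cases
        case 1
        then show ?thesis
          using ps(1) by (simp add: polygonal_line_in_def nth_append)
      next
        case 2
        then have "i = length ps - 1" "i < length ps"
          by auto
        then have "(ps @ qs) ! i = B" "(ps @ qs) ! Suc i = B"
          using 2 ne ps(3) qs(2) by (auto simp: nth_append last_conv_nth hd_conv_nth)
        then show ?thesis
          using AC by simp
      next
        case 3
        then show ?thesis
          using qs(1) i by (auto simp: polygonal_line_in_def nth_append Suc_diff_le)
      qed
    qed
    then have "polygonal_line_in S (ps @ qs) \<and> hd (ps @ qs) = A \<and> last (ps @ qs) = C"
      using ps qs ne by (auto simp: polygonal_line_in_def)
    with AC show "(A, C) \<in> p_connected_rel S"
      unfolding p_connected_rel_def by blast
  qed
qed

definition p_components :: "(real^2) set \<Rightarrow> (real^2) set set" where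
  "p_components S = S // p_connected_rel S"

definition p_componentwise_simply_connected :: "(real^2) set \<Rightarrow> bool" where
  "p_componentwise_simply_connected S \<longleftrightarrow> (\<forall>C\<in>p_components S. simply_connected C)"

end

theory Submission
  imports Defs "HOL-Complex_Analysis.Complex_Analysis"
begin

text \<open>A density argument shows that almost every pair of \<open>Seg S\<close> has its segment in the interior of
  \<open>S\<close>; the components of the interior, cut off by large disks, are bounded, open and simply
  connected, so let \<open>U\<close> be such a set and let \<open>M\<close> bound the areas of its triangles.

  Fix a chord of \<open>U\<close>. It cuts \<open>U\<close> into pockets. The body of a pocket consists of its points that see
  the base chord; what is left of the pocket is cut off by chords (windows), each of which is the base
  chord of a new pocket. This gives a tree whose bodies cover \<open>U\<close> up to a null set, and a segment in
  \<open>U\<close> meets at most three bodies: one parent and two of its children. Triangles spanned by two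
  mutually visible points and the base points they see bound horizontal distances in terms of \<open>M\<close>. With the
  midpoint of a visible pair deciding which of its two points is charged, every point \<open>A\<close> is charged
  with a set of partners of area at most \<open>30 M + 24 M + 32 M\<close>: partners beyond the base
  chord of the body of \<open>A\<close> at distance at most three times that of \<open>A\<close>, pairs whose midpoint lies
  in the body of \<open>A\<close> and is lower than \<open>A\<close>, and more distant partners beyond the chord whose midpoint
  with \<open>A\<close> lies in the parent body. Fubini gives \<open>172 M\<close> times the area of \<open>U\<close>.\<close>

section \<open>Winding numbers of triangles and quadrilaterals\<close>

text \<open>Convex sets enter only as triangles: three mutually visible points of a simply connected
  set span one inside it, and a closed quadrilateral whose two halves are equally oriented fills one
  of its halves. The threshold 3 separates two regimes. A partner beyond the base chord at most
  three times as far as \<open>A\<close> is caught by a trapezoid whose width grows with the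
  distance. For a farther partner the crossing lies in the first quarter of the segment, so its
  height over the parent's base is at least half that of \<open>A\<close>, and the width of the
  midpoint measured against the crossing loses only a factor 2. The midpoint is used because it lies
  in the parent's body even when both points lie in children, and passing from it to the partner
  merely doubles widths. The obstacle there: the line of the window may leave the region before it
  meets the base line of the parent, so a limit of base points seen from the body stands in for the
  meeting point. A visible pair is charged to at least one of its two points, whence 2 * 86 =
  172.\<close>

definition det2 :: "real^2 \<Rightarrow> real^2 \<Rightarrow> real" where
  "det2 u v = u$1 * v$2 - u$2 * v$1"

lemma det2_simps:
  "det2 (u + v) w = det2 u w + det2 v w" "det2 u (v + w) = det2 u v + det2 u w"
  "det2 (u - v) w = det2 u w - det2 v w" "det2 u (v - w) = det2 u v - det2 u w"
  "det2 (c *\<^sub>R u) v = c * det2 u v" "det2 u (c *\<^sub>R v) = c * det2 u v"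
  "det2 u u = 0" "det2 0 v = 0" "det2 u 0 = 0" "det2 (- u) v = - det2 u v" "det2 u (- v) = - det2 u v"
  by (auto simp: det2_def algebra_simps)

lemma det2_self [simp]: "det2 u u = 0" "det2 0 v = 0" "det2 u 0 = 0"
  by (auto simp: det2_def)

lemma det2_swap: "det2 u v = - det2 v u"
  by (simp add: det2_def)

lemma det2_zero_parallel:
  assumes "det2 u v = 0" "u \<noteq> 0"
  shows "\<exists>t. v = t *\<^sub>R u"
proof -
  have "u$1 \<noteq> 0 \<or> u$2 \<noteq> 0" using assms(2) by (auto simp: vec_eq_iff forall_2)
  then show ?thesis
  proof
    assume h: "u$1 \<noteq> 0"
    show ?thesis
      by (rule exI[of _ "v$1 / u$1"]) (use assms(1) h in \<open>simp add: vec_eq_iff forall_2 det2_def field_simps\<close>)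
  next
    assume h: "u$2 \<noteq> 0"
    show ?thesis
      by (rule exI[of _ "v$2 / u$2"]) (use assms(1) h in \<open>simp add: vec_eq_iff forall_2 det2_def field_simps\<close>)
  qed
qed

lemma continuous_on_det2 [continuous_intros]:
  assumes "continuous_on S f" "continuous_on S g"
  shows "continuous_on S (\<lambda>x. det2 (f x) (g x))"
  unfolding det2_def by (intro continuous_intros assms)

lemma tendsto_det2 [tendsto_intros]:
  assumes "(f \<longlongrightarrow> a) F" "(g \<longlongrightarrow> b) F"
  shows "((\<lambda>x. det2 (f x) (g x)) \<longlongrightarrow> det2 a b) F"
  unfolding det2_def by (intro tendsto_intros assms)

text \<open>Winding numbers and the characterisations of simple connectedness used here are stated
  over \<open>complex\<close>; \<open>cx\<close> and its inverse \<open>xc\<close> carry plane sets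
  there and back.\<close>

definition cx :: "real^2 \<Rightarrow> complex" where
  "cx v = Complex (v$1) (v$2)"

definition xc :: "complex \<Rightarrow> real^2" where
  "xc z = vector [Re z, Im z]"

lemma xc_cx [simp]: "xc (cx v) = v"
  by (simp add: xc_def cx_def vec_eq_iff forall_2)

lemma cx_xc [simp]: "cx (xc z) = z"
  by (simp add: xc_def cx_def complex_eq_iff)

lemma linear_cx: "linear cx"
  by (rule linearI) (auto simp: cx_def complex_eq_iff)

lemma inj_cx: "inj cx"
  by (metis injI xc_cx)

lemma surj_cx: "surj cx"
  by (metis surjI cx_xc)

lemma cx_diff: "cx (u - v) = cx u - cx v"
  by (simp add: linear_cx linear_diff)

lemma continuous_on_cx: "continuous_on S cx"
  using linear_cx linear_continuous_on linear_linear by blast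

lemma cx_image_iff [simp]: "cx v \<in> cx ` S \<longleftrightarrow> v \<in> S"
  using inj_cx by (simp add: inj_image_mem_iff)

lemma cx_segment: "cx ` closed_segment a b = closed_segment (cx a) (cx b)"
  by (simp add: closed_segment_linear_image linear_cx)

lemma cx_hull: "cx ` (convex hull A) = convex hull (cx ` A)"
  by (simp add: convex_hull_linear_image linear_cx)

lemma open_cx: "open S \<Longrightarrow> open (cx ` S)"
  by (simp add: linear_cx surj_cx open_surjective_linear_image)

lemma simply_connected_cx: "simply_connected (cx ` S) \<longleftrightarrow> simply_connected S"
  by (metis homeomorphic_simply_connected_eq homeomorphic_sym inj_cx linear_cx
      linear_homeomorphic_image)

lemma det2_nonzero_not_collinear:
  assumes "det2 (b - a) (c - a) \<noteq> 0"
  shows "\<not> collinear {a, b, c}"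
proof
  assume "collinear {a, b, c}"
  then obtain u where u: "\<And>x y. x \<in> {a,b,c} \<Longrightarrow> y \<in> {a,b,c} \<Longrightarrow> \<exists>k. x - y = k *\<^sub>R u"
    unfolding collinear_def by blast
  obtain k l where "b - a = k *\<^sub>R u" "c - a = l *\<^sub>R u"
    using u[of b a] u[of c a] by auto
  with assms show False by (metis det2_simps(5-7) mult_zero_right)
qed

lemma bary_in_interior:
  assumes "det2 (b - a) (c - a) \<noteq> 0" "0 < x" "0 < y" "0 < z" "x + y + z = 1"
    and "v = x *\<^sub>R a + y *\<^sub>R b + z *\<^sub>R c"
  shows "v \<in> interior (convex hull {a, b, c :: real^2})"
  using interior_convex_hull_3_minimal[OF det2_nonzero_not_collinear[OF assms(1)]] assms(2-) 
  by auto

lemma interior_bary: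
  assumes "v \<in> interior (convex hull {a, b, c :: real^2})" "det2 (b - a) (c - a) \<noteq> 0"
  obtains x y z where "0 < x" "0 < y" "0 < z" "x + y + z = 1"
    "v = x *\<^sub>R a + y *\<^sub>R b + z *\<^sub>R c"
proof -
  have "interior (convex hull {a, b, c}) =
      {v. \<exists>x y z. 0 < x \<and> 0 < y \<and> 0 < z \<and> x + y + z = 1 \<and> x *\<^sub>R a + y *\<^sub>R b + z *\<^sub>R c = v}"
    by (rule interior_convex_hull_3_minimal[OF det2_nonzero_not_collinear[OF assms(2)]]) simp
  then show thesis using assms(1) that by auto
qed

lemma interior_triangle_not_segments:
  assumes "v \<in> interior (convex hull {a, b, c :: real^2})"
  shows "v \<notin> closed_segment a b" "v \<notin> closed_segment b c" "v \<notin> closed_segment c a"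
  using interior_of_triangle[of a b c] assms by (auto simp: closed_segment_def)

lemma cx_interior: "cx ` interior S = interior (cx ` S)"
  by (rule interior_bijective_linear_image[symmetric]) (use linear_cx inj_cx surj_cx in \<open>auto simp: bij_def\<close>)

lemma wn_triangle:
  assumes "v \<in> interior (convex hull {a, b, c :: real^2})" "det2 (b - a) (c - a) \<noteq> 0"
  shows "winding_number (linepath (cx a) (cx b) +++ linepath (cx b) (cx c) +++ linepath (cx c) (cx a)) (cx v)
     = of_real (sgn (det2 (b - a) (c - a)))"
proof -
  obtain x y z where xyz: "0 < x" "0 < y" "0 < z" "x + y + z = 1"
    "v = x *\<^sub>R a + y *\<^sub>R b + z *\<^sub>R c"
    by (rule interior_bary[OF assms])
  have "cx v \<in> interior (convex hull {cx a, cx b, cx c})"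
    using imageI[OF assms(1), of cx] by (simp add: cx_interior cx_hull)
  note w = winding_number_triangle[OF this]
  have x: "x = 1 - y - z" using xyz(4) by simp
  \<comment> \<open>The orientation test of \<open>winding_number_triangle\<close> is twice the
    signed area of \<open>a\<close>, \<open>b\<close>, \<open>v\<close>, that is, the weight of
    \<open>c\<close> times that of the whole triangle.\<close>
  have "Im ((cx b - cx a) * cnj (cx b - cx v)) = z * det2 (b - a) (c - a)"
    unfolding xyz(5) x by (simp add: cx_def det2_def algebra_simps)
  then show ?thesis using w xyz(3) assms(2)
    by (auto simp: sgn_if zero_less_mult_iff)
qed

text \<open>Off a closed path the winding number has open level sets, so every condition on its
  value is an open condition.\<close>

lemma open_winding_cx:
  assumes g: "path g" "pathfinish g = pathstart g"
  shows "open {v. cx v \<notin> path_image g \<and> P (winding_number g (cx v))}"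
proof -
  have "open (\<Union>k\<in>Collect P. {z. z \<notin> path_image g \<and> winding_number g z = k})"
    using open_winding_number_levelsets[OF g] by blast
  then have "open (cx -` (\<Union>k\<in>Collect P. {z. z \<notin> path_image g \<and> winding_number g z = k}))"
    by (rule open_vimage[OF _ continuous_on_cx])
  moreover have "cx -` (\<Union>k\<in>Collect P. {z. z \<notin> path_image g \<and> winding_number g z = k}) =
      {v. cx v \<notin> path_image g \<and> P (winding_number g (cx v))}" by auto
  ultimately show ?thesis by simp
qed

definition wn_quad :: "real^2 \<Rightarrow> real^2 \<Rightarrow> real^2 \<Rightarrow> real^2 \<Rightarrow> real^2 \<Rightarrow> complex" where
  "wn_quad a b c d v = winding_number (linepath (cx a) (cx b) +++ linepath (cx b) (cx c) +++
      linepath (cx c) (cx d) +++ linepath (cx d) (cx a)) (cx v)"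

lemma cx_in_segment [simp]: "cx v \<in> closed_segment (cx a) (cx b) \<longleftrightarrow> v \<in> closed_segment a b"
  by (metis cx_image_iff cx_segment)

text \<open>The diagonal between \<open>b\<close> and \<open>d\<close> is inserted once in each
  direction; the two contributions cancel.\<close>

lemma wn_quad_split:
  assumes "v \<notin> closed_segment a b" "v \<notin> closed_segment b c" "v \<notin> closed_segment c d"
    "v \<notin> closed_segment d a" "v \<notin> closed_segment b d"
  shows "wn_quad a b c d v =
    winding_number (linepath (cx a) (cx b) +++ linepath (cx b) (cx d) +++ linepath (cx d) (cx a)) (cx v) +
    winding_number (linepath (cx b) (cx c) +++ linepath (cx c) (cx d) +++ linepath (cx d) (cx b)) (cx v)"
proof -
  have "winding_number (linepath (cx d) (cx b)) (cx v) = - winding_number (linepath (cx b) (cx d)) (cx v)"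
    using winding_number_reversepath[of "linepath (cx b) (cx d)" "cx v"] assms by simp
  moreover have "v \<notin> closed_segment d b" using assms closed_segment_commute by metis
  ultimately show ?thesis
    using assms unfolding wn_quad_def
    by (simp add: winding_number_join path_image_join)
qed

text \<open>The triangle \<open>a b d\<close> contributes its orientation. The triangle
  \<open>b c d\<close> contributes 0 at points outside it and otherwise its own orientation, which
  \<open>h\<close> forces to have the same sign, so nothing cancels.\<close>

lemma wn_quad_nonzero:
  assumes v: "v \<in> interior (convex hull {a, b, d})" and o: "det2 (b - a) (d - a) \<noteq> 0"
    and n: "v \<notin> closed_segment b c" "v \<notin> closed_segment c d"
    and h: "v \<notin> convex hull {b, c, d} \<or> det2 (b - a) (d - a) * det2 (c - b) (d - b) > 0"
  shows "wn_quad a b c d v \<noteq> 0"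
proof -
  note ns = interior_triangle_not_segments[OF v]
  have s: "wn_quad a b c d v = of_real (sgn (det2 (b - a) (d - a))) +
    winding_number (linepath (cx b) (cx c) +++ linepath (cx c) (cx d) +++ linepath (cx d) (cx b)) (cx v)"
    using wn_quad_split[of v a b c d] ns n wn_triangle[OF v o] by metis
  show ?thesis
  proof (cases "v \<in> convex hull {b, c, d}")
    case False
    have "cx v \<notin> convex hull {cx b, cx c, cx d}"
    proof -
      have "cx v \<notin> cx ` (convex hull {b, c, d})" using False by simp
      then show ?thesis by (simp add: cx_hull)
    qed
    moreover have "path_image (linepath (cx b) (cx c) +++ linepath (cx c) (cx d) +++ linepath (cx d) (cx b))
      \<subseteq> convex hull {cx b, cx c, cx d}"
      by (auto simp: path_image_join segment_convex_hull intro: subsetD[OF hull_mono, rotated])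
    ultimately have "winding_number (linepath (cx b) (cx c) +++ linepath (cx c) (cx d) +++ linepath (cx d) (cx b)) (cx v) = 0"
      by (intro winding_number_zero_outside[of _ "convex hull {cx b, cx c, cx d}"]) auto
    then show ?thesis using s o by (simp add: sgn_if)
  next
    case True
    with h have pos: "det2 (b - a) (d - a) * det2 (c - b) (d - b) > 0" by auto
    then have o2: "det2 (c - b) (d - b) \<noteq> 0" by auto
    have "interior (convex hull {b, c, d}) = convex hull {b,c,d} - (closed_segment b c \<union> closed_segment c d \<union> closed_segment d b)"
      by (rule interior_of_triangle) simp
    moreover have "v \<notin> closed_segment d b" using ns closed_segment_commute by blast
    ultimately have "v \<in> interior (convex hull {b, c, d})" using True n by auto
    from s wn_triangle[OF this o2] 
    have "wn_quad a b c d v = of_real (sgn (det2 (b - a) (d - a)) + sgn (det2 (c - b) (d - b)))" by simp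
    moreover have "sgn (det2 (b - a) (d - a)) + sgn (det2 (c - b) (d - b)) \<noteq> 0"
      using pos by (auto simp: sgn_if zero_less_mult_iff)
    ultimately show ?thesis by (metis of_real_eq_0_iff)
  qed
qed

lemma wn_quad_open:
  "open {v. v \<notin> closed_segment a b \<union> closed_segment b c \<union> closed_segment c d \<union> closed_segment d a
      \<and> wn_quad a b c d v \<noteq> 0}" (is "open ?W")
proof -
  define g where "g = linepath (cx a) (cx b) +++ linepath (cx b) (cx c) +++
      linepath (cx c) (cx d) +++ linepath (cx d) (cx a)"
  have g: "path g" "pathfinish g = pathstart g" by (auto simp: g_def)
  have pi: "path_image g = closed_segment (cx a) (cx b) \<union> closed_segment (cx b) (cx c) \<union> 
      closed_segment (cx c) (cx d) \<union> closed_segment (cx d) (cx a)"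
    by (auto simp: g_def path_image_join)
  have "wn_quad a b c d v = winding_number g (cx v)" for v
    by (simp add: wn_quad_def g_def)
  moreover have "cx v \<in> path_image g \<longleftrightarrow> v \<in> closed_segment a b \<union> closed_segment b c \<union> closed_segment c d \<union> closed_segment d a" for v
    unfolding pi by simp
  ultimately show ?thesis using open_winding_cx[OF g, of "\<lambda>k. k \<noteq> 0"] by simp
qed

lemma wn_quad_simply_connected:
  assumes "simply_connected S" "closed_segment a b \<subseteq> S" "closed_segment b c \<subseteq> S"
    "closed_segment c d \<subseteq> S" "closed_segment d a \<subseteq> S" "v \<notin> S"
  shows "wn_quad a b c d v = 0"
  unfolding wn_quad_def
proof (rule simply_connected_imp_winding_number_zero)
  show "simply_connected (cx ` S)" using assms simply_connected_cx by blast
  show "path_image (linepath (cx a) (cx b) +++ linepath (cx b) (cx c) +++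
      linepath (cx c) (cx d) +++ linepath (cx d) (cx a)) \<subseteq> cx ` S"
    using assms by (auto simp: path_image_join simp flip: cx_segment)
qed (use assms in auto)

text \<open>A point of the open triangle outside \<open>S\<close> would have winding number 1 or -1
  along a boundary contained in a simply connected set. A degenerate triangle is covered by one of
  its sides.\<close>

lemma triangle_fill:
  assumes S: "simply_connected S" and s: "closed_segment a b \<subseteq> S" "closed_segment b c \<subseteq> S"
    "closed_segment c a \<subseteq> S"
  shows "convex hull {a, b, c :: real^2} \<subseteq> S"
proof
  fix v assume v: "v \<in> convex hull {a, b, c}"
  show "v \<in> S"
  proof (cases "det2 (b - a) (c - a) = 0")
    case False
    show ?thesis
    proof (rule ccontr)
      assume "v \<notin> S"
      have "v \<in> interior (convex hull {a, b, c})"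
        using interior_of_triangle[of a b c] v \<open>v \<notin> S\<close> s by auto
      from wn_triangle[OF this False]
      have 1: "winding_number (linepath (cx a) (cx b) +++ linepath (cx b) (cx c) +++ linepath (cx c) (cx a)) (cx v) \<noteq> 0"
        using False by (simp add: sgn_if)
      have "winding_number (linepath (cx a) (cx b) +++ linepath (cx b) (cx c) +++ linepath (cx c) (cx a)) (cx v) = 0"
      proof (rule simply_connected_imp_winding_number_zero)
        show "simply_connected (cx ` S)" using S simply_connected_cx by blast
        show "path_image (linepath (cx a) (cx b) +++ linepath (cx b) (cx c) +++ linepath (cx c) (cx a)) \<subseteq> cx ` S"
          using s by (auto simp: path_image_join simp flip: cx_segment)
      qed (use \<open>v \<notin> S\<close> in auto)
      with 1 show False by simp
    qed
  next
    case True
    have "collinear {a, b, c}"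
    proof (cases "b = a")
      case False
      then have "\<exists>t. c - a = t *\<^sub>R (b - a)"
        using True det2_zero_parallel[of "b - a" "c - a"] by auto
      then obtain t where "c - a = t *\<^sub>R (b - a)" by blast
      then have "collinear {0, b - a, c - a}" by (auto simp: collinear_lemma)
      then show ?thesis
        using collinear_3[of b a c] by (simp add: insert_commute)
    qed (simp add: collinear_2 insert_commute)
    then have "between (b, c) a \<or> between (c, a) b \<or> between (a, b) c"
      using collinear_between_cases by blast
    then have "{a, b, c} \<subseteq> closed_segment b c \<or> {a, b, c} \<subseteq> closed_segment c a
        \<or> {a, b, c} \<subseteq> closed_segment a b"
      by (auto simp: between_mem_segment)
    then have "convex hull {a, b, c} \<subseteq> closed_segment b c \<or> convex hull {a, b, c} \<subseteq> closed_segment c a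
        \<or> convex hull {a, b, c} \<subseteq> closed_segment a b"
      by (metis convex_closed_segment hull_minimal)
    then show ?thesis using v s by auto
  qed
qed

text \<open>The halves \<open>a b d\<close> and \<open>b c d\<close> are equally oriented, so their
  winding numbers cannot cancel inside \<open>a b d\<close>. Nothing else is known about the shape,
  hence only this half is filled.\<close>

lemma quad_fill:
  assumes S: "simply_connected S" and s: "closed_segment a b \<subseteq> S" "closed_segment b c \<subseteq> S"
    "closed_segment c d \<subseteq> S" "closed_segment d a \<subseteq> S"
    and o: "det2 (b - a) (d - a) * det2 (c - b) (d - b) > 0"
  shows "convex hull {a, b, d :: real^2} \<subseteq> S"
proof
  fix v assume v: "v \<in> convex hull {a, b, d}"
  have o1: "det2 (b - a) (d - a) \<noteq> 0" using o by auto
  show "v \<in> S"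
  proof (rule ccontr)
    assume vS: "v \<notin> S"
    define g where "g = linepath (cx a) (cx b) +++ linepath (cx b) (cx c) +++
      linepath (cx c) (cx d) +++ linepath (cx d) (cx a)"
    have g: "path g" "pathfinish g = pathstart g" by (auto simp: g_def)
    have pi: "path_image g = closed_segment (cx a) (cx b) \<union> closed_segment (cx b) (cx c) \<union> 
      closed_segment (cx c) (cx d) \<union> closed_segment (cx d) (cx a)"
      by (auto simp: g_def path_image_join)
    \<comment> \<open>\<open>v\<close> may lie on the diagonal, where the splitting fails. The open
      set \<open>Z\<close> contains \<open>v\<close>, so it meets the interior of the triangle,
      where the winding number is nonzero.\<close>
    define Z where "Z = {v. cx v \<notin> path_image g \<and> winding_number g (cx v) = 0}"
    have "open Z" using open_winding_cx[OF g, of "\<lambda>k. k = 0"] by (simp add: Z_def)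
    moreover have "v \<in> Z"
      using vS s wn_quad_simply_connected[OF S s vS, unfolded wn_quad_def, folded g_def] by (auto simp: pi Z_def)
    moreover have "v \<in> closure (interior (convex hull {a, b, d}))"
    proof -
      have "(1/3) *\<^sub>R a + (1/3) *\<^sub>R b + (1/3) *\<^sub>R d \<in> interior (convex hull {a, b, d})"
        by (rule bary_in_interior[OF o1, of "1/3" "1/3" "1/3"]) auto
      then have "closure (interior (convex hull {a, b, d})) = closure (convex hull {a, b, d})"
        by (intro convex_closure_interior) (auto)
      then show ?thesis using v closure_subset by blast
    qed
    ultimately have "Z \<inter> interior (convex hull {a, b, d}) \<noteq> {}"
      by (subst open_Int_closure_eq_empty[symmetric]) auto
    then obtain w where w: "w \<in> interior (convex hull {a, b, d})"
       "w \<in> Z"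
      by auto
    then have "wn_quad a b c d w = 0" unfolding wn_quad_def g_def[symmetric] by (simp add: Z_def)
    moreover have "wn_quad a b c d w \<noteq> 0"
      by (intro wn_quad_nonzero w o1) (use w(2) o pi in \<open>auto simp: Z_def\<close>)
    ultimately show False by simp
  qed
qed

section \<open>Separation by chords and interior components\<close>

text \<open>The quotient \<open>F\<close> has a continuous logarithm on \<open>U\<close>; its
  imaginary part \<open>h\<close> is a lift of the angle under which the chord is seen. Inside
  \<open>U\<close> it takes a certain value \<open>c\<close> on the chord, elsewhere it differs from
  \<open>c\<close>, and \<open>h > c\<close> and \<open>h < c\<close> are the two sides.\<close>

lemma chord_separation:
  fixes U :: "(real^2) set"
  assumes U: "open U" "simply_connected U" and pq: "p \<notin> U" "q \<notin> U" "p \<noteq> q"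
    and sub: "open_segment p q \<subseteq> U"
  obtains Cl Cr where "open Cl" "open Cr" "Cl \<inter> Cr = {}" "U - open_segment p q = Cl \<union> Cr"
    "\<And>x. x \<in> open_segment p q \<Longrightarrow> \<exists>e>0. \<forall>z\<in>ball x e. 
        (det2 (q - p) (z - p) > 0 \<longrightarrow> z \<in> Cl) \<and> (det2 (q - p) (z - p) < 0 \<longrightarrow> z \<in> Cr)"
proof -
  define F where "F = (\<lambda>z. (z - cx p) / (z - cx q))"
  have ne: "z \<noteq> cx p" "z \<noteq> cx q" if "z \<in> cx ` U" for z using that pq by (auto simp: inj_eq[OF inj_cx])
  have "continuous_on (cx ` U) F" unfolding F_def
    by (intro continuous_intros) (use ne in auto)
  moreover have "\<forall>z\<in>cx ` U. F z \<noteq> 0" using ne by (simp add: F_def)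
  ultimately obtain g where g: "continuous_on (cx ` U) g" "\<forall>z\<in>cx ` U. F z = exp (g z)"
    using simply_connected_eq_continuous_log[OF open_cx[OF U(1)]] U(2) by (auto simp: simply_connected_cx)
  define h where "h = (\<lambda>v. Im (g (cx v)))"
  have ch: "continuous_on U h" unfolding h_def
    using continuous_on_compose2[OF g(1) continuous_on_cx, of U] by (intro continuous_on_Im) auto
  have ReF: "Re (F (cx v)) = exp (Re (g (cx v))) * cos (h v)" 
    and ImF: "Im (F (cx v)) = exp (Re (g (cx v))) * sin (h v)" if "v \<in> U" for v
    using g(2) that by (simp_all add: h_def Re_exp Im_exp)
  have F1: "Im (F (cx v)) = - det2 (q - p) (v - p) / (norm (v - q))\<^sup>2"
    and F2: "Re (F (cx v)) = ((v - p) \<bullet> (v - q)) / (norm (v - q))\<^sup>2" for v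
  proof -
    have n: "(norm b)\<^sup>2 = (b$1)\<^sup>2 + (b$2)\<^sup>2" for b :: "real^2"
      by (simp add: norm_vec_def L2_set_def sum_2)
    have 1: "Im (cx a / cx b) = det2 b a / (norm b)\<^sup>2" "Re (cx a / cx b) = (a \<bullet> b) / (norm b)\<^sup>2" for a b
      by (simp_all add: Im_divide Re_divide cx_def det2_def n inner_vec_def sum_2 mult.commute)
    have 2: "F (cx v) = cx (v - p) / cx (v - q)" by (simp add: F_def cx_diff)
    have 3: "det2 (v - q) (v - p) = - det2 (q - p) (v - p)" by (simp add: det2_def algebra_simps)
    show "Im (F (cx v)) = - det2 (q - p) (v - p) / (norm (v - q))\<^sup>2"
      "Re (F (cx v)) = ((v - p) \<bullet> (v - q)) / (norm (v - q))\<^sup>2"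
      unfolding 2 1 3 by simp_all
  qed
  have nq: "(norm (v - q))\<^sup>2 > 0" if "v \<in> U" for v using that pq by auto
  have seg1: "sin (h v) = 0 \<and> cos (h v) < 0" if v: "v \<in> open_segment p q" for v
  proof -
    obtain t where t: "0 < t" "t < 1" "v = (1 - t) *\<^sub>R p + t *\<^sub>R q"
      using v by (auto simp: in_segment)
    have vp: "v - p = t *\<^sub>R (q - p)" "v - q = (t - 1) *\<^sub>R (q - p)"
      unfolding t(3) by (auto simp: algebra_simps)
    have vU: "v \<in> U" using v sub by auto
    have "(v - p) \<bullet> (v - q) < 0"
      unfolding vp using t pq by (auto simp: mult_less_0_iff mult_pos_neg)
    then have "Re (F (cx v)) < 0" using nq[OF vU] by (simp add: F2 divide_neg_pos)
    moreover have "Im (F (cx v)) = 0" unfolding F1 vp by (simp add: det2_simps)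
    ultimately show ?thesis using ReF[OF vU] ImF[OF vU] by (auto simp: mult_less_0_iff)
  qed
  have seg2: "v \<in> open_segment p q" if vU: "v \<in> U" and s: "sin (h v) = 0" "cos (h v) < 0" for v
  proof -
    have "Im (F (cx v)) = 0" "Re (F (cx v)) < 0"
      using ReF[OF vU] ImF[OF vU] s by (auto simp: mult_pos_neg)
    then have c: "det2 (q - p) (v - p) = 0" and d: "(v - p) \<bullet> (v - q) < 0" 
      using nq[OF vU] by (auto simp: F1 F2 divide_less_0_iff)
    obtain t where t: "v - p = t *\<^sub>R (q - p)" using det2_zero_parallel[OF c] pq by auto
    have vq: "v - q = (t - 1) *\<^sub>R (q - p)" using t by (simp add: algebra_simps)
    have "t * (t - 1) * ((q - p) \<bullet> (q - p)) < 0" using d unfolding t vq by (simp add: mult.assoc mult.left_commute)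
    then have "t * (t - 1) < 0" by (smt (verit) inner_ge_zero mult_nonneg_nonneg)
    then have "0 < t" "t < 1" by (auto simp: mult_less_0_iff)
    moreover have "v = (1 - t) *\<^sub>R p + t *\<^sub>R q" using t by (simp add: algebra_simps)
    ultimately show ?thesis using pq by (auto simp: in_segment)
  qed
  have cosm1: "cos (h v) = -1" if "v \<in> open_segment p q" for v
    using seg1[OF that] sin_zero_abs_cos_one[of "h v"] by (auto simp: abs_if split: if_splits)
  \<comment> \<open>On the chord \<open>F\<close> is a negative real, so \<open>h\<close> is an odd
    multiple of pi. Distinct such values are at least 2 pi apart, and the chord is
    connected.\<close>
  have "h constant_on open_segment p q"
  proof (rule continuous_discrete_range_constant)
    show "connected (open_segment p q)" by (simp add: convex_connected)
    show "continuous_on (open_segment p q) h" using ch sub continuous_on_subset by blast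
    show "\<exists>e>0. \<forall>y. y \<in> open_segment p q \<and> h y \<noteq> h x \<longrightarrow> e \<le> norm (h y - h x)"
      if x: "x \<in> open_segment p q" for x
    proof (intro exI[of _ "2 * pi"] conjI allI impI)
      fix y assume y: "y \<in> open_segment p q \<and> h y \<noteq> h x"
      obtain m n :: int where mn: "h x = (2*m+1)*pi" "h y = (2*n+1)*pi"
        using cosm1[OF x] cosm1[of y] y by (auto simp: cos_eq_minus1)
      then have "m \<noteq> n" using y by auto
      then have "\<bar>real_of_int (n - m)\<bar> \<ge> 1" by linarith
      moreover have "h y - h x = 2 * pi * real_of_int (n - m)" using mn by (simp add: algebra_simps)
      ultimately show "2 * pi \<le> norm (h y - h x)" by (simp add: abs_mult)
    qed simp
  qed
  then obtain c where c: "\<And>v. v \<in> open_segment p q \<Longrightarrow> h v = c" by (auto simp: constant_on_def)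
  have "midpoint p q \<in> open_segment p q" using pq by simp
  then have cc: "sin c = 0" "cos c = -1" using seg1 cosm1 c by metis+
  define Cl where "Cl = {v \<in> U. h v > c}"
  define Cr where "Cr = {v \<in> U. h v < c}"
  have eqc: "v \<in> open_segment p q" if "v \<in> U" "h v = c" for v
    using seg2[OF that(1)] that cc by auto
  show thesis
  proof
    have "open (U \<inter> h -` {c<..})" "open (U \<inter> h -` {..<c})" 
      using continuous_open_preimage[OF ch U(1)] by auto
    then show "open Cl" "open Cr" by (auto simp: Cl_def Cr_def vimage_def Int_def)
    show "Cl \<inter> Cr = {}" by (auto simp: Cl_def Cr_def)
    show "U - open_segment p q = Cl \<union> Cr"
      using c eqc by (auto simp: Cl_def Cr_def) (metis linorder_less_linear)
    fix x assume x: "x \<in> open_segment p q"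
    then have xU: "x \<in> U" using sub by auto
    obtain e1 where e1: "e1 > 0" "ball x e1 \<subseteq> U" using U(1) xU open_contains_ball by blast
    \<comment> \<open>As long as \<open>h\<close> changes by less than pi, the sine of
      \<open>h - c\<close> decides the sign of \<open>h - c\<close>, and this sine has the sign of
      the side of \<open>p q\<close>.\<close>
    obtain e2 where e2: "e2 > 0" "\<And>y. y \<in> U \<Longrightarrow> dist y x < e2 \<Longrightarrow> dist (h y) (h x) < pi"
      using ch xU pi_gt_zero unfolding continuous_on_iff by metis
    show "\<exists>e>0. \<forall>z\<in>ball x e. 
        (det2 (q - p) (z - p) > 0 \<longrightarrow> z \<in> Cl) \<and> (det2 (q - p) (z - p) < 0 \<longrightarrow> z \<in> Cr)"
    proof (intro exI[of _ "min e1 e2"] conjI ballI)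
      show "min e1 e2 > 0" using e1 e2 by simp
      fix z assume z: "z \<in> ball x (min e1 e2)"
      then have zU: "z \<in> U" using e1 by auto
      define \<delta> where "\<delta> = h z - c"
      have \<delta>: "\<bar>\<delta>\<bar> < pi" using e2(2)[OF zU] z c[OF x] by (auto simp: dist_real_def dist_commute \<delta>_def)
      have "sin (h z) = - sin \<delta>" using cc sin_add[of c \<delta>] by (simp add: \<delta>_def)
      moreover have "det2 (q - p) (z - p) = - Im (F (cx z)) * (norm (z - q))\<^sup>2"
        using nq[OF zU] by (simp add: F1)
      ultimately have e: "det2 (q - p) (z - p) = exp (Re (g (cx z))) * (norm (z - q))\<^sup>2 * sin \<delta>"
        using ImF[OF zU] by simp
      have pos: "exp (Re (g (cx z))) * (norm (z - q))\<^sup>2 > 0" using nq[OF zU] by simp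
      have s: "sin \<delta> \<le> 0" if "\<delta> \<le> 0" using \<delta> sin_ge_zero[of "-\<delta>"] that by auto
      have s': "sin \<delta> \<ge> 0" if "\<delta> \<ge> 0" using \<delta> sin_ge_zero[of "\<delta>"] that by auto
      show "det2 (q - p) (z - p) > 0 \<longrightarrow> z \<in> Cl"
      proof
        assume "det2 (q - p) (z - p) > 0"
        then have "sin \<delta> > 0" using e pos by (metis zero_less_mult_pos)
        then show "z \<in> Cl" using s zU by (force simp: Cl_def \<delta>_def)
      qed
      show "det2 (q - p) (z - p) < 0 \<longrightarrow> z \<in> Cr"
      proof
        assume "det2 (q - p) (z - p) < 0"
        then have "sin \<delta> < 0" using e pos by (metis mult_less_0_iff order.asym)
        then show "z \<in> Cr" using s' zU by (force simp: Cr_def \<delta>_def)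
      qed
    qed
  qed
qed

section \<open>Components of the interior inherit simple connectedness from the p-components\<close>

lemma p_connected_segment:
  assumes "closed_segment a b \<subseteq> S"
  shows "(a, b) \<in> p_connected_rel S"
proof -
  have "polygonal_line_in S [a, b]"
    using assms by (auto simp: polygonal_line_in_def nth_Cons split: nat.splits)
  then show ?thesis using assms unfolding p_connected_rel_def
    by (auto intro!: exI[of _ "[a,b]"])
qed

text \<open>In a ball contained in \<open>C\<close> every point is joined to the centre by a
  segment, so the class of a point is open and closed in \<open>C\<close>.\<close>

lemma connected_in_p_component:
  assumes C: "open C" "connected C" "C \<noteq> {}" "C \<subseteq> S"
  obtains K where "K \<in> p_components S" "C \<subseteq> K" "K \<subseteq> S"
proof -
  note eqv = equiv_p_connected_rel[of S]
  obtain a where a: "a \<in> C" using C by auto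
  have tr: "(a, y) \<in> p_connected_rel S \<longleftrightarrow> (a, x) \<in> p_connected_rel S" if "x \<in> C" "ball x e \<subseteq> C" "y \<in> ball x e" for x y e
  proof -
    have "closed_segment x y \<subseteq> ball x e"
      by (meson centre_in_ball convex_ball convex_contains_segment dual_order.strict_trans2 mem_ball that(3) zero_le_dist)
    then have "closed_segment x y \<subseteq> S" using that C(4) by (meson subset_trans)
    then have "(x, y) \<in> p_connected_rel S" by (rule p_connected_segment)
    moreover have "sym (p_connected_rel S)" "trans (p_connected_rel S)"
      using eqv by (auto elim: equivE)
    ultimately show ?thesis by (meson symD transD)
  qed
  have "open {x \<in> C. (a, x) \<in> p_connected_rel S}" "open {x \<in> C. (a, x) \<notin> p_connected_rel S}"
    using C(1) tr unfolding open_contains_ball by fast+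
  then have "{x \<in> C. (a, x) \<notin> p_connected_rel S} = {} \<or> {x \<in> C. (a, x) \<in> p_connected_rel S} = {}"
    using connectedD[OF C(2), of "{x \<in> C. (a, x) \<in> p_connected_rel S}" "{x \<in> C. (a, x) \<notin> p_connected_rel S}"]
    by blast
  moreover have "(a, a) \<in> p_connected_rel S" using a C(4) p_connected_segment[of a a S] by auto
  ultimately have "C \<subseteq> p_connected_rel S `` {a}" using a by auto
  moreover have "p_connected_rel S `` {a} \<in> p_components S" using a C(4) by (auto simp: p_components_def quotientI)
  moreover have "p_connected_rel S `` {a} \<subseteq> S" by (auto simp: p_connected_rel_def)
  ultimately show thesis using that by blast
qed

text \<open>It suffices that loops in \<open>C\<close> have winding number 0 around points outside
  \<open>C\<close>. A bad point would lie in another component of the same open set; that whole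
  component would then have nonzero winding number, whereas its frontier points lie outside the open
  set and have winding number 0.\<close>

lemma simply_connected_component:
  assumes S: "p_componentwise_simply_connected S" and B: "open B" "convex B" "bounded B"
    and C: "C \<in> components (interior S \<inter> B)"
  shows "simply_connected C"
proof -
  define U where "U = interior S \<inter> B"
  have oU: "open U" using B by (simp add: U_def open_Int)
  have oC: "open C" using C oU open_components U_def by blast
  have cC: "connected C" and neC: "C \<noteq> {}" and CU: "C \<subseteq> U" 
    using in_components_connected[OF C] in_components_nonempty[OF C] in_components_subset[OF C] by (simp_all add: U_def)
  have "C \<subseteq> S" using CU interior_subset by (auto simp: U_def)
  from connected_in_p_component[OF oC cC neC this] obtain K where K: "K \<in> p_components S" "C \<subseteq> K" "K \<subseteq> S"
    by metis
  have scK: "simply_connected K" using S K by (auto simp: p_componentwise_simply_connected_def)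
  have "winding_number g z = 0"
    if g: "path g" "path_image g \<subseteq> cx ` C" "pathfinish g = pathstart g" and z: "z \<notin> cx ` C" for g z
  proof (rule ccontr)
    assume nz: "winding_number g z \<noteq> 0"
    \<comment> \<open>Winding numbers vanish outside the simply connected \<open>K\<close> and
      outside the convex \<open>B\<close>. Since \<open>W\<close> is open, it lies even in
      \<open>interior S\<close> and not just in \<open>K\<close>.\<close>
    define W where "W = {v. cx v \<notin> path_image g \<and> winding_number g (cx v) \<noteq> 0}"
    have oW: "open W" using open_winding_cx[OF g(1,3), of "\<lambda>k. k \<noteq> 0"] by (simp add: W_def)
    have "W \<subseteq> K"
    proof
      fix v assume "v \<in> W"
      moreover have "winding_number g (cx v) = 0" if "v \<notin> K"
        by (rule simply_connected_imp_winding_number_zero[of "cx ` K"])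
          (use that g K scK simply_connected_cx in auto)
      ultimately show "v \<in> K" by (auto simp: W_def)
    qed
    moreover have "W \<subseteq> B"
    proof
      fix v assume "v \<in> W"
      moreover have piB: "path_image g \<subseteq> cx ` B" using g(2) CU by (metis Int_lower2 U_def image_mono subset_trans)
      have "winding_number g (cx v) = 0" if "v \<notin> B"
        by (rule winding_number_zero_outside[of _ "cx ` B"])
          (use that g B piB linear_cx convex_linear_image in auto)
      ultimately show "v \<in> B" by (auto simp: W_def)
    qed
    ultimately have WU: "W \<subseteq> U" using K oW interior_maximal[OF _ oW, of S] by (auto simp: U_def)
    define v where "v = xc z"
    have v: "v \<notin> C" using z cx_image_iff[of v C] by (simp add: v_def)
    have "z \<notin> path_image g" using z g(2) by auto
    then have v: "v \<in> W" "v \<notin> C" using nz v by (auto simp: W_def v_def)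
    define D where "D = connected_component_set U v"
    have vU: "v \<in> U" using v WU by auto
    have D: "D \<in> components U" "v \<in> D" "connected D" "open D"
      using vU oU by (auto simp: D_def componentsI open_connected_component)
    have DC: "D \<inter> C = {}" 
      using components_nonoverlap[OF D(1) C[folded U_def]] D v by auto
    have DW: "D \<subseteq> W"
    proof
      fix w assume w: "w \<in> D"
      have disj: "cx ` D \<inter> path_image g = {}" 
      proof -
        have False if "x \<in> D" "cx x \<in> path_image g" for x
          using DC that subsetD[OF g(2) that(2)] by auto
        then show ?thesis by auto
      qed 
      have "winding_number g (cx w) = winding_number g (cx v)"
        by (rule winding_number_eq[OF g(1,3), of _ "cx ` D"])
          (use w D disj in \<open>auto intro!: connected_continuous_image continuous_on_cx\<close>)
      then show "w \<in> W" using v disj w by (auto simp: W_def)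
    qed
    \<comment> \<open>Boundedness of \<open>B\<close> provides a frontier point \<open>y\<close> of
      \<open>D\<close>. The winding number is 0 near \<open>y\<close>, although \<open>D\<close>
      comes arbitrarily close to it.\<close>
    have "D \<noteq> UNIV" using D in_components_subset B not_bounded_UNIV bounded_subset
      by (metis Int_lower2 U_def)
    then obtain y where y: "y \<in> frontier D" using frontier_eq_empty D(2) by blast
    have "frontier D \<subseteq> frontier U" using frontier_of_components_subset D(1) by blast
    then have yU: "y \<notin> U" using y oU frontier_disjoint_eq by blast
    then have yW: "y \<notin> W" using WU by auto
    define Z where "Z = {v. cx v \<notin> path_image g \<and> winding_number g (cx v) = 0}"
    have "open Z" using open_winding_cx[OF g(1,3), of "\<lambda>k. k = 0"] by (simp add: Z_def)
    moreover have "cx y \<notin> path_image g" using subsetD[OF g(2), of "cx y"] yU CU by auto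
    then have "y \<in> Z" using yW by (simp add: W_def Z_def)
    moreover have "y \<in> closure D" using y by (auto simp: frontier_def)
    ultimately have "Z \<inter> D \<noteq> {}" using open_Int_closure_eq_empty[of Z D] by auto
    then show False using DW by (auto simp: Z_def W_def)
  qed
  then have "simply_connected (cx ` C)"
    using simply_connected_eq_winding_number_zero[OF open_cx[OF oC]]
      connected_continuous_image[OF continuous_on_cx cC] by blast
  then show ?thesis by (simp add: simply_connected_cx)
qed

section \<open>Almost every visible segment lies in the interior\<close>

text \<open>By compactness a tube of uniform radius around the segment lies in \<open>U\<close>;
  moving both endpoints by less than that radius keeps the segment in the tube.\<close>

lemma open_visible_pairs:
  fixes U :: "'a::euclidean_space set"
  assumes "open U"
  shows "open {(A, B). closed_segment A B \<subseteq> U}"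
proof (subst open_contains_ball, intro ballI)
  fix z assume "z \<in> {(A, B). closed_segment A B \<subseteq> U}"
  then obtain A B where z: "z = (A, B)" "closed_segment A B \<subseteq> U" by auto
  obtain e where e: "e > 0" "(\<Union>x\<in>closed_segment A B. ball x e) \<subseteq> U"
    using compact_subset_open_imp_ball_epsilon_subset[OF compact_segment assms z(2)] by metis
  have "ball z e \<subseteq> {(A, B). closed_segment A B \<subseteq> U}"
  proof
    fix w assume w: "w \<in> ball z e"
    obtain A' B' where w': "w = (A', B')" by (cases w)
    have d: "norm (A' - A) < e" "norm (B' - B) < e"
      using w dist_fst_le[of z w] dist_snd_le[of z w] by (auto simp: w' z dist_norm norm_minus_commute)
    have "closed_segment A' B' \<subseteq> U"
    proof
      fix y assume "y \<in> closed_segment A' B'"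
      then obtain t where t: "0 \<le> t" "t \<le> 1" "y = (1 - t) *\<^sub>R A' + t *\<^sub>R B'"
        by (auto simp: in_segment)
      define x where "x = (1 - t) *\<^sub>R A + t *\<^sub>R B"
      have xAB: "x \<in> closed_segment A B" using t by (auto simp: in_segment x_def)
      have "y - x = (1 - t) *\<^sub>R (A' - A) + t *\<^sub>R (B' - B)"
        by (simp add: t x_def algebra_simps)
      then have "norm (y - x) \<le> (1 - t) * norm (A' - A) + t * norm (B' - B)"
        using norm_triangle_ineq[of "(1 - t) *\<^sub>R (A' - A)" "t *\<^sub>R (B' - B)"] t by simp
      also have "\<dots> < e"
        using convex_bound_lt[OF d, of "1 - t" t] t by simp
      finally have "y \<in> ball x e" by (simp add: dist_norm norm_minus_commute)
      then show "y \<in> U" by (rule subsetD[OF e(2) UN_I[OF xAB]])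
    qed
    then show "w \<in> {(A, B). closed_segment A B \<subseteq> U}" by (simp add: w')
  qed
  with e(1) show "\<exists>e>0. ball z e \<subseteq> {(A, B). closed_segment A B \<subseteq> U}" by blast
qed

lemma Seg_eq: "Seg S = {(A, B). closed_segment A B \<subseteq> S}"
  by (auto simp: Seg_def)

lemma open_Seg: "open U \<Longrightarrow> open (Seg U)"
  using open_visible_pairs[of U] by (simp add: Seg_eq)

text \<open>The quadrilateral with vertices \<open>B + \<rho> e1\<close>, \<open>A + \<rho> e2\<close>, \<open>B + 2 \<rho> e2\<close>, \<open>A - \<rho> e2\<close>
  winds around the half of \<open>AB\<close> next to \<open>B\<close>.\<close>

lemma half_segment_in_interior:
  fixes A B e1 e2 :: "real^2"
  assumes S: "p_componentwise_simply_connected S"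
    and AB: "B - A = m *\<^sub>R e1 + b *\<^sub>R e2" and m: "m > 0" and b: "\<bar>b\<bar> < \<rho>" and e: "det2 e1 e2 \<noteq> 0"
    and s: "closed_segment (A + \<rho> *\<^sub>R e2) (B + \<rho> *\<^sub>R e1) \<subseteq> S"
      "closed_segment (A + \<rho> *\<^sub>R e2) (B + (2 * \<rho>) *\<^sub>R e2) \<subseteq> S"
      "closed_segment (A - \<rho> *\<^sub>R e2) (B + \<rho> *\<^sub>R e1) \<subseteq> S"
      "closed_segment (A - \<rho> *\<^sub>R e2) (B + (2 * \<rho>) *\<^sub>R e2) \<subseteq> S"
    and t: "1/2 \<le> t" "t \<le> 1"
  shows "A + t *\<^sub>R (B - A) \<in> interior S"
proof -
  define A1 A2 B1 B2 where "A1 = A + \<rho> *\<^sub>R e2" and "A2 = A - \<rho> *\<^sub>R e2" 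
    and "B1 = B + \<rho> *\<^sub>R e1" and "B2 = B + (2 * \<rho>) *\<^sub>R e2"
  note defs = A1_def A2_def B1_def B2_def
  have \<rho>: "\<rho> > 0" using b by linarith
  have B: "B = A + m *\<^sub>R e1 + b *\<^sub>R e2" using AB by (simp add: algebra_simps)
  define Z where "Z = A + t *\<^sub>R (B - A)"
  note eqv = equiv_p_connected_rel[of S]
  have rel: "(B1, A1) \<in> p_connected_rel S" "(A1, B2) \<in> p_connected_rel S"
    "(B2, A2) \<in> p_connected_rel S" "(A2, B1) \<in> p_connected_rel S"
    using s by (auto simp: defs closed_segment_commute intro!: p_connected_segment)
  define K where "K = p_connected_rel S `` {B1}"
  have "B1 \<in> S" using s(1) by (auto simp: defs)
  then have K: "K \<in> p_components S" by (auto simp: K_def p_components_def quotientI)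
  have KS: "K \<subseteq> S" by (auto simp: K_def p_connected_rel_def)
  have scK: "simply_connected K" using S K by (auto simp: p_componentwise_simply_connected_def)
  have tr: "trans (p_connected_rel S)" using eqv by (auto elim: equivE)
  have seg: "closed_segment x y \<subseteq> K" if "closed_segment x y \<subseteq> S" "(B1, x) \<in> p_connected_rel S" for x y
  proof
    fix w assume "w \<in> closed_segment x y"
    then have "closed_segment x w \<subseteq> S" using that(1) by (meson subset_trans ends_in_segment(1) subset_closed_segment)
    then have "(x, w) \<in> p_connected_rel S" by (rule p_connected_segment)
    then show "w \<in> K" using tr that(2) by (auto simp: K_def dest: transD)
  qed
  have r: "(B1, B1) \<in> p_connected_rel S" "(B1, A1) \<in> p_connected_rel S" "(B1, B2) \<in> p_connected_rel S" "(B1, A2) \<in> p_connected_rel S"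
    using rel tr by (auto dest: transD)
  have sK: "closed_segment B1 A1 \<subseteq> K" "closed_segment A1 B2 \<subseteq> K" "closed_segment B2 A2 \<subseteq> K" "closed_segment A2 B1 \<subseteq> K"
    using seg[of B1 A1] seg[of A1 B2] seg[of B2 A2] seg[of A2 B1] s r by (auto simp: defs closed_segment_commute)
  have c: "det2 (A1 - B1) (A2 - B1) = 2 * \<rho> * (m + \<rho>) * det2 e1 e2"
    by (simp add: defs B det2_simps det2_swap[of e2 e1]) (simp add: algebra_simps)
  have c0: "det2 (A1 - B1) (A2 - B1) \<noteq> 0" using c \<rho> m e by simp
  \<comment> \<open>\<open>g\<close> is the barycentric weight of \<open>B1\<close> and
    \<open>d\<close> the difference of the weights of \<open>A1\<close> and \<open>A2\<close>, read
    off from the coefficients of \<open>e1\<close> and \<open>e2\<close>.\<close>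
  define g where "g = t * m / (m + \<rho>)"
  have mr: "m + \<rho> > 0" using m \<rho> by simp
  have g1: "g * (m + \<rho>) = t * m" using mr by (simp add: g_def)
  have g0: "g > 0" using t m mr by (simp add: g_def)
  define d where "d = b * t / (m + \<rho>)"
  have d1: "d * (m + \<rho>) = b * t" using mr by (simp add: d_def)
  have "\<bar>b\<bar> * t \<le> \<bar>b\<bar> * 1" by (rule mult_left_mono) (use t in auto)
  then have "\<bar>b * t\<bar> < \<rho>" using b t by (simp add: abs_mult)
  also have "\<rho> \<le> (1 - g) * (m + \<rho>)" using g1 t m by (simp add: algebra_simps)
  finally have "\<bar>b * t\<bar> < (1 - g) * (m + \<rho>)" .
  moreover have "\<bar>d\<bar> * (m + \<rho>) = \<bar>b * t\<bar>" unfolding d1[symmetric] abs_mult using mr by simp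
  ultimately have "\<bar>d\<bar> * (m + \<rho>) < (1 - g) * (m + \<rho>)" by simp
  then have dg: "\<bar>d\<bar> < 1 - g" using mr by simp
  have Zint: "Z \<in> interior (convex hull {B1, A1, A2})"
  proof (rule bary_in_interior[OF c0 g0, of "(1 - g + d)/2" "(1 - g - d)/2"])
    have "Z - (g *\<^sub>R B1 + ((1 - g + d)/2) *\<^sub>R A1 + ((1 - g - d)/2) *\<^sub>R A2) 
       = (t * m - g * (m + \<rho>)) *\<^sub>R e1 + (t * b - g * b - d * \<rho>) *\<^sub>R e2"
      by (simp add: Z_def defs B vec_eq_iff) (simp add: field_simps)
    moreover have "t * b - g * b - d * \<rho> = 0"
    proof -
      have "(t * b - g * b - d * \<rho>) * (m + \<rho>) = t * b * (m + \<rho>) - (g * (m + \<rho>)) * b - (d * (m + \<rho>)) * \<rho>"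
        by (simp add: algebra_simps)
      also have "\<dots> = 0" unfolding g1 d1 by (simp add: algebra_simps)
      finally show ?thesis using mr by simp
    qed
    ultimately show "Z = g *\<^sub>R B1 + ((1 - g + d)/2) *\<^sub>R A1 + ((1 - g - d)/2) *\<^sub>R A2"
      using g1 by simp
  qed (use dg in \<open>auto simp: field_simps\<close>)
  \<comment> \<open>In this triangle the weight of \<open>B2\<close> would be \<open>t\<close> and
    that of \<open>A2\<close> at least \<open>2 * t\<close>, more than 1 in all. Here
    \<open>1/2 \<le> t\<close> and the factor 2 in \<open>B2\<close> enter.\<close>
  have Zout: "Z \<notin> convex hull {A1, B2, A2}"
  proof
    assume "Z \<in> convex hull {A1, B2, A2}"
    then obtain x y z where xyz: "0 \<le> x" "0 \<le> y" "0 \<le> z" "x + y + z = 1"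
      "Z = x *\<^sub>R A1 + y *\<^sub>R B2 + z *\<^sub>R A2"
      by (auto simp: convex_hull_3)
    have x: "x = 1 - y - z" using xyz by simp
    have "0 = ((y - t) * m) *\<^sub>R e1 + ((y - t) * b + (1 - y - 2 * z + 2 * y) * \<rho>) *\<^sub>R e2"
      using xyz(5) unfolding x by (simp add: Z_def defs B vec_eq_iff) (simp add: algebra_simps)
    then have "det2 (((y - t) * m) *\<^sub>R e1 + ((y - t) * b + (1 - y - 2 * z + 2 * y) * \<rho>) *\<^sub>R e2) e2 = 0"
      "det2 e1 (((y - t) * m) *\<^sub>R e1 + ((y - t) * b + (1 - y - 2 * z + 2 * y) * \<rho>) *\<^sub>R e2) = 0"
      by simp_all
    then have "y = t" "1 + y - 2 * z = 0" using e m \<rho> by (auto simp: det2_simps)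
    then show False using xyz t by linarith
  qed
  \<comment> \<open>Nonzero winding number is an open condition that holds inside \<open>K\<close>
    only; this places \<open>Z\<close> in the interior of \<open>S\<close> and not merely in
    \<open>S\<close>.\<close>
  define W where "W = {v. v \<notin> closed_segment B1 A1 \<union> closed_segment A1 B2 \<union> closed_segment B2 A2 \<union> closed_segment A2 B1
      \<and> wn_quad B1 A1 B2 A2 v \<noteq> 0}"
  have n: "Z \<notin> closed_segment A1 B2" "Z \<notin> closed_segment B2 A2"
    unfolding segment_convex_hull
    using Zout hull_mono[of "{A1, B2}" "{A1, B2, A2}" convex] hull_mono[of "{B2, A2}" "{A1, B2, A2}" convex] by blast+
  have "Z \<in> W" unfolding W_def
    using wn_quad_nonzero[OF Zint c0 n] Zout n interior_triangle_not_segments[OF Zint] by blast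
  moreover have "open W" unfolding W_def by (rule wn_quad_open)
  moreover have "W \<subseteq> K" using wn_quad_simply_connected[OF scK sK] by (auto simp: W_def)
  ultimately show ?thesis using KS interiorI[of W Z S] by (auto simp: Z_def)
qed

text \<open>The first four offsets are the sides of the quadrilateral for the half next to
  \<open>B\<close>, the other four those for the half next to \<open>A\<close>, obtained by
  exchanging \<open>A\<close> and \<open>B\<close> and reversing \<open>e1\<close>.\<close>

lemma segment_in_interior:
  fixes A B e1 e2 :: "real^2"
  assumes S: "p_componentwise_simply_connected S"
    and AB: "B - A = m *\<^sub>R e1 + b *\<^sub>R e2" and m: "m > 0" and b: "\<bar>b\<bar> < \<rho>" and e: "det2 e1 e2 \<noteq> 0"
    and s: "\<And>x y. (x, y) \<in> {(\<rho> *\<^sub>R e2, \<rho> *\<^sub>R e1), (\<rho> *\<^sub>R e2, (2 * \<rho>) *\<^sub>R e2), (- \<rho> *\<^sub>R e2, \<rho> *\<^sub>R e1),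
        (- \<rho> *\<^sub>R e2, (2 * \<rho>) *\<^sub>R e2), (- \<rho> *\<^sub>R e1, \<rho> *\<^sub>R e2), ((2 * \<rho>) *\<^sub>R e2, \<rho> *\<^sub>R e2), 
        (- \<rho> *\<^sub>R e1, - \<rho> *\<^sub>R e2), ((2 * \<rho>) *\<^sub>R e2, - \<rho> *\<^sub>R e2)} \<Longrightarrow> closed_segment (A + x) (B + y) \<subseteq> S"
  shows "closed_segment A B \<subseteq> interior S"
proof
  fix z assume "z \<in> closed_segment A B"
  then obtain t where t: "0 \<le> t" "t \<le> 1" "z = (1 - t) *\<^sub>R A + t *\<^sub>R B" by (auto simp: in_segment)
  show "z \<in> interior S"
  proof (cases "1/2 \<le> t")
    case True
    have "A + t *\<^sub>R (B - A) \<in> interior S"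
      by (rule half_segment_in_interior[OF S AB m b e _ _ _ _ True t(2)])
        (use s[of "\<rho> *\<^sub>R e2" "\<rho> *\<^sub>R e1"] s[of "\<rho> *\<^sub>R e2" "(2 * \<rho>) *\<^sub>R e2"] s[of "- \<rho> *\<^sub>R e2" "\<rho> *\<^sub>R e1"]
          s[of "- \<rho> *\<^sub>R e2" "(2 * \<rho>) *\<^sub>R e2"] in simp_all)
    moreover have "z = A + t *\<^sub>R (B - A)" using t by (simp add: algebra_simps)
    ultimately show ?thesis by simp
  next
    case False
    have AB': "A - B = m *\<^sub>R (- e1) + (- b) *\<^sub>R e2" using AB by (simp add: algebra_simps)
    have "B + (1 - t) *\<^sub>R (A - B) \<in> interior S"
      by (rule half_segment_in_interior[OF S AB' m])
        (use b e t False s[of "- \<rho> *\<^sub>R e1" "\<rho> *\<^sub>R e2"] s[of "(2 * \<rho>) *\<^sub>R e2" "\<rho> *\<^sub>R e2"] s[of "- \<rho> *\<^sub>R e1" "- \<rho> *\<^sub>R e2"]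
          s[of "(2 * \<rho>) *\<^sub>R e2" "- \<rho> *\<^sub>R e2"] in \<open>simp_all add: closed_segment_commute det2_simps\<close>)
    moreover have "z = B + (1 - t) *\<^sub>R (A - B)" using t by (simp add: algebra_simps)
    ultimately show ?thesis by simp
  qed
qed

text \<open>A one-ball form of the Lebesgue density theorem. If every small ball centred in
  \<open>N\<close> lost more than the proportion \<open>\<theta>\<close>, a disjoint Vitali family
  of such balls inside an open \<open>V\<close> slightly larger than \<open>N\<close> would lose
  more than \<open>V - N\<close> has to offer.\<close>

lemma dense_ball:
  fixes N :: "'a::euclidean_space set"
  assumes N: "N \<in> lmeasurable" "measure lebesgue N > 0" and \<theta>: "0 < \<theta>" and d: "d > 0"
  obtains x r where "x \<in> N" "0 < r" "r < d" 
    "measure lebesgue (ball x r - N) \<le> \<theta> * measure lebesgue (ball x r)"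
proof (cases "\<theta> < 1")
  case False
  obtain x where x: "x \<in> N" using N by fastforce
  have "measure lebesgue (ball x (d/2) - N) \<le> measure lebesgue (ball x (d/2))"
    by (intro measure_mono_fmeasurable) (use N in auto)
  also have "\<dots> \<le> \<theta> * measure lebesgue (ball x (d/2))"
    using False by (simp add: mult_le_cancel_right1)
  finally show ?thesis using that[of x "d/2"] x d by auto
next
  case True
  show ?thesis
  proof (rule ccontr)
    assume no: "\<not> thesis"
    define c where "c = measure lebesgue N"
    have "c * \<theta> > 0" using N \<theta> by (simp add: c_def)
    \<comment> \<open>The excess \<open>c * \<theta>\<close> is matched to the loss: the balls cover
      \<open>N\<close> up to a null set, so together they lose at least
      \<open>\<theta> * c\<close>.\<close>
    then obtain V where V: "open V" "N \<subseteq> V" and VN0: "V - N \<in> lmeasurable" "emeasure lebesgue (V - N) < ennreal (c * \<theta>)"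
      using sets_lebesgue_outer_open[of N "c * \<theta>"] N by (metis fmeasurableD)
    have "N \<union> (V - N) \<in> lmeasurable" using N VN0 by blast
    then have V3: "V \<in> lmeasurable" using V(2) by (simp add: Un_absorb1)
    have VN: "measure lebesgue (V - N) < c * \<theta>"
      using VN0 \<open>0 < c * \<theta>\<close> by (simp add: emeasure_eq_measure2 ennreal_less_iff)
    have bad: "\<theta> * measure lebesgue (ball x r) < measure lebesgue (ball x r - N)"
      if "x \<in> N" "0 < r" "r < d" for x r
      using no that that(1) \<open>\<And>x r. \<lbrakk>x \<in> N; 0 < r; r < d; measure lebesgue (ball x r - N) \<le> \<theta> * measure lebesgue (ball x r)\<rbrakk> \<Longrightarrow> thesis\<close>
      by (meson not_le)
    define K where "K = {(x, r). x \<in> N \<and> 0 < r \<and> r < d \<and> ball x r \<subseteq> V}"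
    obtain C where C: "countable C" "C \<subseteq> K" "pairwise (\<lambda>i j. disjnt (ball (fst i) (snd i)) (ball (fst j) (snd j))) C"
      "negligible (N - (\<Union>i\<in>C. ball (fst i) (snd i)))"
    proof (rule Vitali_covering_theorem_balls[of N K fst snd])
      fix x e :: real and y assume "y \<in> N" "0 < e"
      then obtain r where r: "r > 0" "ball y r \<subseteq> V" using V open_contains_ball by blast
      show "\<exists>i. i \<in> K \<and> y \<in> ball (fst i) (snd i) \<and> snd i < e"
        by (rule exI[of _ "(y, min (r/2) (min (e/2) (d/2)))"])
          (use r \<open>0 < e\<close> \<open>y \<in> N\<close> d in \<open>auto simp: K_def\<close>)
    qed auto
    define B where "B = (\<Union>i\<in>C. ball (fst i) (snd i))"
    have dis: "disjoint_family_on (\<lambda>i. ball (fst i) (snd i)) C"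
      using C(3) by (auto simp: disjoint_family_on_def pairwise_def disjnt_def)
    have dis2: "disjoint_family_on (\<lambda>i. ball (fst i) (snd i) - N) C"
      using dis unfolding disjoint_family_on_def by blast
    have "ball (fst i) (snd i) \<subseteq> V" if "i \<in> C" for i
      using subsetD[OF C(2) that] by (simp add: K_def case_prod_beta)
    then have BV: "B \<subseteq> V" unfolding B_def by blast
    have oB: "open B" by (auto simp: B_def)
    have Bm: "B \<in> lmeasurable" using BV V3 oB by (intro fmeasurableI2[OF V3 BV]) (auto intro: borel_open)
    have "ennreal \<theta> * emeasure lebesgue B = (\<integral>\<^sup>+i. ennreal \<theta> * emeasure lebesgue (ball (fst i) (snd i)) \<partial>count_space C)"
      unfolding B_def using C(1) dis by (subst emeasure_UN_countable) (auto simp: nn_integral_cmult)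
    also have "\<dots> \<le> (\<integral>\<^sup>+i. emeasure lebesgue (ball (fst i) (snd i) - N) \<partial>count_space C)"
    proof (rule nn_integral_mono)
      fix i assume "i \<in> space (count_space C)"
      then have i: "i \<in> K" using C(2) by auto
      have "ball (fst i) (snd i) - N \<in> lmeasurable" using N by (auto intro: fmeasurable.Diff)
      then show "ennreal \<theta> * emeasure lebesgue (ball (fst i) (snd i)) \<le> emeasure lebesgue (ball (fst i) (snd i) - N)"
        using bad[of "fst i" "snd i"] i \<theta>
        by (auto simp: K_def emeasure_eq_measure2 ennreal_mult[symmetric] less_imp_le intro!: ennreal_leI)
    qed
    also have "\<dots> = emeasure lebesgue (B - N)"
    proof -
      have "B - N = (\<Union>i\<in>C. ball (fst i) (snd i) - N)" by (auto simp: B_def)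
      then show ?thesis using C(1) dis2 N by (subst emeasure_UN_countable[symmetric]) (auto intro: fmeasurableD)
    qed
    finally have "\<theta> * measure lebesgue B \<le> measure lebesgue (B - N)"
      using Bm N \<theta> fmeasurable.Diff[OF Bm, of N] 
      by (auto simp: emeasure_eq_measure2 ennreal_mult[symmetric] fmeasurableD)
    also have "\<dots> \<le> measure lebesgue (V - N)"
      by (intro measure_mono_fmeasurable) (use BV V3 N Bm in \<open>auto intro: fmeasurable.Diff fmeasurableD\<close>)
    also have "\<dots> < \<theta> * c" using VN by (simp add: mult.commute)
    also have "c \<le> measure lebesgue B"
    proof -
      have "c \<le> measure lebesgue (N \<inter> B) + measure lebesgue (N - B)"
        using measure_Un_le[of "N \<inter> B" lebesgue "N - B"] N Bm by (auto simp: c_def Int_Diff_Un fmeasurableD)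
      moreover have "measure lebesgue (N - B) = 0"
        using C(4) by (simp add: B_def negligible_imp_measure0)
      moreover have "measure lebesgue (N \<inter> B) \<le> measure lebesgue B"
        by (intro measure_mono_fmeasurable) (use Bm N in auto)
      ultimately show ?thesis by simp
    qed
    finally show False using \<theta> by simp
  qed
qed

lemma orthonormal_frame:
  fixes v :: "real^2"
  assumes "v \<noteq> 0"
  obtains e1 e2 where "norm e1 = 1" "norm e2 = 1" "det2 e1 e2 = 1" "e1 \<bullet> v = norm v" "e2 \<bullet> v = 0"
    "\<And>x. x = (e1 \<bullet> x) *\<^sub>R e1 + (e2 \<bullet> x) *\<^sub>R e2"
proof -
  define e1 where "e1 = v /\<^sub>R norm v"
  define e2 :: "real^2" where "e2 = vector [- e1$2, e1$1]"
  have n1: "norm e1 = 1" using assms by (simp add: e1_def)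
  have n2: "(norm x)\<^sup>2 = (x$1)\<^sup>2 + (x$2)\<^sup>2" for x :: "real^2"
    by (simp add: norm_vec_def L2_set_def sum_2)
  have q: "(e1$1)\<^sup>2 + (e1$2)\<^sup>2 = 1" using n2[of e1] n1 by simp
  have "(norm e2)\<^sup>2 = 1" using n2[of e2] q by (simp add: e2_def)
  then have "norm e2 = 1" by (simp add: power2_eq_1_iff) (smt (verit) norm_ge_zero)
  moreover have "det2 e1 e2 = 1" using q by (simp add: det2_def e2_def power2_eq_square)
  moreover have v: "v = norm v *\<^sub>R e1" using assms by (simp add: e1_def)
  have "e1 \<bullet> v = norm v" using n1 by (subst v) (simp add: dot_square_norm)
  moreover have "e2 \<bullet> v = 0" by (subst v) (simp add: inner_vec_def sum_2 e2_def)
  moreover have "x = (e1 \<bullet> x) *\<^sub>R e1 + (e2 \<bullet> x) *\<^sub>R e2" for x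
  proof -
    have "(e1 \<bullet> x) * e1$1 + (e2 \<bullet> x) * e2$1 = ((e1$1)\<^sup>2 + (e1$2)\<^sup>2) * x$1"
         "(e1 \<bullet> x) * e1$2 + (e2 \<bullet> x) * e2$2 = ((e1$1)\<^sup>2 + (e1$2)\<^sup>2) * x$2"
      by (simp_all add: inner_vec_def sum_2 e2_def power2_eq_square algebra_simps)
    then show ?thesis using q by (simp add: vec_eq_iff forall_2)
  qed
  ultimately show thesis using that n1 by blast
qed

text \<open>A union bound: if no \<open>w\<close> worked, the translates by \<open>- h\<close> of
  the part of the ball missing from \<open>N\<close> would cover \<open>ball z (s * R)\<close>,
  whose measure exceeds their total. The bounds on \<open>h\<close> and \<open>s\<close> keep
  \<open>w + h\<close> inside \<open>ball z R\<close>.\<close>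

lemma exists_common_translate:
  fixes N :: "'a::euclidean_space set"
  assumes N: "N \<in> lmeasurable" and H: "finite H" "\<And>h. h \<in> H \<Longrightarrow> norm h \<le> R / 2"
    and R: "R > 0" and dense: "measure lebesgue (ball z R - N) \<le> \<theta> * measure lebesgue (ball z R)"
    and s: "0 < s" "s \<le> 1/2" and \<theta>: "real (card H) * \<theta> < s ^ DIM('a)"
  obtains w where "w \<in> ball z (s * R)" "\<And>h. h \<in> H \<Longrightarrow> w + h \<in> N"
proof (rule ccontr)
  assume no: "\<not> thesis"
  define F where "F = (\<lambda>h. (+) (- h) ` (ball z R - N))"
  have bN: "ball z R - N \<in> lmeasurable" using N by (auto intro: fmeasurable.Diff)
  have F: "F h \<in> lmeasurable" "measure lebesgue (F h) = measure lebesgue (ball z R - N)" for h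
    using measurable_translation[OF bN, of "- h"] measure_translation[of "- h" "ball z R - N"]
    by (simp_all add: F_def)
  have "ball z (s * R) \<subseteq> (\<Union>h\<in>H. F h)"
  proof
    fix w assume w: "w \<in> ball z (s * R)"
    have "\<exists>h\<in>H. w + h \<notin> N" using no that[OF w] by blast
    then obtain h where h: "h \<in> H" "w + h \<notin> N" by blast
    have "dist z (w + h) \<le> dist z w + norm h"
      by (metis add_diff_cancel_left' dist_norm dist_commute dist_triangle)
    also have "\<dots> < s * R + R / 2" using w H(2)[OF h(1)] by simp
    also have "\<dots> \<le> R" using mult_right_mono[OF s(2), of R] R by linarith
    finally have "w + h \<in> ball z R - N" using h by simp
    then have "- h + (w + h) \<in> F h" unfolding F_def by (rule imageI)
    then show "w \<in> (\<Union>h\<in>H. F h)" using h by auto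
  qed
  then have "measure lebesgue (ball z (s * R)) \<le> measure lebesgue (\<Union>h\<in>H. F h)"
    by (intro measure_mono_fmeasurable) (use F H in \<open>auto intro!: fmeasurable.finite_UN\<close>)
  also have "\<dots> \<le> (\<Sum>h\<in>H. measure lebesgue (F h))"
    by (rule measure_UNION_le) (use F H in \<open>auto intro: fmeasurableD\<close>)
  also have "\<dots> \<le> real (card H) * (\<theta> * measure lebesgue (ball z R))"
    using dense F(2) by (intro sum_bounded_above) auto
  also have "\<dots> = real (card H) * \<theta> * measure lebesgue (ball z R)" by simp
  also have "\<dots> < s ^ DIM('a) * measure lebesgue (ball z R)"
    using \<theta> content_ball_pos[OF R, of z] by (intro mult_strict_right_mono) auto
  also have "\<dots> = measure lebesgue (ball z (s * R))"
    using content_ball[of R z] content_ball[of "s * R" z] R s by (simp add: power_mult_distrib)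
  finally show False by simp
qed

text \<open>If the bad pairs had positive measure, some bad pair would stay bad, hence visible,
  under all eight perturbations that \<open>segment_in_interior\<close> asks for. Its segment would
  then lie in the interior, so the pair was not bad.\<close>

lemma negligible_Seg_diff_interior:
  assumes S: "p_componentwise_simply_connected S" and m: "Seg S \<in> sets lebesgue"
  shows "negligible (Seg S - Seg (interior S))"
proof -
  define N0 where "N0 = Seg S - Seg (interior S)"
  have N0: "N0 \<in> sets lebesgue" using m open_Seg[of "interior S"] by (auto simp: N0_def)
  \<comment> \<open>The ball makes the measure finite. The lower bound on the distance exceeds the
    radius \<open>R\<close> chosen later, so small perturbations preserve the direction of the
    segment.\<close>
  define N where "N = (\<lambda>k::nat. N0 \<inter> {z. dist (fst z) (snd z) > 1 / Suc k} \<inter> ball 0 (real k))"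
  have N: "N k \<in> lmeasurable" for k
  proof -
    have "open {z :: (real^2) \<times> (real^2). dist (fst z) (snd z) > 1 / Suc k}"
      by (intro open_Collect_less continuous_intros)
    then have "{z :: (real^2) \<times> (real^2). dist (fst z) (snd z) > 1 / Suc k} \<in> sets lebesgue" by auto
    then show ?thesis unfolding N_def by (intro bounded_set_imp_lmeasurable) (use N0 in \<open>auto intro: bounded_subset\<close>)
  qed
  have "negligible (N k)" for k
  proof (rule ccontr)
    assume "\<not> negligible (N k)"
    then have "measure lebesgue (N k) > 0"
      using N[of k] by (metis negligible_iff_measure zero_less_measure_iff)
    define s :: real where "s = 1/32"
    \<comment> \<open>Nine offsets will be used, and 9/16 < 1. The value 1/32 of \<open>s\<close>
      keeps \<open>B - A\<close> within \<open>\<rho> / 2\<close> of \<open>v\<close>.\<close>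
    define \<theta> where "\<theta> = s ^ DIM((real^2) \<times> (real^2)) / 16"
    have \<theta>: "\<theta> > 0" by (simp add: \<theta>_def s_def)
    obtain z R where z: "z \<in> N k" and R: "0 < R" "R < 1 / Suc k" 
      and dense: "measure lebesgue (ball z R - N k) \<le> \<theta> * measure lebesgue (ball z R)"
      using dense_ball[OF N[of k] \<open>measure lebesgue (N k) > 0\<close> \<theta>, of "1 / Suc k"] by auto
    define v where "v = snd z - fst z"
    have nv: "norm v > R" using z R by (auto simp: N_def v_def dist_norm norm_minus_commute)
    then have "v \<noteq> 0" using R by auto
    obtain e1 e2 where e: "norm e1 = 1" "norm e2 = 1" "det2 e1 e2 = 1" "e1 \<bullet> v = norm v" "e2 \<bullet> v = 0"
      "\<And>x. x = (e1 \<bullet> x) *\<^sub>R e1 + (e2 \<bullet> x) *\<^sub>R e2"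
      using orthonormal_frame[OF \<open>v \<noteq> 0\<close>] by metis
    define \<rho> where "\<rho> = R / 8"
    \<comment> \<open>The zero offset makes \<open>(A, B)\<close> itself a bad pair.\<close>
    define L where "L = [(0, 0), (\<rho> *\<^sub>R e2, \<rho> *\<^sub>R e1), (\<rho> *\<^sub>R e2, (2 * \<rho>) *\<^sub>R e2), (- \<rho> *\<^sub>R e2, \<rho> *\<^sub>R e1),
        (- \<rho> *\<^sub>R e2, (2 * \<rho>) *\<^sub>R e2), (- \<rho> *\<^sub>R e1, \<rho> *\<^sub>R e2), ((2 * \<rho>) *\<^sub>R e2, \<rho> *\<^sub>R e2), 
        (- \<rho> *\<^sub>R e1, - \<rho> *\<^sub>R e2), ((2 * \<rho>) *\<^sub>R e2, - \<rho> *\<^sub>R e2)]"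
    define H where "H = set L"
    have "card H \<le> 9" using card_length[of L] by (simp add: H_def L_def)
    have nH: "norm h \<le> R / 2" if "h \<in> H" for h
    proof -
      have "norm (fst h) \<le> 2 * \<rho>" "norm (snd h) \<le> 2 * \<rho>"
        using that R e(1,2) by (auto simp: H_def L_def \<rho>_def)
      then have "norm (fst h) + norm (snd h) \<le> R / 2" by (simp add: \<rho>_def)
      then show ?thesis using norm_Pair_le[of "fst h" "snd h"] by simp
    qed
    have "real (card H) * \<theta> \<le> 9 * \<theta>" using \<open>card H \<le> 9\<close> \<theta> by simp
    also have "\<dots> < s ^ DIM((real^2) \<times> (real^2))" by (simp add: \<theta>_def s_def)
    finally have cH: "real (card H) * \<theta> < s ^ DIM((real^2) \<times> (real^2))" .
    obtain w where w: "w \<in> ball z (s * R)" "\<And>h. h \<in> H \<Longrightarrow> w + h \<in> N k"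
      using exists_common_translate[OF N _ nH R(1) dense _ _ cH] by (auto simp: s_def H_def)
    obtain A B where AB: "w = (A, B)" by (cases w)
    have inN: "(A + x, B + y) \<in> N k" if "(x, y) \<in> H" for x y using w(2)[OF that] by (simp add: AB)
    define u where "u = (B - A) - v"
    have "norm (A - fst z) \<le> s * R" "norm (B - snd z) \<le> s * R"
      using w(1) dist_fst_le[of z w] dist_snd_le[of z w] by (auto simp: AB dist_norm norm_minus_commute)
    moreover have "u = (B - snd z) - (A - fst z)" by (simp add: u_def v_def)
    ultimately have nu: "norm u \<le> \<rho> / 2" 
      using norm_triangle_ineq4[of "B - snd z" "A - fst z"] by (simp add: \<rho>_def s_def)
    have "\<bar>e1 \<bullet> u\<bar> \<le> \<rho> / 2" "\<bar>e2 \<bullet> u\<bar> \<le> \<rho> / 2"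
      using Cauchy_Schwarz_ineq2[of e1 u] Cauchy_Schwarz_ineq2[of e2 u] e nu by auto
    moreover have "e1 \<bullet> (B - A) = norm v + e1 \<bullet> u" "e2 \<bullet> (B - A) = e2 \<bullet> u"
      using e by (simp_all add: u_def inner_diff_right)
    ultimately have mb: "e1 \<bullet> (B - A) > 0" "\<bar>e2 \<bullet> (B - A)\<bar> < \<rho>" using nv R by (auto simp: \<rho>_def)
    have "closed_segment A B \<subseteq> interior S"
    proof (rule segment_in_interior[OF S e(6)[of "B - A"] mb])
      show "closed_segment (A + x) (B + y) \<subseteq> S"
        if "(x, y) \<in> {(\<rho> *\<^sub>R e2, \<rho> *\<^sub>R e1), (\<rho> *\<^sub>R e2, (2 * \<rho>) *\<^sub>R e2), (- \<rho> *\<^sub>R e2, \<rho> *\<^sub>R e1),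
        (- \<rho> *\<^sub>R e2, (2 * \<rho>) *\<^sub>R e2), (- \<rho> *\<^sub>R e1, \<rho> *\<^sub>R e2), ((2 * \<rho>) *\<^sub>R e2, \<rho> *\<^sub>R e2), 
        (- \<rho> *\<^sub>R e1, - \<rho> *\<^sub>R e2), ((2 * \<rho>) *\<^sub>R e2, - \<rho> *\<^sub>R e2)}" for x y
        using inN[of x y] that by (auto simp: H_def L_def N_def N0_def Seg_eq)
    qed (use e in simp)
    moreover have "(A, B) \<in> N k" using inN[of 0 0] by (simp add: H_def L_def)
    ultimately show False by (auto simp: N_def N0_def Seg_eq)
  qed
  then have "negligible (\<Union>k. N k)" by (rule negligible_Union_nat)
  moreover have "negligible {z :: (real^2) \<times> (real^2). (axis 1 1, - axis 1 1) \<bullet> z = 0}"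
    by (rule negligible_hyperplane) (simp add: zero_prod_def axis_eq_0_iff)
  ultimately have "negligible ((\<Union>k. N k) \<union> {z :: (real^2) \<times> (real^2). (axis 1 1, - axis 1 1) \<bullet> z = 0})"
    by (rule negligible_Un)
  moreover have "N0 \<subseteq> (\<Union>k. N k) \<union> {z. (axis 1 1, - axis 1 1) \<bullet> z = 0}"
  proof
    fix z assume z: "z \<in> N0"
    show "z \<in> (\<Union>k. N k) \<union> {z. (axis 1 1, - axis 1 1) \<bullet> z = 0}"
    proof (cases "fst z = snd z")
      case True
      then show ?thesis by (cases z) (simp add: inner_axis')
    next
      case False
      obtain k1 k2 :: nat where k: "inverse (Suc k1) < dist (fst z) (snd z)" "norm z < k2"
        using reals_Archimedean[of "dist (fst z) (snd z)"] reals_Archimedean2[of "norm z"] False by auto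
      define k where "k = max k1 k2"
      have "1 / real (Suc k) \<le> inverse (Suc k1)" by (simp add: k_def field_simps)
      then have "z \<in> N k" using z k by (auto simp: N_def k_def)
      then show ?thesis by auto
    qed
  qed
  ultimately show ?thesis unfolding N0_def by (rule negligible_subset)
qed

section \<open>Chords, pockets and bodies\<close>

text \<open>The signed distance from the line through \<open>p\<close> and \<open>q\<close>, scaled
  by \<open>norm (q - p)\<close>.\<close>

definition side :: "real^2 \<Rightarrow> real^2 \<Rightarrow> real^2 \<Rightarrow> real" where
  "side p q z = det2 (q - p) (z - p)"

lemma side_swap: "side q p z = - side p q z"
  by (simp add: side_def det2_def algebra_simps)

lemma side_affine: "side p q ((1 - t) *\<^sub>R x + t *\<^sub>R y) = (1 - t) * side p q x + t * side p q y"
  by (simp add: side_def det2_def algebra_simps)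

lemma side_segment:
  assumes "z \<in> closed_segment x y"
  obtains t where "0 \<le> t" "t \<le> 1" "z = (1 - t) *\<^sub>R x + t *\<^sub>R y" "side p q z = (1 - t) * side p q x + t * side p q y"
  using assms that by (metis in_segment(1) side_affine)

lemma side_base [simp]: "side p q p = 0" "side p q q = 0"
  by (simp_all add: side_def)

lemma side_open_segment: "z \<in> open_segment p q \<Longrightarrow> side p q z = 0"
  by (auto simp: in_segment side_affine)

lemma side_diff:
  assumes "side p q y = 0"
  shows "side p q z = det2 (q - p) (z - y)"
  using assms by (simp add: side_def det2_simps)

lemma continuous_on_side [continuous_intros]:
  "continuous_on S f \<Longrightarrow> continuous_on S (\<lambda>x. side p q (f x))"
  unfolding side_def by (intro continuous_intros)

lemma convex_side_pos: "convex {z. side p q z > 0}"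
  unfolding convex_alt by (auto simp: side_affine) (smt (verit) mult_nonneg_nonneg mult_pos_pos)

lemma on_line:
  assumes "side p q z = 0" "p \<noteq> q"
  obtains t where "z = p + t *\<^sub>R (q - p)"
  using det2_zero_parallel[of "q - p" "z - p"] assms unfolding side_def
  by (metis diff_add_cancel add.commute eq_iff_diff_eq_0)

lemma line_open_segment:
  assumes "p \<noteq> q"
  shows "p + t *\<^sub>R (q - p) \<in> open_segment p q \<longleftrightarrow> 0 < t \<and> t < 1"
proof -
  have e: "p + t *\<^sub>R (q - p) = (1 - t) *\<^sub>R p + t *\<^sub>R q" by (simp add: algebra_simps)
  have "s = t" if "(1 - t) *\<^sub>R p + t *\<^sub>R q = (1 - s) *\<^sub>R p + s *\<^sub>R q" for s
  proof -
    have "(t - s) *\<^sub>R (q - p) = 0" using that by (simp add: algebra_simps)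
    then show ?thesis using assms by simp
  qed
  then show ?thesis unfolding e using assms by (auto simp: in_segment)
qed

lemma open_segment_line_ball:
  assumes "x \<in> open_segment p q"
  obtains e where "e > 0" "\<And>z. z \<in> ball x e \<Longrightarrow> side p q z = 0 \<Longrightarrow> z \<in> open_segment p q"
proof -
  have pq: "p \<noteq> q" using assms by auto
  obtain t where t: "0 < t" "t < 1" "x = p + t *\<^sub>R (q - p)"
    using assms by (auto simp: in_segment algebra_simps)
  show thesis
  proof
    show "min t (1 - t) * norm (q - p) > 0" using t pq by auto
    fix z assume z: "z \<in> ball x (min t (1 - t) * norm (q - p))" "side p q z = 0"
    obtain s where s: "z = p + s *\<^sub>R (q - p)" using on_line[OF z(2) pq] .
    have "x - z = (t - s) *\<^sub>R (q - p)" by (simp add: s t algebra_simps)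
    then have "\<bar>t - s\<bar> * norm (q - p) < min t (1 - t) * norm (q - p)" using z(1) by (simp add: dist_norm)
    then have "\<bar>t - s\<bar> < min t (1 - t)" using pq by (simp add: mult_less_cancel_right)
    then have "0 < s" "s < 1" by auto
    then show "z \<in> open_segment p q" by (simp add: s line_open_segment[OF pq])
  qed
qed

lemma side_pos_near:
  assumes "p \<noteq> q" "side p q x = 0" "e > 0"
  obtains z where "z \<in> ball x e" "side p q z > 0"
proof -
  define n :: "real^2" where "n = vector [- (q - p)$2, (q - p)$1]"
  have c: "det2 (q - p) n = (norm (q - p))\<^sup>2"
    by (simp add: det2_def n_def norm_vec_def L2_set_def sum_2 power2_eq_square) (simp add: algebra_simps)
  then have cp: "det2 (q - p) n > 0" using assms(1) by simp
  then have n0: "n \<noteq> 0" by auto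
  define z where "z = x + (e / (2 * norm n)) *\<^sub>R n"
  have "dist x z = e / 2" using n0 assms(3) by (simp add: z_def dist_norm)
  then have "z \<in> ball x e" using assms(3) by simp
  moreover have "side p q z = (e / (2 * norm n)) * det2 (q - p) n"
    using side_diff[OF assms(2), of z] by (simp add: z_def det2_simps)
  then have "side p q z > 0" using cp n0 assms(3) by simp
  ultimately show thesis using that by blast
qed

lemma side_neg_near:
  assumes "p \<noteq> q" "side p q x = 0" "e > 0"
  obtains z where "z \<in> ball x e" "side p q z < 0"
proof -
  have "side q p x = 0" using assms(2) side_swap[of q p x] by simp
  then obtain z where "z \<in> ball x e" "side q p z > 0" using side_pos_near[of q p x e] assms by auto
  then show thesis using that[of z] side_swap[of q p z] by simp
qed

lemma basis_decomp:
  assumes "det2 u v \<noteq> 0"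
  shows "x = (det2 x v / det2 u v) *\<^sub>R u + (det2 u x / det2 u v) *\<^sub>R v"
proof -
  have "det2 x v * u$1 + det2 u x * v$1 = det2 u v * x$1" "det2 x v * u$2 + det2 u x * v$2 = det2 u v * x$2"
    by (simp_all add: det2_def algebra_simps)
  then have "x$1 = (det2 x v * u$1 + det2 u x * v$1) / det2 u v" "x$2 = (det2 x v * u$2 + det2 u x * v$2) / det2 u v"
    using assms by (simp_all add: field_simps)
  then show ?thesis by (simp add: vec_eq_iff forall_2 add_divide_distrib)
qed

locale region =
  fixes U :: "(real^2) set"
  assumes open_U: "open U" and bounded_U: "bounded U" and sc_U: "simply_connected U"
begin

lemma connected_U: "connected U"
  using sc_U simply_connected_imp_connected by blast

abbreviation sees :: "real^2 \<Rightarrow> real^2 \<Rightarrow> bool" where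
  "sees A B \<equiv> closed_segment A B \<subseteq> U"

definition chord :: "real^2 \<Rightarrow> real^2 \<Rightarrow> bool" where
  "chord p q \<longleftrightarrow> p \<notin> U \<and> q \<notin> U \<and> p \<noteq> q \<and> open_segment p q \<subseteq> U"

text \<open>The orientation of the chord carries information: the pocket is on its positive side, so
  that \<open>side p q\<close> acts as a height over the base.\<close>

definition pocket :: "real^2 \<Rightarrow> real^2 \<Rightarrow> (real^2) set \<Rightarrow> bool" where
  "pocket p q K \<longleftrightarrow> chord p q \<and> K \<in> components (U - open_segment p q) \<and>
     (\<forall>x\<in>open_segment p q. \<exists>e>0. ball x e \<subseteq> U \<and> 
        (\<forall>z\<in>ball x e. (side p q z > 0 \<longrightarrow> z \<in> K) \<and> (side p q z < 0 \<longrightarrow> z \<notin> K)))"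

definition body :: "real^2 \<Rightarrow> real^2 \<Rightarrow> (real^2) set \<Rightarrow> (real^2) set" where
  "body p q K = {A \<in> K. \<exists>y\<in>open_segment p q. sees A y}"

text \<open>Near the window the parent's body is exactly the negative side, while
  \<open>pocket p' q' L\<close> puts \<open>L\<close> on the positive side. A window is thus a piece
  of the frontier of the body inside \<open>K\<close>.\<close>

definition child :: "real^2 \<Rightarrow> real^2 \<Rightarrow> (real^2) set \<Rightarrow> real^2 \<Rightarrow> real^2 \<Rightarrow> (real^2) set \<Rightarrow> bool" where
  "child p q K p' q' L \<longleftrightarrow> pocket p' q' L \<and> L \<subseteq> K \<and> L \<inter> body p q K = {} \<and>
     (\<forall>x\<in>open_segment p' q'. \<exists>e>0. ball x e \<subseteq> K \<and> 
        (\<forall>z\<in>ball x e. side p' q' z < 0 \<longleftrightarrow> z \<in> body p q K))"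

lemma open_minus_chord: "chord p q \<Longrightarrow> open (U - open_segment p q)"
proof -
  assume "chord p q"
  then have "U - open_segment p q = U - closed_segment p q"
    by (auto simp: chord_def open_segment_def)
  then show ?thesis using open_U by (simp add: open_Diff)
qed

lemma closure_component:
  assumes "K \<in> components V" "y \<in> closure K" "y \<in> V"
  shows "y \<in> K"
  using closedin_component[OF assms(1)] assms(2,3) by (auto simp: closedin_limpt closure_def)

text \<open>As \<open>U\<close> is connected, the component touches the chord. The touched part is
  open and closed in the chord, hence all of it, and at a touched point the component contains the
  positive half of a small disk.\<close>

lemma pocket_aux:
  assumes c: "chord p q" and K: "K \<in> components (U - open_segment p q)" and KC: "K \<subseteq> Cl"
    and C: "Cl \<inter> Cr = {}"
    and loc: "\<And>x. x \<in> open_segment p q \<Longrightarrow> \<exists>e>0. \<forall>z\<in>ball x e. 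
        (side p q z > 0 \<longrightarrow> z \<in> Cl) \<and> (side p q z < 0 \<longrightarrow> z \<in> Cr)"
  shows "pocket p q K"
proof -
  have pq: "p \<noteq> q" and rU: "open_segment p q \<subseteq> U" using c by (auto simp: chord_def)
  have oK: "open K" using open_components[OF open_minus_chord[OF c] K] .
  have KU: "K \<subseteq> U - open_segment p q" and Kne: "K \<noteq> {}"
    using in_components_subset[OF K] in_components_nonempty[OF K] .
  have loc': "\<exists>e>0. ball x e \<subseteq> U \<and> (\<forall>z\<in>ball x e. (side p q z > 0 \<longrightarrow> z \<in> Cl) \<and> (side p q z < 0 \<longrightarrow> z \<in> Cr)
      \<and> (side p q z = 0 \<longrightarrow> z \<in> open_segment p q))"
    if x: "x \<in> open_segment p q" for x
  proof -
    obtain e1 where e1: "e1 > 0" "\<forall>z\<in>ball x e1. (side p q z > 0 \<longrightarrow> z \<in> Cl) \<and> (side p q z < 0 \<longrightarrow> z \<in> Cr)"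
      using loc[OF x] by blast
    obtain e2 where e2: "e2 > 0" "\<And>z. z \<in> ball x e2 \<Longrightarrow> side p q z = 0 \<Longrightarrow> z \<in> open_segment p q"
      using open_segment_line_ball[OF x] by blast
    obtain e3 where e3: "e3 > 0" "ball x e3 \<subseteq> U" using open_U x rU open_contains_ball by blast
    show ?thesis
      by (rule exI[of _ "min e1 (min e2 e3)"]) (use e1 e2 e3 in auto)
  qed
  have half: "ball x e \<inter> {z. side p q z > 0} \<subseteq> K"
    if x: "x \<in> open_segment p q" "x \<in> closure K" and e: "e > 0" "ball x e \<subseteq> U"
      "\<forall>z\<in>ball x e. (side p q z > 0 \<longrightarrow> z \<in> Cl) \<and> (side p q z < 0 \<longrightarrow> z \<in> Cr)
      \<and> (side p q z = 0 \<longrightarrow> z \<in> open_segment p q)" for x e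
  proof -
    have "ball x e \<inter> K \<noteq> {}"
      using x(2) e(1) open_Int_closure_eq_empty[of "ball x e" K] centre_in_ball[of x e] by blast
    then obtain k where k: "k \<in> K" "k \<in> ball x e" by auto
    then have "side p q k > 0"
      using e(3) KC C KU by (metis Diff_iff disjoint_iff linorder_neqE_linordered_idom subsetD)
    then have "K \<inter> (ball x e \<inter> {z. side p q z > 0}) \<noteq> {}" using k by auto
    moreover have "connected (ball x e \<inter> {z. side p q z > 0})"
      by (intro convex_connected convex_Int convex_side_pos) auto
    moreover have "ball x e \<inter> {z. side p q z > 0} \<subseteq> U - open_segment p q"
      using e(2) side_open_segment by fastforce
    ultimately show ?thesis using components_maximal[OF K] by blast
  qed
  define R1 where "R1 = open_segment p q \<inter> closure K"
  have "R1 \<noteq> {}"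
  proof
    assume "R1 = {}"
    then have "U \<inter> closure K \<subseteq> K" using closure_component[OF K] by (auto simp: R1_def)
    then have "K \<inter> U = {} \<or> (- closure K) \<inter> U = {}"
      using connectedD[OF connected_U oK, of "- closure K"] closure_subset[of K] by auto
    moreover have m: "midpoint p q \<in> open_segment p q" using pq by simp
    moreover have "midpoint p q \<in> U" using m rU by blast
    ultimately show False using \<open>R1 = {}\<close> Kne KU unfolding R1_def by blast
  qed
  moreover have "openin (top_of_set (open_segment p q)) R1"
  proof (subst openin_contains_ball, intro conjI ballI)
    show "R1 \<subseteq> open_segment p q" by (auto simp: R1_def)
    fix x assume x: "x \<in> R1"
    then obtain e where e: "e > 0" "ball x e \<subseteq> U"
      "\<forall>z\<in>ball x e. (side p q z > 0 \<longrightarrow> z \<in> Cl) \<and> (side p q z < 0 \<longrightarrow> z \<in> Cr)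
      \<and> (side p q z = 0 \<longrightarrow> z \<in> open_segment p q)" using loc'[of x] by (auto simp: R1_def)
    have h: "ball x e \<inter> {z. side p q z > 0} \<subseteq> K" using half[OF _ _ e] x by (auto simp: R1_def)
    have "ball x e \<inter> open_segment p q \<subseteq> R1"
    proof
      fix y assume y: "y \<in> ball x e \<inter> open_segment p q"
      have "y \<in> closure K" unfolding closure_approachable
      proof (intro allI impI)
        fix d :: real assume "d > 0"
        then have "min d (e - dist x y) > 0" using y by auto
        then obtain z where z: "z \<in> ball y (min d (e - dist x y))" "side p q z > 0"
          using side_pos_near[OF pq side_open_segment, of y] y by blast
        then have "dist x z < e" using dist_triangle[of x z y] by auto
        then have "z \<in> K" using h z by auto
        then show "\<exists>z\<in>K. dist z y < d" using z by (auto simp: dist_commute)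
      qed
      then show "y \<in> R1" using y by (auto simp: R1_def)
    qed
    then show "\<exists>e>0. ball x e \<inter> open_segment p q \<subseteq> R1" using e(1) by blast
  qed
  moreover have "closedin (top_of_set (open_segment p q)) R1"
    unfolding R1_def by (intro closedin_closed_Int) simp
  moreover have "connected (open_segment p q)" by (simp add: convex_connected)
  ultimately have R1: "open_segment p q \<subseteq> closure K"
    unfolding R1_def by (metis Int_lower2 connected_clopen)
  show ?thesis unfolding pocket_def
  proof (intro conjI ballI c K)
    fix x assume x: "x \<in> open_segment p q"
    then obtain e where e: "e > 0" "ball x e \<subseteq> U"
      "\<forall>z\<in>ball x e. (side p q z > 0 \<longrightarrow> z \<in> Cl) \<and> (side p q z < 0 \<longrightarrow> z \<in> Cr)
      \<and> (side p q z = 0 \<longrightarrow> z \<in> open_segment p q)" using loc'[of x] by auto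
    have "ball x e \<inter> {z. side p q z > 0} \<subseteq> K" using half[OF x _ e] x R1 by blast
    moreover have "z \<notin> K" if "z \<in> ball x e" "side p q z < 0" for z
      using e(3) that KC C by blast
    ultimately show "\<exists>e>0. ball x e \<subseteq> U \<and> 
        (\<forall>z\<in>ball x e. (side p q z > 0 \<longrightarrow> z \<in> K) \<and> (side p q z < 0 \<longrightarrow> z \<notin> K))"
      using e by blast
  qed
qed

text \<open>A component lies in one of the two sides given by \<open>chord_separation\<close>; for
  the negative side the chord is reversed.\<close>

lemma pocket_exists:
  assumes c: "chord p q" and K: "K \<in> components (U - open_segment p q)"
  shows "pocket p q K \<or> pocket q p K"
proof -
  obtain Cl Cr where C: "open Cl" "open Cr" "Cl \<inter> Cr = {}" "U - open_segment p q = Cl \<union> Cr"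
    "\<And>x. x \<in> open_segment p q \<Longrightarrow> \<exists>e>0. \<forall>z\<in>ball x e. 
        (det2 (q - p) (z - p) > 0 \<longrightarrow> z \<in> Cl) \<and> (det2 (q - p) (z - p) < 0 \<longrightarrow> z \<in> Cr)"
    using chord_separation[OF open_U sc_U, of p q] c unfolding chord_def by metis
  have "K \<subseteq> Cl \<union> Cr" using in_components_subset[OF K] C(4) by simp
  moreover have "connected K" using in_components_connected[OF K] .
  ultimately have "Cl \<inter> K = {} \<or> Cr \<inter> K = {}"
    using connectedD[of K Cl Cr] C(1-3) by auto
  then consider "K \<subseteq> Cl" | "K \<subseteq> Cr" using \<open>K \<subseteq> Cl \<union> Cr\<close> by blast
  then show ?thesis
  proof cases
    case 1
    then show ?thesis using pocket_aux[OF c K 1 C(3)] C(5) by (simp add: side_def)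
  next
    case 2
    have c': "chord q p" using c by (auto simp: chord_def open_segment_commute)
    have K': "K \<in> components (U - open_segment q p)" using K by (simp add: open_segment_commute)
    have d: "Cr \<inter> Cl = {}" using C(3) by auto
    have l: "\<exists>e>0. \<forall>z\<in>ball x e. (side q p z > 0 \<longrightarrow> z \<in> Cr) \<and> (side q p z < 0 \<longrightarrow> z \<in> Cl)"
      if "x \<in> open_segment q p" for x
    proof -
      have "x \<in> open_segment p q" using that by (simp add: open_segment_commute)
      then obtain e where e: "e > 0" "\<forall>z\<in>ball x e. (side p q z > 0 \<longrightarrow> z \<in> Cl) \<and> (side p q z < 0 \<longrightarrow> z \<in> Cr)"
        using C(5) unfolding side_def by blast
      show ?thesis by (rule exI[of _ e]) (use e side_swap[of q p] in auto)
    qed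
    show ?thesis by (rule disjI2, rule pocket_aux[OF c' K' 2 d l])
  qed
qed

context
  fixes p q K assumes pk: "pocket p q K"
begin

lemma pocket_chord: "chord p q" using pk by (simp add: pocket_def)

lemma pocket_ne: "p \<noteq> q" and pocket_chord_subset: "open_segment p q \<subseteq> U"
  using pocket_chord by (auto simp: chord_def)

lemma pocket_comp: "K \<in> components (U - open_segment p q)" using pk by (simp add: pocket_def)

lemma pocket_open: "open K"
  using open_components[OF open_minus_chord[OF pocket_chord] pocket_comp] .

lemma pocket_subset: "K \<subseteq> U" and pocket_disj: "K \<inter> open_segment p q = {}"
  using in_components_subset[OF pocket_comp] by auto

lemma pocket_connected: "connected K" using in_components_connected[OF pocket_comp] .

lemma pocket_maximal: "connected T \<Longrightarrow> T \<subseteq> U \<Longrightarrow> T \<inter> open_segment p q = {} \<Longrightarrow> x \<in> T \<Longrightarrow> x \<in> K \<Longrightarrow> T \<subseteq> K"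
  using components_maximal[OF pocket_comp, of T] by blast

lemma pocket_closure: "y \<in> closure K \<Longrightarrow> y \<in> U \<Longrightarrow> y \<in> K \<or> y \<in> open_segment p q"
  using closure_component[OF pocket_comp] by blast

lemma pocket_local:
  assumes "x \<in> open_segment p q"
  obtains e where "e > 0" "ball x e \<subseteq> U" "\<And>z. z \<in> ball x e \<Longrightarrow> side p q z > 0 \<longleftrightarrow> z \<in> K"
    "\<And>z. z \<in> ball x e \<Longrightarrow> side p q z = 0 \<Longrightarrow> z \<in> open_segment p q"
proof -
  obtain e where e: "e > 0" "ball x e \<subseteq> U"
        "\<forall>z\<in>ball x e. (side p q z > 0 \<longrightarrow> z \<in> K) \<and> (side p q z < 0 \<longrightarrow> z \<notin> K)"
    using pk assms by (auto simp: pocket_def)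
  obtain e2 where e2: "e2 > 0" "\<And>z. z \<in> ball x e2 \<Longrightarrow> side p q z = 0 \<Longrightarrow> z \<in> open_segment p q"
    using open_segment_line_ball[OF assms] by blast
  show thesis
  proof (rule that[of "min e e2"])
    fix z assume z: "z \<in> ball x (min e e2)"
    then have z': "z \<in> ball x e" "z \<in> ball x e2" by auto
    show "side p q z > 0 \<longleftrightarrow> z \<in> K"
      using e(3) e2(2)[OF z'(2)] z'(1) pocket_disj by (metis IntI emptyE linorder_neqE_linordered_idom)
  qed (use e e2 in auto)
qed

lemma body_subset: "body p q K \<subseteq> K" by (auto simp: body_def)

lemma body_open: "open (body p q K)"
proof -
  have "open {A. sees A y}" for y
  proof -
    have "open ((\<lambda>A. (A, y)) -` {(A, B). sees A B})"
      by (intro open_vimage open_visible_pairs open_U continuous_intros)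
    then show ?thesis by (simp add: vimage_def)
  qed
  then have "open (K \<inter> (\<Union>y\<in>open_segment p q. {A. sees A y}))"
    using pocket_open by auto
  moreover have "body p q K = K \<inter> (\<Union>y\<in>open_segment p q. {A. sees A y})"
    by (auto simp: body_def)
  ultimately show ?thesis by simp
qed

lemma visible_side:
  assumes A: "A \<in> K" and y: "y \<in> open_segment p q" and s: "sees A y"
  shows "side p q A > 0" "\<And>z. z \<in> closed_segment A y \<Longrightarrow> z \<noteq> y \<Longrightarrow> z \<in> body p q K"
proof -
  have A0: "side p q A \<noteq> 0"
  proof
    assume "side p q A = 0"
    then obtain a where a: "A = p + a *\<^sub>R (q - p)" using on_line pocket_ne by metis
    obtain t where t: "0 < t" "t < 1" "y = p + t *\<^sub>R (q - p)"
      using y by (auto simp: in_segment algebra_simps)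
    have "A \<notin> open_segment p q" using A pocket_disj by auto
    \<comment> \<open>A point of the base line off the chord would have to see \<open>y\<close>
      through \<open>p\<close> or \<open>q\<close>, which are not in \<open>U\<close>.\<close>
    then have "a \<le> 0 \<or> a \<ge> 1" using a line_open_segment[OF pocket_ne, of a] by auto
    then show False
    proof
      assume "a \<le> 0"
      define c where "c = (-a) / (t - a)"
      have c: "0 \<le> c" "c \<le> 1" "c * (t - a) = - a" using \<open>a \<le> 0\<close> t by (auto simp: c_def field_simps)
      have "(1 - c) *\<^sub>R A + c *\<^sub>R y = p + (a + c * (t - a)) *\<^sub>R (q - p)"
        by (simp add: a t algebra_simps)
      then have "(1 - c) *\<^sub>R A + c *\<^sub>R y = p" using c by simp
      then have "p \<in> closed_segment A y" using c by (metis in_segment(1))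
      then show False using s pocket_chord by (auto simp: chord_def)
    next
      assume "a \<ge> 1"
      define c where "c = (a - 1) / (a - t)"
      have c: "0 \<le> c" "c \<le> 1" "c * (a - t) = a - 1" using \<open>a \<ge> 1\<close> t by (auto simp: c_def field_simps)
      have "(1 - c) *\<^sub>R A + c *\<^sub>R y = p + (a - c * (a - t)) *\<^sub>R (q - p)"
        by (simp add: a t algebra_simps)
      then have "(1 - c) *\<^sub>R A + c *\<^sub>R y = q" using c by simp
      then have "q \<in> closed_segment A y" using c by (metis in_segment(1))
      then show False using s pocket_chord by (auto simp: chord_def)
    qed
  qed
  have sz: "side p q z = (1 - u) * side p q A" if "z = (1 - u) *\<^sub>R A + u *\<^sub>R y" for z u
    by (simp add: that side_affine side_open_segment[OF y])
  have zK: "z \<in> K" if z: "z \<in> closed_segment A y" "z \<noteq> y" for z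
  proof -
    have "closed_segment A z \<inter> open_segment p q = {}"
    proof (rule ccontr)
      assume "closed_segment A z \<inter> open_segment p q \<noteq> {}"
      then obtain x where x: "x \<in> closed_segment A z" "x \<in> open_segment p q" by auto
      have "x \<in> closed_segment A y" using x z by (meson ends_in_segment(1) subset_closed_segment subsetD)
      then obtain u where u: "0 \<le> u" "u \<le> 1" "x = (1 - u) *\<^sub>R A + u *\<^sub>R y" by (auto simp: in_segment)
      have "u = 1" using sz[OF u(3)] side_open_segment[OF x(2)] A0 by simp
      then have "y \<in> closed_segment A z" using x u by simp
      then have "z = y" using z by (metis between_mem_segment between_antisym between_commute)
      then show False using z by simp
    qed
    moreover have "sees A z" using s z by (meson ends_in_segment(1) subset_closed_segment subset_trans)
    ultimately have "closed_segment A z \<subseteq> K" by (intro pocket_maximal[of _ A]) (use A in auto)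
    then show ?thesis by auto
  qed
  \<comment> \<open>From the negative side the segment would approach \<open>y\<close> through
    points of \<open>K\<close> on the negative side, against the local picture at
    \<open>y\<close>.\<close>
  show "side p q A > 0"
  proof (rule ccontr)
    assume "\<not> side p q A > 0"
    then have neg: "side p q A < 0" using A0 by simp
    obtain e where e: "e > 0" "\<And>z. z \<in> ball y e \<Longrightarrow> side p q z > 0 \<longleftrightarrow> z \<in> K"
      using pocket_local[OF y] by metis
    have Ay: "A \<noteq> y" using A0 side_open_segment[OF y] by auto
    define c where "c = min 1 (e / (2 * norm (A - y)))"
    have c: "0 < c" "c \<le> 1" using e Ay by (auto simp: c_def)
    define z where "z = (1 - (1 - c)) *\<^sub>R A + (1 - c) *\<^sub>R y"
    have "y - z = - (c *\<^sub>R (A - y))" by (simp add: z_def algebra_simps)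
    then have "dist y z = c * norm (A - y)" using c by (simp add: dist_norm)
    also have "\<dots> \<le> e / (2 * norm (A - y)) * norm (A - y)" by (intro mult_right_mono) (auto simp: c_def)
    also have "\<dots> < e" using e Ay by simp
    finally have zb: "z \<in> ball y e" by simp
    have z1: "z \<in> closed_segment A y" unfolding in_segment z_def using c by (intro exI[of _ "1 - c"]) auto
    have sn: "side p q z < 0" using sz[OF z_def] neg c by (simp add: mult_pos_neg)
    then have "z \<noteq> y" using side_open_segment[OF y] by auto
    then have "z \<in> K" using zK z1 by blast
    then show False using e(2)[OF zb] sn by simp
  qed
  show "z \<in> body p q K" if z: "z \<in> closed_segment A y" "z \<noteq> y" for z
  proof -
    have "sees z y" using s z by (meson ends_in_segment(2) subset_closed_segment subset_trans)
    then show ?thesis using zK[OF z] y by (auto simp: body_def)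
  qed
qed

lemma body_side: "A \<in> body p q K \<Longrightarrow> side p q A > 0"
  using visible_side(1) by (auto simp: body_def)

lemma body_near_chord:
  assumes x: "x \<in> open_segment p q"
  obtains e where "e > 0" "ball x e \<subseteq> U" "\<And>z. z \<in> ball x e \<Longrightarrow> side p q z > 0 \<Longrightarrow> z \<in> body p q K"
    "\<And>z. z \<in> ball x e \<Longrightarrow> z \<in> K \<Longrightarrow> side p q z > 0"
proof -
  obtain e where e: "e > 0" "ball x e \<subseteq> U" "\<And>z. z \<in> ball x e \<Longrightarrow> side p q z > 0 \<longleftrightarrow> z \<in> K"
    using pocket_local[OF x] by metis
  show thesis
  proof (rule that[OF e(1,2)])
    fix z assume z: "z \<in> ball x e" "side p q z > 0"
    have "closed_segment z x \<subseteq> ball x e" using z e(1) by (intro closed_segment_subset) auto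
    then show "z \<in> body p q K" using e z x by (auto simp: body_def)
  qed (use e(3) in blast)
qed

lemma body_nonempty: "body p q K \<noteq> {}"
proof -
  have m: "midpoint p q \<in> open_segment p q" using pocket_ne by simp
  obtain e where e: "e > 0" "\<And>z. z \<in> ball (midpoint p q) e \<Longrightarrow> side p q z > 0 \<Longrightarrow> z \<in> body p q K"
    using body_near_chord[OF m] by metis
  obtain z where "z \<in> ball (midpoint p q) e" "side p q z > 0"
    using side_pos_near[OF pocket_ne side_open_segment[OF m] e(1)] by blast
  then show ?thesis using e by auto
qed

text \<open>The lines of sight tie the body to its base chord. Being connected, the union falls on
  one side of any window it avoids; \<open>child_exists\<close> relies on this.\<close>

lemma body_chord_connected: "connected (body p q K \<union> open_segment p q)"
proof -
  define F where "F = insert (open_segment p q) {closed_segment A y \<union> open_segment p q |A y. A \<in> K \<and> y \<in> open_segment p q \<and> sees A y}"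
  have "connected (\<Union>F)"
  proof (rule connected_Union)
    show "connected s" if "s \<in> F" for s
      using that unfolding F_def by (auto intro!: connected_Un simp: convex_connected)
    have "midpoint p q \<in> \<Inter>F" using pocket_ne by (auto simp: F_def)
    then show "\<Inter>F \<noteq> {}" by blast
  qed
  moreover have "\<Union>F = body p q K \<union> open_segment p q"
    using visible_side(2) by (auto simp: F_def) (auto simp: body_def, blast)
  ultimately show ?thesis by simp
qed

end


section \<open>Visible pairs over a common base chord\<close>

lemma triangle_subset:
  "sees a b \<Longrightarrow> sees b c \<Longrightarrow> sees c a \<Longrightarrow> convex hull {a, b, c} \<subseteq> U"
  using triangle_fill[OF sc_U] .

lemma hull_segment: "x \<in> convex hull S \<Longrightarrow> y \<in> convex hull S \<Longrightarrow> closed_segment x y \<subseteq> convex hull S"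
  by (simp add: closed_segment_subset)

lemma hull_vertices: "a \<in> convex hull {a, b, c}" "b \<in> convex hull {a, b, c}" "c \<in> convex hull {a, b, c}"
  by (auto intro: hull_inc)

text \<open>If \<open>AA'\<close> and \<open>BB'\<close> cross in \<open>X\<close>, the areas of \<open>AXB\<close> and \<open>XA'B'\<close> cannot both be small;
  otherwise the triangle \<open>AA'B\<close> lies in \<open>U\<close>.\<close>

lemma visible_pair_over_base_pos:
  fixes A A' B B' u v :: "real^2"
  assumes seg: "sees A A'" "sees B B'" "sees A B" "sees A' B'"
    and A: "A = A' + v" and B': "B' = A' + b *\<^sub>R u" and B: "B = A' + d *\<^sub>R u + h *\<^sub>R v"
    and h: "0 < h" "h \<le> 1" and uv: "det2 u v \<noteq> 0" and d: "d > 0"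
    and M: "\<And>a b c. convex hull {a, b, c} \<subseteq> U \<Longrightarrow> \<bar>det2 (b - a) (c - a)\<bar> \<le> 2 * M"
  shows "d * \<bar>det2 u v\<bar> \<le> (1 + h) * (2 * M)"
    and "N \<in> closed_segment A B \<Longrightarrow> \<exists>y\<in>closed_segment A' B'. sees N y"
proof -
  have M0: "0 \<le> 2 * M" 
    using M[of A A A] seg(1) by auto
  have "d * \<bar>det2 u v\<bar> \<le> (1 + h) * (2 * M) \<and> 
     (N \<in> closed_segment A B \<longrightarrow> (\<exists>y\<in>closed_segment A' B'. sees N y))"
  proof (cases "b \<ge> 0")
    case True
    \<comment> \<open>With \<open>A'\<close> as origin and axes \<open>u\<close>, \<open>v\<close>
      the points are \<open>A = (0, 1)\<close>, \<open>B = (d, h)\<close>,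
      \<open>B' = (b, 0)\<close>. For positive \<open>b\<close> the halves of the quadrilateral
      \<open>A A' B' B\<close> are equally oriented.\<close>
    have T: "convex hull {A, A', B} \<subseteq> U"
    proof (cases "b = 0")
      case True
      then show ?thesis using triangle_subset[of A A' B] seg B' by (simp add: closed_segment_commute)
    next
      case False
      then have b: "b > 0" using \<open>b \<ge> 0\<close> by simp
      show ?thesis
      proof (rule quad_fill[OF sc_U, of A A' B' B])
        have "det2 (A' - A) (B - A) = d * det2 u v"
          by (simp add: A B det2_simps det2_swap[of v u])
        moreover have "det2 (B' - A') (B - A') = b * h * det2 u v"
          by (simp add: B B' det2_simps)
        ultimately have "det2 (A' - A) (B - A) * det2 (B' - A') (B - A') = (d * b * h) * (det2 u v * det2 u v)"
          by simp
        also have "\<dots> > 0"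
        proof -
          have "det2 u v * det2 u v > 0" using uv not_real_square_gt_zero[of "det2 u v"] by blast
          moreover have "d * b * h > 0" by (intro mult_pos_pos d b h(1))
          ultimately show ?thesis by (rule mult_pos_pos[rotated])
        qed
        finally show "det2 (A' - A) (B - A) * det2 (B' - A') (B - A') > 0" .
      qed (use seg in \<open>simp_all add: closed_segment_commute\<close>)
    qed
    have "\<bar>det2 (A' - A) (B - A)\<bar> \<le> 2 * M" using M[OF T] .
    moreover have "det2 (A' - A) (B - A) = d * det2 u v"
      by (simp add: A B det2_simps det2_swap[of v u])
    ultimately have 1: "d * \<bar>det2 u v\<bar> \<le> 2 * M" using d by (simp add: abs_mult)
    have "2 * M \<le> (1 + h) * (2 * M)" using M0 h by (simp add: algebra_simps)
    moreover have "sees N A'" if "N \<in> closed_segment A B"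
      using hull_segment[of N "{A, A', B}" A'] hull_segment[of A "{A, A', B}" B] hull_vertices[where a = A and b = A' and c = B]
        that T by blast
    ultimately show ?thesis using 1 by auto
  next
    case False
    define \<beta> where "\<beta> = - b"
    have \<beta>: "\<beta> > 0" using False by (simp add: \<beta>_def)
    \<comment> \<open>The segments now cross at \<open>X = (0, x)\<close>, and \<open>\<tau>\<close>
      is the weight of \<open>B\<close> in the crossing point.\<close>
    define \<tau> where "\<tau> = \<beta> / (d + \<beta>)"
    have \<tau>: "0 < \<tau>" "\<tau> < 1" "\<tau> * (d + \<beta>) = \<beta>" using d \<beta> by (auto simp: \<tau>_def)
    define x where "x = \<tau> * h"
    have x: "0 < x" "x < 1"
      using \<tau> h mult_strict_mono[of \<tau> 1 h 1] by (auto simp: x_def) (smt (verit) mult_left_le)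
    define X where "X = A' + x *\<^sub>R v"
    have XA: "X = (1 - (1 - x)) *\<^sub>R A + (1 - x) *\<^sub>R A'" by (simp add: X_def A algebra_simps)
    have "X - ((1 - (1 - \<tau>)) *\<^sub>R B + (1 - \<tau>) *\<^sub>R B') = - ((\<tau> * (d + \<beta>) - \<beta>) *\<^sub>R u)"
      by (simp add: X_def B B' x_def \<beta>_def algebra_simps)
    then have XB: "X = (1 - (1 - \<tau>)) *\<^sub>R B + (1 - \<tau>) *\<^sub>R B'" using \<tau>(3) by simp
    have "X \<in> closed_segment A A'" unfolding in_segment using XA x by (intro exI[of _ "1 - x"]) auto
    moreover have "X \<in> closed_segment B B'" unfolding in_segment using XB \<tau> by (intro exI[of _ "1 - \<tau>"]) auto
    ultimately have sX: "sees A X" "sees X A'" "sees B X" "sees X B'"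
      using Un_closed_segment[of X A A'] Un_closed_segment[of X B B'] seg by blast+
    have T1: "convex hull {A, X, B} \<subseteq> U"
      by (rule triangle_subset) (use sX seg in \<open>simp_all add: closed_segment_commute\<close>)
    have T2: "convex hull {X, A', B'} \<subseteq> U"
      by (rule triangle_subset) (use sX seg in \<open>simp_all add: closed_segment_commute\<close>)
    define c where "c = \<bar>det2 u v\<bar>"
    have c: "c > 0" using uv by (simp add: c_def)
    have "det2 (X - A) (B - A) = (1 - x) * d * det2 u v"
      by (simp add: X_def A B det2_simps det2_swap[of v u]) (simp add: algebra_simps)
    then have m1: "(1 - x) * (d * c) \<le> 2 * M" using M[OF T1] x d by (simp add: c_def abs_mult)
    have "det2 (A' - X) (B' - X) = - (x * \<beta>) * det2 u v"
      by (simp add: X_def B' \<beta>_def det2_simps det2_swap[of v u])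
    then have m2: "x * (\<beta> * c) \<le> 2 * M" using M[OF T2] x \<beta> by (simp add: c_def abs_mult)
    have "d * c \<le> (1 + h) * (2 * M)"
    \<comment> \<open>At \<open>x = h / (1 + h)\<close> the two area bounds give the same estimate
      for \<open>d\<close>: below this value the triangle \<open>A X B\<close> decides, above it
      \<open>X A' B'\<close>.\<close>
    proof (cases "(1 + h) * x \<le> h")
      case True
      have "1 * (d * c) \<le> ((1 + h) * (1 - x)) * (d * c)"
        using True d c by (intro mult_right_mono) (auto simp: algebra_simps)
      also have "\<dots> \<le> (1 + h) * (2 * M)" using mult_left_mono[OF m1, of "1 + h"] h by simp
      finally show ?thesis by simp
    next
      case False
      have "x * (d + \<beta>) = h * (\<tau> * (d + \<beta>))" by (simp add: x_def)
      then have "x * (d + \<beta>) = h * \<beta>" unfolding \<tau>(3) .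
      then have "x * d = (h - x) * \<beta>" by (simp add: algebra_simps)
      also have "\<dots> \<le> (h * x) * \<beta>" using False \<beta> by (intro mult_right_mono) (auto simp: algebra_simps)
      finally have "d \<le> h * \<beta>" using x(1) by (simp add: mult.commute mult.left_commute)
      then have "d * c \<le> (h * \<beta>) * c" using c by (intro mult_right_mono) auto
      also have "\<dots> \<le> ((1 + h) * x) * (\<beta> * c)" using False \<beta> c mult_right_mono[of h "(1 + h) * x" "\<beta> * c"] by simp
      also have "\<dots> \<le> (1 + h) * (2 * M)" using mult_left_mono[OF m2, of "1 + h"] h by simp
      finally show ?thesis .
    qed
    moreover have "\<exists>y\<in>closed_segment A' B'. sees N y" if N: "N \<in> closed_segment A B"
    proof -
      obtain s where s: "0 \<le> s" "s \<le> 1" "N = (1 - s) *\<^sub>R A + s *\<^sub>R B" using N by (auto simp: in_segment)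
      \<comment> \<open>Projection through \<open>X\<close> sends \<open>A\<close> to
        \<open>A'\<close> and \<open>B\<close> to \<open>B'\<close> with ratios \<open>k1\<close>
        and \<open>k2\<close>, so it sends \<open>N\<close> to the point \<open>y\<close> of
        \<open>A' B'\<close> with weights proportional to \<open>(1 - s) * k1\<close> and
        \<open>s * k2\<close>. Then \<open>N\<close> sees \<open>y\<close> through
        \<open>X\<close>.\<close>
      define k1 where "k1 = (1 - x) / x"
      define k2 where "k2 = (1 - \<tau>) / \<tau>"
      have k: "k1 > 0" "k2 > 0" using x \<tau> by (auto simp: k1_def k2_def)
      have kA: "A - X = - (k1 *\<^sub>R (A' - X))"
      proof -
        have "A - X = (1 - x) *\<^sub>R v" "A' - X = - (x *\<^sub>R v)" by (simp_all add: A X_def algebra_simps)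
        then show ?thesis using x by (simp add: k1_def)
      qed
      have kB: "B - X = - (k2 *\<^sub>R (B' - X))"
      proof -
        have "B - X = (1 - \<tau>) *\<^sub>R (B - B')" "B' - X = - (\<tau> *\<^sub>R (B - B'))" by (simp_all add: XB algebra_simps)
        then show ?thesis using \<tau> by (simp add: k2_def)
      qed
      define g where "g = (1 - s) * k1 + s * k2"
      have g: "g > 0"
      proof (cases "s = 0")
        case False
        then show ?thesis using s k by (simp add: g_def add_nonneg_pos)
      qed (use k in \<open>simp add: g_def\<close>)
      define y where "y = (1 - s * k2 / g) *\<^sub>R A' + (s * k2 / g) *\<^sub>R B'"
      have gs: "1 - s * k2 / g = (1 - s) * k1 / g" using g by (simp add: field_simps) (simp add: g_def algebra_simps)
      have y1: "y \<in> closed_segment A' B'" unfolding in_segment y_def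
        by (intro exI[of _ "s * k2 / g"]) (use s k g gs in \<open>auto simp: field_simps g_def\<close>)
      have "N - X = (1 - s) *\<^sub>R (A - X) + s *\<^sub>R (B - X)" by (simp add: s algebra_simps)
      also have "\<dots> = - (((1 - s) * k1) *\<^sub>R (A' - X) + (s * k2) *\<^sub>R (B' - X))" by (simp add: kA kB)
      also have "\<dots> = - (g *\<^sub>R (y - X))"
      proof -
        have "y - X = ((1 - s) * k1 / g) *\<^sub>R (A' - X) + (s * k2 / g) *\<^sub>R (B' - X)"
          unfolding y_def gs[symmetric] by (simp add: algebra_simps)
        then show ?thesis using g by (simp add: scaleR_add_right)
      qed
      finally have NX: "N - X = - (g *\<^sub>R (y - X))" .
      define \<theta> where "\<theta> = g / (1 + g)"
      have \<theta>: "0 \<le> \<theta>" "\<theta> \<le> 1" "\<theta> - (1 - \<theta>) * g = 0" using g by (auto simp: \<theta>_def field_simps)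
      have N: "N = X - g *\<^sub>R (y - X)" using NX by (simp add: algebra_simps)
      have "(1 - \<theta>) *\<^sub>R N + \<theta> *\<^sub>R y - X = (\<theta> - (1 - \<theta>) * g) *\<^sub>R (y - X)"
        by (simp add: N algebra_simps)
      then have "X = (1 - \<theta>) *\<^sub>R N + \<theta> *\<^sub>R y" using \<theta>(3) by simp
      then have "X \<in> closed_segment N y" using \<theta> by (metis in_segment(1))
      then have "closed_segment N y = closed_segment N X \<union> closed_segment X y"
        using Un_closed_segment by blast
      moreover have "sees N X"
        using hull_segment[of N "{A, X, B}" X] hull_segment[of A "{A, X, B}" B] hull_vertices[where a = A and b = X and c = B]
          that T1 by blast
      moreover have "sees X y"
        using hull_segment[of X "{X, A', B'}" y] hull_segment[of A' "{X, A', B'}" B'] hull_vertices[where a = X and b = A' and c = B']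
          y1 T2 by blast
      ultimately show ?thesis using y1 by blast
    qed
    ultimately show ?thesis by (auto simp: c_def)
  qed
  then show "d * \<bar>det2 u v\<bar> \<le> (1 + h) * (2 * M)"
    and "N \<in> closed_segment A B \<Longrightarrow> \<exists>y\<in>closed_segment A' B'. sees N y"
    by blast+
qed

text \<open>Replacing \<open>u\<close> by \<open>- u\<close> reduces negative \<open>d\<close> to
  the positive case; for \<open>d = 0\<close> the point \<open>B\<close> lies on
  \<open>A A'\<close>.\<close>

lemma visible_pair_over_base:
  fixes A A' B B' u v :: "real^2"
  assumes seg: "sees A A'" "sees B B'" "sees A B" "sees A' B'"
    and A: "A = A' + v" and B': "B' = A' + b *\<^sub>R u" and B: "B = A' + d *\<^sub>R u + h *\<^sub>R v"
    and h: "0 < h" "h \<le> 1" and uv: "det2 u v \<noteq> 0"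
    and M: "\<And>a b c. convex hull {a, b, c} \<subseteq> U \<Longrightarrow> \<bar>det2 (b - a) (c - a)\<bar> \<le> 2 * M"
  shows "\<bar>d\<bar> * \<bar>det2 u v\<bar> \<le> (1 + h) * (2 * M)"
    and "N \<in> closed_segment A B \<Longrightarrow> \<exists>y\<in>closed_segment A' B'. sees N y"
proof -
  have "\<bar>d\<bar> * \<bar>det2 u v\<bar> \<le> (1 + h) * (2 * M) \<and>
    (N \<in> closed_segment A B \<longrightarrow> (\<exists>y\<in>closed_segment A' B'. sees N y))"
  proof (rule linorder_cases[of d 0])
    assume d: "d > 0"
    show ?thesis using visible_pair_over_base_pos[OF seg A B' B h uv d M] d by auto
  next
    assume d: "d < 0"
    have B1: "B' = A' + (- b) *\<^sub>R (- u)" "B = A' + (- d) *\<^sub>R (- u) + h *\<^sub>R v" "det2 (- u) v \<noteq> 0" "- d > 0"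
      using B B' uv d by (simp_all add: det2_simps)
    show ?thesis using visible_pair_over_base_pos[OF seg A B1(1) B1(2) h B1(3) B1(4) M] d by (auto simp: det2_simps)
  next
    assume d: "d = 0"
    have "0 \<le> 2 * M" using M[of A A A] seg(1) by auto
    then have "0 \<le> (1 + h) * (2 * M)" using h by simp
    moreover have "sees N A'" if "N \<in> closed_segment A B"
    proof -
      have "B = (1 - (1 - h)) *\<^sub>R A + (1 - h) *\<^sub>R A'" using d by (simp add: A B algebra_simps)
      then have "B \<in> closed_segment A A'" unfolding in_segment using h by (intro exI[of _ "1 - h"]) auto
      then have "N \<in> closed_segment A A'" using that by (meson ends_in_segment(1) subset_closed_segment subsetD)
      then show ?thesis using seg(1) by (meson ends_in_segment(2) subset_closed_segment subset_trans)
    qed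
    ultimately show ?thesis using d by auto
  qed
  then show "\<bar>d\<bar> * \<bar>det2 u v\<bar> \<le> (1 + h) * (2 * M)"
    and "N \<in> closed_segment A B \<Longrightarrow> \<exists>y\<in>closed_segment A' B'. sees N y"
    by blast+
qed

text \<open>A crude bound from the diameter. It lets \<open>visible_pair_over_base\<close> be
  applied for its visibility claim, before any good constant is fixed.\<close>

lemma triangle_area_bounded:
  obtains M where "\<And>a b c. convex hull {a, b, c} \<subseteq> U \<Longrightarrow> \<bar>det2 (b - a) (c - a)\<bar> \<le> 2 * M"
proof -
  obtain R where R: "\<And>x. x \<in> U \<Longrightarrow> norm x \<le> R" using bounded_U bounded_iff by blast
  have n: "\<bar>x $ i\<bar> \<le> norm x" for x :: "real^2" and i by (rule component_le_norm_cart)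
  have crb: "\<bar>det2 x y\<bar> \<le> 2 * (norm x * norm y)" for x y
  proof -
    have "\<bar>det2 x y\<bar> \<le> \<bar>x$1\<bar> * \<bar>y$2\<bar> + \<bar>x$2\<bar> * \<bar>y$1\<bar>"
      unfolding det2_def using abs_triangle_ineq4[of "x$1 * y$2" "x$2 * y$1"] by (simp add: abs_mult)
    also have "\<dots> \<le> norm x * norm y + norm x * norm y"
      by (intro add_mono mult_mono n) auto
    finally show ?thesis by simp
  qed
  show thesis
  proof (rule that[of "(2 * R) * (2 * R)"])
    fix a b c assume "convex hull {a, b, c} \<subseteq> U"
    then have "a \<in> U" "b \<in> U" "c \<in> U" using hull_vertices[where a = a and b = b and c = c] by blast+
    then have "norm (b - a) \<le> 2 * R" "norm (c - a) \<le> 2 * R"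
      using R[of a] R[of b] R[of c] norm_triangle_ineq4[of b a] norm_triangle_ineq4[of c a] by auto
    moreover have "0 \<le> R" using R[OF \<open>a \<in> U\<close>] norm_ge_zero[of a] by linarith
    moreover from calculation have "norm (b - a) * norm (c - a) \<le> (2 * R) * (2 * R)"
      by (intro mult_mono) auto
    ultimately show "\<bar>det2 (b - a) (c - a)\<bar> \<le> 2 * ((2 * R) * (2 * R))"
      using crb[of "b - a" "c - a"] by simp
  qed
qed

text \<open>Affine coordinates with origin \<open>A'\<close>, one axis along the base and the other
  ending in \<open>A\<close>: Cramer's rule, with quotients of \<open>side\<close> as second
  coordinate.\<close>

lemma body_coords:
  assumes "side p q A' = 0" "side p q A > 0" "p \<noteq> q"
  shows "det2 (q - p) (A - A') = side p q A"
    "B = A' + (det2 (B - A') (A - A') / side p q A) *\<^sub>R (q - p) + (side p q B / side p q A) *\<^sub>R (A - A')"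
proof -
  show c: "det2 (q - p) (A - A') = side p q A" using side_diff[OF assms(1)] by simp
  have "det2 (q - p) (B - A') = side p q B" using side_diff[OF assms(1)] by simp
  then show "B = A' + (det2 (B - A') (A - A') / side p q A) *\<^sub>R (q - p) + (side p q B / side p q A) *\<^sub>R (A - A')"
    using basis_decomp[of "q - p" "A - A'" "B - A'"] c assms(2) by (simp add: algebra_simps)
qed

lemma line_coords:
  assumes "side p q x = 0" "side p q y = 0" "p \<noteq> q"
  obtains b where "y = x + b *\<^sub>R (q - p)"
proof -
  obtain s t where st: "x = p + s *\<^sub>R (q - p)" "y = p + t *\<^sub>R (q - p)" using on_line assms by metis
  have "y = x + (t - s) *\<^sub>R (q - p)" unfolding st by (simp add: algebra_simps)
  then show thesis using that by blast
qed

lemma open_segment_sub: "x \<in> open_segment p q \<Longrightarrow> y \<in> open_segment p q \<Longrightarrow> closed_segment x y \<subseteq> open_segment p q"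
  by (simp add: closed_segment_subset)

context
  fixes p q K assumes pk: "pocket p q K"
begin

text \<open>\<open>visible_pair_over_base\<close> gives each point of \<open>A B\<close> a base
  point that it sees, and positivity of \<open>side p q\<close> at both ends keeps the segment off
  the base chord. Calling the higher end \<open>A\<close> provides the bound
  \<open>h \<le> 1\<close>.\<close>

lemma body_segment_aux:
  assumes A: "A \<in> body p q K" and B: "B \<in> body p q K" and AB: "sees A B"
    and le: "side p q B \<le> side p q A"
  shows "closed_segment A B \<subseteq> body p q K"
proof
  fix N assume N: "N \<in> closed_segment A B"
  note pq = pocket_ne[OF pk]
  obtain A' where A': "A' \<in> open_segment p q" "sees A A'" using A by (auto simp: body_def)
  obtain B' where B': "B' \<in> open_segment p q" "sees B B'" using B by (auto simp: body_def)
  have s: "side p q A > 0" "side p q B > 0" using body_side[OF pk] A B by auto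
  note bc = body_coords[OF side_open_segment[OF A'(1)] s(1) pq]
  obtain b where b: "B' = A' + b *\<^sub>R (q - p)"
    using line_coords[OF side_open_segment[OF A'(1)] side_open_segment[OF B'(1)] pq] .
  obtain M where M: "\<And>a b c. convex hull {a, b, c} \<subseteq> U \<Longrightarrow> \<bar>det2 (b - a) (c - a)\<bar> \<le> 2 * M"
    using triangle_area_bounded by blast
  have sub: "closed_segment A' B' \<subseteq> open_segment p q" by (rule open_segment_sub[OF A'(1) B'(1)])
  then have A'B': "sees A' B'" using pocket_chord_subset[OF pk] by blast
  have "\<exists>y\<in>closed_segment A' B'. sees N y"
    by (rule visible_pair_over_base(2)[OF A'(2) B'(2) AB A'B' _ b bc(2) _ _ _ M N]) (use s le bc in \<open>auto simp: divide_le_eq\<close>)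
  then obtain y where y: "y \<in> open_segment p q" "sees N y" using sub by auto
  have "closed_segment A B \<inter> open_segment p q = {}"
  proof -
    have "side p q z > 0" if "z \<in> closed_segment A B" for z
      using closed_segment_subset[OF _ _ convex_side_pos, of A p q B] s that by auto
    then show ?thesis using side_open_segment by fastforce
  qed
  then have "closed_segment A B \<subseteq> K" 
    using A body_subset[OF pk] by (intro pocket_maximal[OF pk _ AB, of A]) auto
  then show "N \<in> body p q K" using y N by (auto simp: body_def)
qed

lemma body_segment:
  assumes A: "A \<in> body p q K" and B: "B \<in> body p q K" and AB: "sees A B"
  shows "closed_segment A B \<subseteq> body p q K"
proof (cases "side p q B \<le> side p q A")
  case False
  then show ?thesis
    using body_segment_aux[OF B A] AB by (simp add: closed_segment_commute)
qed (use body_segment_aux[OF A B AB] in simp)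

text \<open>All pairs in a disk inside \<open>U\<close> see each other, so convexity relative to
  visibility becomes convexity.\<close>

lemma body_ball_convex:
  assumes "ball Z e \<subseteq> U"
  shows "convex (body p q K \<inter> ball Z e)"
  unfolding convex_contains_segment
proof (intro ballI)
  fix a b assume ab: "a \<in> body p q K \<inter> ball Z e" "b \<in> body p q K \<inter> ball Z e"
  then have "closed_segment a b \<subseteq> ball Z e" by (intro closed_segment_subset) auto
  moreover from this have "closed_segment a b \<subseteq> body p q K" using ab assms by (intro body_segment) auto
  ultimately show "closed_segment a b \<subseteq> body p q K \<inter> ball Z e" by auto
qed

text \<open>Behind \<open>X\<close> a point of the disk sees \<open>y\<close> through
  \<open>X\<close>; between \<open>X\<close> and \<open>y\<close> it lies on a line of sight; beyond
  \<open>y\<close> it cannot be, for then the convex disk would contain \<open>y\<close>.\<close>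

lemma body_disk_chord:
  assumes D: "ball Z e \<subseteq> K" and X: "X \<in> ball Z e" "X \<in> K" and y: "y \<in> open_segment p q" "sees X y"
    and P: "X + s *\<^sub>R (y - X) \<in> ball Z e"
  shows "X + s *\<^sub>R (y - X) \<in> body p q K"
proof -
  define P where "P = X + s *\<^sub>R (y - X)"
  have yD: "y \<notin> ball Z e" using D pocket_disj[OF pk] y by auto
  have PX: "closed_segment P X \<subseteq> ball Z e" using X P by (intro closed_segment_subset) (auto simp: P_def)
  have DU: "ball Z e \<subseteq> U" using D pocket_subset[OF pk] by auto
  consider "s \<le> 0" | "0 \<le> s" "s < 1" | "s \<ge> 1" by linarith
  then show ?thesis
  proof cases
    case 1
    define t where "t = - s / (1 - s)"
    have t: "0 \<le> t" "t \<le> 1" "(1 - t) * s + t = 0" using 1 by (auto simp: t_def field_simps)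
    have "(1 - t) *\<^sub>R P + t *\<^sub>R y = X + ((1 - t) * s + t) *\<^sub>R (y - X)" by (simp add: P_def algebra_simps)
    then have "X = (1 - t) *\<^sub>R P + t *\<^sub>R y" using t by simp
    then have "X \<in> closed_segment P y" using t by (metis in_segment(1))
    then have "closed_segment P y = closed_segment P X \<union> closed_segment X y"
      using Un_closed_segment by blast
    then have "sees P y" using PX y DU by auto
    then show ?thesis using y P D by (auto simp: body_def P_def)
  next
    case 2
    have "P = (1 - s) *\<^sub>R X + s *\<^sub>R y" by (simp add: P_def algebra_simps)
    then have "P \<in> closed_segment X y" using 2 by (metis in_segment(1) less_imp_le)
    moreover have "P \<noteq> y" using yD P by (auto simp: P_def)
    ultimately show ?thesis using visible_side(2)[OF pk X(2) y] by (simp add: P_def)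
  next
    case 3
    define t where "t = 1 - 1 / s"
    have t: "0 \<le> t" "t \<le> 1" "(1 - t) * s = 1" using 3 by (auto simp: t_def field_simps)
    have "(1 - t) *\<^sub>R P + t *\<^sub>R X = X + ((1 - t) * s) *\<^sub>R (y - X)" by (simp add: P_def algebra_simps)
    then have "y = (1 - t) *\<^sub>R P + t *\<^sub>R X" using t by simp
    then have "y \<in> closed_segment P X" using t by (metis in_segment(1))
    then show ?thesis using PX yD by auto
  qed
qed

text \<open>In a disk disjoint from the base chord the body is convex and contains with a point \<open>X\<close> the
  whole chord of the disk through \<open>X\<close> towards the base point seen by \<open>X\<close>. As \<open>X\<close> tends to a
  frontier point \<open>Z\<close>, these chords tend to a diameter on the supporting line at \<open>Z\<close>.\<close>

lemma frontier_halfplane: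
  assumes Z: "Z \<in> K" "Z \<in> closure (body p q K)" "Z \<notin> body p q K"
  obtains d e where "d \<noteq> 0" "e > 0" "ball Z e \<subseteq> K" "\<And>z. z \<in> ball Z e \<Longrightarrow> det2 d (z - Z) > 0 \<longleftrightarrow> z \<in> body p q K"
proof -
  obtain e0 where e0: "e0 > 0" "ball Z e0 \<subseteq> K" using pocket_open[OF pk] Z(1) open_contains_ball by blast
  define C where "C = body p q K \<inter> ball Z e0"
  have DU: "ball Z e0 \<subseteq> U" using e0 pocket_subset[OF pk] by auto
  have cC: "convex C" unfolding C_def using body_ball_convex[OF DU] .
  have oC: "open C" unfolding C_def using body_open[OF pk] by auto
  have ZC: "Z \<notin> C" using Z by (simp add: C_def)
  have cl: "\<exists>X\<in>C. dist X Z < r" if "r > 0" for r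
  proof -
    have "min r e0 > 0" using that e0 by simp
    then obtain X where "X \<in> body p q K" "dist X Z < min r e0" using Z(2) unfolding closure_approachable by blast
    then show ?thesis by (auto simp: C_def dist_commute)
  qed
  then have Cne: "C \<noteq> {}" using zero_less_one by blast
  obtain a b where ab: "a \<noteq> 0" "\<forall>x\<in>{Z}. a \<bullet> x \<le> b" "\<forall>x\<in>C. a \<bullet> x \<ge> b"
    using separating_hyperplane_sets[of "{Z}" C] cC ZC Cne by auto
  have nn: "a \<bullet> (x - Z) \<ge> 0" if "x \<in> C" for x using ab that by (auto simp: inner_diff_right)
  have pos: "a \<bullet> (x - Z) > 0" if x: "x \<in> C" for x
  proof (rule ccontr)
    assume "\<not> a \<bullet> (x - Z) > 0"
    then have 0: "a \<bullet> (x - Z) = 0" using nn[OF x] by simp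
    obtain r where r: "r > 0" "ball x r \<subseteq> C" using oC x open_contains_ball by blast
    define w where "w = x - (r / (2 * norm a)) *\<^sub>R a"
    have "dist x w = r / 2" using r ab by (simp add: w_def dist_norm)
    then have "w \<in> C" using r by auto
    have "a \<bullet> (w - Z) = a \<bullet> (x - Z) - (r / (2 * norm a)) * (a \<bullet> a)" by (simp add: w_def inner_diff_right)
    also have "\<dots> < 0" using 0 r ab by simp
    finally show False using nn[OF \<open>w \<in> C\<close>] by simp
  qed
  \<comment> \<open>\<open>a\<close> turned by a right angle, hence a direction of the supporting
    line.\<close>
  define d0 :: "real^2" where "d0 = vector [a$2, - a$1]"
  have cd0: "det2 d0 x = a \<bullet> x" for x by (simp add: det2_def d0_def inner_vec_def sum_2)
  have d0: "d0 \<noteq> 0" using cd0[of a] ab(1) by auto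
  \<comment> \<open>From a point within \<open>e0 / 2\<close> of \<open>Z\<close>, steps of length
    \<open>r\<close> both ways along the line of sight stay in the disk.\<close>
  define r where "r = e0 / 4"
  have "\<exists>X w. X \<in> C \<and> dist X Z < 1 / Suc n \<and> norm w = 1 \<and> (dist X Z < e0 / 2 \<longrightarrow> X + r *\<^sub>R w \<in> C \<and> X - r *\<^sub>R w \<in> C)" for n
  proof -
    obtain X where X: "X \<in> C" "dist X Z < 1 / Suc n" using cl[of "1 / Suc n"] by auto
    obtain y where y: "y \<in> open_segment p q" "sees X y" using X by (auto simp: C_def body_def)
    have "X \<in> K" using X body_subset[OF pk] by (auto simp: C_def)
    then have "X \<noteq> y" using y pocket_disj[OF pk] by auto
    define w where "w = (y - X) /\<^sub>R norm (y - X)"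
    have w1: "norm w = 1" using \<open>X \<noteq> y\<close> by (simp add: w_def)
    have in_C: "X + s *\<^sub>R w \<in> C" if "dist X Z < e0 / 2" "\<bar>s\<bar> \<le> r" for s
    proof -
      have "dist Z (X + s *\<^sub>R w) \<le> dist X Z + norm (s *\<^sub>R w)"
        by (metis dist_commute dist_norm dist_triangle2 add_diff_cancel_left' dist_triangle)
      also have "\<dots> < e0" using that w1 e0 by (simp add: r_def)
      finally have b: "X + s *\<^sub>R w \<in> ball Z e0" by simp
      moreover have "X + s *\<^sub>R w = X + (s / norm (y - X)) *\<^sub>R (y - X)" by (simp add: w_def divide_inverse)
      ultimately show ?thesis 
        using body_disk_chord[OF e0(2) _ \<open>X \<in> K\<close> y, of "s / norm (y - X)"] X(1) by (auto simp: C_def)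
    qed
    have "r \<ge> 0" using e0 by (simp add: r_def)
    show ?thesis
      by (rule exI[of _ X], rule exI[of _ w]) (use X w1 in_C[of r] in_C[of "-r"] \<open>r \<ge> 0\<close> in auto)
  qed
  then obtain X w where Xw: "\<And>n. X n \<in> C" "\<And>n. dist (X n) Z < 1 / Suc n" "\<And>n::nat. norm (w n) = 1"
    "\<And>n. dist (X n) Z < e0 / 2 \<Longrightarrow> X n + r *\<^sub>R w n \<in> C \<and> X n - r *\<^sub>R w n \<in> C" by metis
  have XZ: "X \<longlonglongrightarrow> Z"
  proof (rule LIMSEQ_I)
    fix e :: real assume "e > 0"
    then obtain m where m: "inverse (Suc m) < e" using reals_Archimedean by blast
    have "norm (X n - Z) < e" if "n \<ge> m" for n
    proof -
      have "1 / Suc n \<le> inverse (Suc m)" using that by (simp add: field_simps)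
      then show ?thesis using Xw(2)[of n] m by (simp add: dist_norm)
    qed
    then show "\<exists>m. \<forall>n\<ge>m. norm (X n - Z) < e" by blast
  qed
  have "compact (sphere (0::real^2) 1)" by simp
  moreover have "\<forall>n. w n \<in> sphere 0 1" using Xw(3) by simp
  ultimately obtain l \<sigma> where l: "l \<in> sphere 0 1" "strict_mono (\<sigma>::nat\<Rightarrow>nat)" "(w \<circ> \<sigma>) \<longlonglongrightarrow> l"
    unfolding compact_def by metis
  have XZ': "(\<lambda>n. X (\<sigma> n)) \<longlonglongrightarrow> Z" using LIMSEQ_subseq_LIMSEQ[OF XZ l(2)] by (simp add: o_def)
  have l3: "(\<lambda>n. w (\<sigma> n)) \<longlonglongrightarrow> l" using l(3) by (simp add: o_def)
  have ev: "eventually (\<lambda>n. dist (X (\<sigma> n)) Z < e0 / 2) sequentially" 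
    using tendstoD[OF XZ', of "e0/2"] e0 by simp
  have "Z + r *\<^sub>R l \<in> closure C"
  proof (rule Lim_in_closed_set[of _ "\<lambda>n. X (\<sigma> n) + r *\<^sub>R w (\<sigma> n)" sequentially])
    show "eventually (\<lambda>n. X (\<sigma> n) + r *\<^sub>R w (\<sigma> n) \<in> closure C) sequentially"
      using ev by eventually_elim (use Xw(4) closure_subset in blast)
    show "(\<lambda>n. X (\<sigma> n) + r *\<^sub>R w (\<sigma> n)) \<longlonglongrightarrow> Z + r *\<^sub>R l" by (intro tendsto_intros XZ' l3)
  qed auto
  moreover have "Z - r *\<^sub>R l \<in> closure C"
  proof (rule Lim_in_closed_set[of _ "\<lambda>n. X (\<sigma> n) - r *\<^sub>R w (\<sigma> n)" sequentially])
    show "eventually (\<lambda>n. X (\<sigma> n) - r *\<^sub>R w (\<sigma> n) \<in> closure C) sequentially"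
      using ev by eventually_elim (use Xw(4) closure_subset in blast)
    show "(\<lambda>n. X (\<sigma> n) - r *\<^sub>R w (\<sigma> n)) \<longlonglongrightarrow> Z - r *\<^sub>R l" by (intro tendsto_intros XZ' l3)
  qed auto
  moreover have clnn: "a \<bullet> (x - Z) \<ge> 0" if "x \<in> closure C" for x
  proof -
    have "C \<subseteq> {x. a \<bullet> Z \<le> a \<bullet> x}" using nn by (auto simp: inner_diff_right)
    then have "closure C \<subseteq> {x. a \<bullet> Z \<le> a \<bullet> x}" by (intro closure_minimal closed_Collect_le continuous_intros) 
    then show ?thesis using that by (auto simp: inner_diff_right)
  qed
  \<comment> \<open>The ends of the limiting diameter are symmetric about \<open>Z\<close> and both
    lie in the closed supporting half-plane, so the diameter lies on the supporting line.\<close>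
  ultimately have "r * (a \<bullet> l) \<ge> 0" "r * (a \<bullet> l) \<le> 0" by fastforce+
  then have "a \<bullet> l = 0" using e0 by (simp add: r_def)
  then have "det2 d0 l = 0" using cd0 by simp
  then obtain t where t: "l = t *\<^sub>R d0" using det2_zero_parallel d0 by blast
  then have t0: "t \<noteq> 0" using l(1) by auto
  define m where "m = r * \<bar>t\<bar>"
  have m0: "m > 0" using t0 e0 by (simp add: m_def r_def)
  have cm: "Z + m *\<^sub>R d0 \<in> closure C" "Z - m *\<^sub>R d0 \<in> closure C"
    using \<open>Z + r *\<^sub>R l \<in> closure C\<close> \<open>Z - r *\<^sub>R l \<in> closure C\<close> by (cases "t > 0"; simp add: m_def t)+
  obtain X0 where X0: "X0 \<in> C" using Cne by auto
  define v where "v = X0 - Z"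
  define c where "c = det2 d0 v"
  have c0: "c > 0" using pos[OF X0] by (simp add: c_def cd0 v_def)
  \<comment> \<open>Above the supporting line, \<open>\<phi> z < 1\<close> puts \<open>z\<close>
    into the triangle spanned by \<open>X0\<close> and the two ends of the diameter. This triangle
    is in \<open>closure C\<close>, and the open convex \<open>C\<close> is the interior of its
    closure.\<close>
  define \<phi> where "\<phi> = (\<lambda>z. \<bar>det2 (z - Z) v\<bar> / (c * m) + \<bar>det2 d0 (z - Z)\<bar> / c)"
  have "continuous_on UNIV \<phi>" unfolding \<phi>_def using c0 m0 by (intro continuous_intros) auto
  then have "\<exists>e>0. \<forall>z. dist z Z < e \<longrightarrow> dist (\<phi> z) (\<phi> Z) < 1"
    unfolding continuous_on_iff using zero_less_one by blast
  then obtain e1 where e1: "e1 > 0" "\<And>z. dist z Z < e1 \<Longrightarrow> \<phi> z < 1"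
    by (force simp: \<phi>_def dist_real_def)
  define Ob where "Ob = ball Z e1 \<inter> {z. det2 d0 (z - Z) > 0}"
  have "open Ob" unfolding Ob_def by (intro open_Int open_ball open_Collect_less continuous_intros)
  moreover have "Ob \<subseteq> closure C"
  proof
    fix z assume z: "z \<in> Ob"
    define \<alpha> where "\<alpha> = det2 (z - Z) v / c"
    define \<beta> where "\<beta> = det2 d0 (z - Z) / c"
    have "z - Z = \<alpha> *\<^sub>R d0 + \<beta> *\<^sub>R v"
      using basis_decomp[of d0 v "z - Z"] c0 by (simp add: \<alpha>_def \<beta>_def c_def)
    then have zz: "z = Z + \<alpha> *\<^sub>R d0 + \<beta> *\<^sub>R v" by (simp add: algebra_simps)
    have b0: "\<beta> > 0" using z c0 by (simp add: \<beta>_def Ob_def)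
    have "\<phi> z < 1" using z by (intro e1) (auto simp: Ob_def dist_commute)
    moreover have "\<phi> z = \<bar>\<alpha>\<bar> / m + \<beta>" using c0 m0 b0 z by (simp add: \<phi>_def \<alpha>_def \<beta>_def abs_mult Ob_def)
    ultimately have le: "\<bar>\<alpha> / m\<bar> < 1 - \<beta>" using m0 by simp
    define y where "y = \<alpha> / m"
    define x1 where "x1 = (1 - \<beta>) / 2 + y / 2"
    define x2 where "x2 = (1 - \<beta>) / 2 - y / 2"
    have le2: "y < 1 - \<beta>" "- y < 1 - \<beta>" using le unfolding abs_less_iff y_def by blast+
    have "x1 \<ge> 0" unfolding x1_def using le2 by (simp add: field_simps)
    moreover have "x2 \<ge> 0" unfolding x2_def using le2 by (simp add: field_simps)
    moreover have "x1 + x2 + \<beta> = 1" unfolding x1_def x2_def by (simp add: field_simps)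
    ultimately have x12: "x1 \<ge> 0" "x2 \<ge> 0" "x1 + x2 + \<beta> = 1" by auto
    have am: "(x1 - x2) * m = \<alpha>" using m0 by (simp add: x1_def x2_def y_def field_simps)
    have "x1 *\<^sub>R (Z + m *\<^sub>R d0) + x2 *\<^sub>R (Z - m *\<^sub>R d0) + \<beta> *\<^sub>R X0 = (x1 + x2 + \<beta>) *\<^sub>R Z + ((x1 - x2) * m) *\<^sub>R d0 + \<beta> *\<^sub>R v"
      by (simp add: v_def algebra_simps)
    also have "\<dots> = z" unfolding x12 am zz by simp
    finally have "z \<in> convex hull {Z + m *\<^sub>R d0, Z - m *\<^sub>R d0, X0}" unfolding convex_hull_3 using x12 b0
      by (intro CollectI exI[of _ x1] exI[of _ x2] exI[of _ \<beta>]) auto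
    also have "\<dots> \<subseteq> closure C"
      using cm X0 closure_subset[of C] by (intro hull_minimal convex_closure cC) auto
    finally show "z \<in> closure C" .
  qed
  ultimately have "Ob \<subseteq> interior (closure C)" by (simp add: interior_maximal)
  also have "\<dots> = C" using convex_interior_closure[OF cC] oC by (simp add: interior_open)
  finally have OC: "Ob \<subseteq> C" .
  show thesis
  proof (rule that[OF d0])
    show "min e0 e1 > 0" "ball Z (min e0 e1) \<subseteq> K" using e0 e1 by auto
    fix z assume z: "z \<in> ball Z (min e0 e1)"
    show "det2 d0 (z - Z) > 0 \<longleftrightarrow> z \<in> body p q K"
    proof
      assume "det2 d0 (z - Z) > 0"
      then have "z \<in> Ob" using z by (auto simp: Ob_def)
      then show "z \<in> body p q K" using OC by (auto simp: C_def)
    next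
      assume "z \<in> body p q K"
      then have "z \<in> C" using z by (auto simp: C_def)
      then show "det2 d0 (z - Z) > 0" using pos cd0 by simp
    qed
  qed
qed

end


section \<open>Windows\<close>

text \<open>The endpoints are the first frontier points met from \<open>Z\<close> in the directions
  \<open>d\<close> and \<open>- d\<close>; they exist because \<open>U\<close> is bounded.\<close>

lemma chord_through:
  assumes Z: "Z \<in> U" and d: "d \<noteq> 0"
  obtains p q c where "chord p q" "Z \<in> open_segment p q" "c > 0" "q - p = c *\<^sub>R d"
proof -
  have Zi: "Z \<in> interior U" using Z open_U by (simp add: interior_open)
  have fr: "frontier U \<inter> U = {}" using open_U frontier_disjoint_eq by blast
  obtain s where s: "0 < s" "Z + s *\<^sub>R d \<in> frontier U" "\<And>e. 0 \<le> e \<Longrightarrow> e < s \<Longrightarrow> Z + e *\<^sub>R d \<in> interior U"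
    using ray_to_frontier[OF bounded_U Zi d] by metis
  have "- d \<noteq> 0" using d by simp
  then obtain t where t: "0 < t" "Z + t *\<^sub>R (- d) \<in> frontier U" "\<And>e. 0 \<le> e \<Longrightarrow> e < t \<Longrightarrow> Z + e *\<^sub>R (- d) \<in> interior U"
    using ray_to_frontier[OF bounded_U Zi] by metis
  define p where "p = Z + t *\<^sub>R (- d)"
  define q where "q = Z + s *\<^sub>R d"
  have qp: "q - p = (s + t) *\<^sub>R d" by (simp add: p_def q_def algebra_simps)
  then have pq: "p \<noteq> q" using d s t by auto
  show thesis
  proof (rule that[of p q "s + t"])
    have "open_segment p q \<subseteq> U"
    proof
      fix z assume "z \<in> open_segment p q"
      then obtain u where u: "0 < u" "u < 1" "z = (1 - u) *\<^sub>R p + u *\<^sub>R q" by (auto simp: in_segment)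
      define e where "e = u * s - (1 - u) * t"
      have z: "z = Z + e *\<^sub>R d" by (simp add: u p_def q_def e_def algebra_simps)
      have "u * s < s" "0 < u * s" "(1 - u) * t < t" "0 < (1 - u) * t" using u s t by auto
      then have "e < s" "- e < t" by (auto simp: e_def)
      then have "z \<in> interior U"
        using s(3)[of e] t(3)[of "- e"] by (cases "e \<ge> 0") (auto simp: z)
      then show "z \<in> U" using interior_subset by blast
    qed
    then show "chord p q" using s t fr pq by (auto simp: chord_def p_def q_def)
    have "Z = p + (t / (s + t)) *\<^sub>R (q - p)"
      unfolding qp using s t by (simp add: p_def)
    then show "Z \<in> open_segment p q" using line_open_segment[OF pq, of "t / (s + t)"] s t by simp
  qed (use s t qp in auto)
qed

lemma child_chord:
  assumes "child p q K p' q' L" "x \<in> open_segment p' q'"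
  shows "x \<in> K" "x \<notin> body p q K" "x \<in> closure (body p q K)"
proof -
  have pL: "pocket p' q' L" using assms by (simp add: child_def)
  obtain e where e: "e > 0" "ball x e \<subseteq> K" "\<And>z. z \<in> ball x e \<Longrightarrow> side p' q' z < 0 \<longleftrightarrow> z \<in> body p q K" 
    using assms by (auto simp: child_def)
  show "x \<in> K" "x \<notin> body p q K"
    using e(1,2) e(3)[of x] side_open_segment[OF assms(2)] centre_in_ball[of x e] by auto
  show "x \<in> closure (body p q K)" unfolding closure_approachable
  proof (intro allI impI)
    fix r :: real assume "r > 0"
    have "min r e > 0" using e \<open>r > 0\<close> by simp
    then obtain z where z: "z \<in> ball x (min r e)" "side p' q' z < 0"
      using side_neg_near[OF pocket_ne[OF pL] side_open_segment[OF assms(2)]] by blast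
    then have "z \<in> body p q K" using e(3)[of z] by auto
    then show "\<exists>y\<in>body p q K. dist y x < r" using z by (auto simp: dist_commute)
  qed
qed

context
  fixes p q K assumes pk: "pocket p q K"
begin

text \<open>The local half-plane picture propagates along the chord: the set of points where it holds is open
  and closed in the chord.\<close>

lemma window_good:
  assumes ch: "chord p' q'" and Z: "Z \<in> open_segment p' q'"
    and good: "\<exists>e>0. ball Z e \<subseteq> K \<and> (\<forall>z\<in>ball Z e. side p' q' z < 0 \<longleftrightarrow> z \<in> body p q K)"
    and x: "x \<in> open_segment p' q'"
  shows "\<exists>e>0. ball x e \<subseteq> K \<and> (\<forall>z\<in>ball x e. side p' q' z < 0 \<longleftrightarrow> z \<in> body p q K)"
proof -
  define P where "P = (\<lambda>x. \<exists>e>0. ball x e \<subseteq> K \<and> (\<forall>z\<in>ball x e. side p' q' z < 0 \<longleftrightarrow> z \<in> body p q K))"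
  define w where "w = open_segment p' q'"
  define H where "H = {x \<in> w. P x}"
  have pq: "p' \<noteq> q'" and wU: "w \<subseteq> U" using ch by (auto simp: chord_def w_def)
  have oH: "openin (top_of_set w) H"
  proof (subst openin_contains_ball, intro conjI ballI)
    show "H \<subseteq> w" by (auto simp: H_def)
    fix x assume "x \<in> H"
    then obtain e where e: "e > 0" "ball x e \<subseteq> K" "\<And>z. z\<in>ball x e \<Longrightarrow> side p' q' z < 0 \<longleftrightarrow> z \<in> body p q K"
      by (auto simp: H_def P_def)
    have "ball x e \<inter> w \<subseteq> H"
    proof
      fix y assume y: "y \<in> ball x e \<inter> w"
      have "ball y (e - dist x y) \<subseteq> ball x e" by (metis ball_subset_ball_iff dist_commute add.commute diff_add_cancel order_refl)
      then have "P y" unfolding P_def using y e by (intro exI[of _ "e - dist x y"]) auto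
      then show "y \<in> H" using y by (simp add: H_def)
    qed
    then show "\<exists>e>0. ball x e \<inter> w \<subseteq> H" using e(1) by blast
  qed
  have cH: "closedin (top_of_set w) H"
  proof (subst closedin_limpt, intro conjI allI impI)
    show "H \<subseteq> w" by (auto simp: H_def)
    fix x assume x: "x islimpt H \<and> x \<in> w"
    have lim: "\<exists>h\<in>H. h \<noteq> x \<and> dist h x < e" if "e > 0" for e
      using x that by (auto simp: islimpt_approachable)
    have hb: "h \<in> K" "h \<notin> body p q K" "\<exists>b\<in>body p q K. dist b h < e \<and> side p' q' b < 0" if h: "h \<in> H" "e > 0" for h e
    proof -
      obtain e1 where e1: "e1 > 0" "ball h e1 \<subseteq> K" "\<And>z. z\<in>ball h e1 \<Longrightarrow> side p' q' z < 0 \<longleftrightarrow> z \<in> body p q K"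
        using h by (auto simp: H_def P_def)
      have s0: "side p' q' h = 0" using h side_open_segment by (auto simp: H_def w_def)
      show "h \<in> K" "h \<notin> body p q K" using e1(1,2) e1(3)[of h] s0 centre_in_ball[of h e1] by auto
      have "min e e1 > 0" using e1 h by simp
      then obtain b where b: "b \<in> ball h (min e e1)" "side p' q' b < 0"
        using side_neg_near[OF pq s0] by blast
      then show "\<exists>b\<in>body p q K. dist b h < e \<and> side p' q' b < 0"
        using e1(3)[of b] b by (intro bexI[of _ b]) (auto simp: dist_commute)
    qed
    have xnb: "x \<notin> body p q K"
    proof
      assume "x \<in> body p q K"
      then obtain e where "e > 0" "ball x e \<subseteq> body p q K" using body_open[OF pk] open_contains_ball by blast
      moreover obtain h where "h \<in> H" "dist h x < e" using lim[OF \<open>e > 0\<close>] by blast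
      ultimately show False using hb(2)[of h 1] by (auto simp: dist_commute subset_iff)
    qed
    have xcl: "x \<in> closure (body p q K)" unfolding closure_approachable
    proof (intro allI impI)
      fix e :: real assume "e > 0"
      then obtain h where h: "h \<in> H" "dist h x < e / 2" using lim[of "e/2"] by auto
      obtain b where "b \<in> body p q K" "dist b h < e / 2" using hb(3)[OF h(1), of "e/2"] \<open>e > 0\<close> by auto
      moreover from this have "dist b x < e" using h dist_triangle[of b x h] by simp
      ultimately show "\<exists>y\<in>body p q K. dist y x < e" by blast
    qed
    have xU: "x \<in> U" using x wU by auto
    have "x \<in> closure K" using xcl closure_mono[OF body_subset[OF pk]] by blast
    then have "x \<in> K \<or> x \<in> open_segment p q" using pocket_closure[OF pk] xU by blast
    \<comment> \<open>Next to the base chord every point of the pocket is in the body, whereas the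
      good points tending to \<open>x\<close> are in the pocket but not in the body.\<close>
    moreover have "x \<notin> open_segment p q"
    proof
      assume "x \<in> open_segment p q"
      then obtain e where e: "e > 0" "\<And>z. z \<in> ball x e \<Longrightarrow> side p q z > 0 \<Longrightarrow> z \<in> body p q K"
          "\<And>z. z \<in> ball x e \<Longrightarrow> z \<in> K \<Longrightarrow> side p q z > 0"
        using body_near_chord[OF pk] by metis
      obtain h where h: "h \<in> H" "dist h x < e" using lim[OF e(1)] by blast
      then have "h \<in> ball x e" by (simp add: dist_commute)
      then show False using e(2)[of h] e(3)[of h] hb(1,2)[OF h(1), of 1] by auto
    qed
    ultimately have xK: "x \<in> K" by blast
    obtain d e where de: "d \<noteq> 0" "e > 0" "ball x e \<subseteq> K" "\<And>z. z \<in> ball x e \<Longrightarrow> det2 d (z - x) > 0 \<longleftrightarrow> z \<in> body p q K"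
      using frontier_halfplane[OF pk xK xcl xnb] by metis
    obtain h where h: "h \<in> H" "h \<noteq> x" "dist h x < e" using lim[OF de(2)] by blast
    have nb: "\<exists>b\<in>body p q K. b \<in> ball x e \<and> dist b h < r \<and> side p' q' b < 0" if "r > 0" for r
    proof -
      have "min r (e - dist h x) > 0" using that h by simp
      then obtain b where b: "b \<in> body p q K" "dist b h < min r (e - dist h x)" "side p' q' b < 0" using hb(3)[OF h(1)] by blast
      moreover from b have "dist x b < e" using dist_triangle[of x b h] by (simp add: dist_commute)
      ultimately show ?thesis by auto
    qed
    \<comment> \<open>\<open>h\<close> is outside the body and a limit of it, so it lies on the
      frontier line at \<open>x\<close>. The line through \<open>x\<close> and \<open>h\<close> is
      that of the chord, so the two lines agree.\<close>
    have h0: "det2 d (h - x) = 0"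
    proof (rule ccontr)
      assume "det2 d (h - x) \<noteq> 0"
      moreover have "\<not> det2 d (h - x) > 0" using de(4)[of h] h hb(2)[OF h(1), of 1] by (auto simp: dist_commute)
      ultimately have "det2 d (h - x) < 0" by simp
      then have "h \<in> {z. det2 d (z - x) < 0}" by simp
      moreover have "open {z. det2 d (z - x) < 0}" by (intro open_Collect_less continuous_intros)
      ultimately obtain r where r: "r > 0" "ball h r \<subseteq> {z. det2 d (z - x) < 0}" using open_contains_ball by blast
      obtain b where b: "b \<in> body p q K" "b \<in> ball x e" "dist b h < r" using nb[OF r(1)] by blast
      then have "det2 d (b - x) < 0" using r(2) by (auto simp: dist_commute subset_iff)
      then show False using de(4)[OF b(2)] b(1) by simp
    qed
    have sx: "side p' q' x = 0" "side p' q' h = 0" using x h side_open_segment by (auto simp: H_def w_def)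
    obtain k where k: "h = x + k *\<^sub>R (q' - p')" using line_coords[OF sx pq] .
    then have k0: "k \<noteq> 0" using h by auto
    have "det2 d (q' - p') = 0" using h0 k k0 by (simp add: det2_simps)
    then have "det2 (q' - p') d = 0" using det2_swap[of d "q' - p'"] by simp
    then obtain t where t: "d = t *\<^sub>R (q' - p')" using det2_zero_parallel[of "q' - p'" d] pq by auto
    have sd: "det2 d (z - x) = t * side p' q' z" for z
      unfolding side_diff[OF sx(1), of z] t det2_simps(5) by simp
    \<comment> \<open>A nearby body point on the negative side of \<open>p' q'\<close> excludes the
      opposite half-plane.\<close>
    obtain b where b: "b \<in> body p q K" "b \<in> ball x e" "side p' q' b < 0" using nb[of 1] by auto
    then have "t * side p' q' b > 0" using de(4) sd by metis
    then have "t < 0" using b(3) by (simp add: zero_less_mult_iff)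
    then have "side p' q' z < 0 \<longleftrightarrow> z \<in> body p q K" if "z \<in> ball x e" for z
      using de(4)[OF that] sd[of z] by (simp add: zero_less_mult_iff)
    then have "P x" unfolding P_def using de by blast
    then show "x \<in> H" using x by (simp add: H_def)
  qed
  have "connected w" by (simp add: w_def convex_connected)
  moreover have "Z \<in> H" using Z good by (simp add: H_def P_def w_def)
  ultimately have "H = w" using oH cH connected_clopen by blast
  then show ?thesis using x by (auto simp: H_def P_def w_def)
qed

text \<open>The window is the maximal chord on the supporting line at \<open>Z\<close>, oriented
  along \<open>- d\<close> to have the body on its negative side; \<open>L\<close> is the component
  beyond it. The body and the base chord form a connected set off the window, so \<open>L\<close>
  contains all of it or none, and the local picture at \<open>Z\<close> rules out the
  former.\<close>

lemma child_exists:
  assumes Z: "Z \<in> K" "Z \<in> closure (body p q K)" "Z \<notin> body p q K"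
  obtains p' q' L where "child p q K p' q' L" "Z \<in> open_segment p' q'"
proof -
  obtain d e where de: "d \<noteq> 0" "e > 0" "ball Z e \<subseteq> K" "\<And>z. z \<in> ball Z e \<Longrightarrow> det2 d (z - Z) > 0 \<longleftrightarrow> z \<in> body p q K"
    using frontier_halfplane[OF pk Z] by metis
  have ZU: "Z \<in> U" using Z pocket_subset[OF pk] by auto
  have "- d \<noteq> 0" using de by simp
  then obtain p' q' c where c: "chord p' q'" "Z \<in> open_segment p' q'" "c > 0" "q' - p' = c *\<^sub>R (- d)"
    using chord_through[OF ZU] by metis
  have pq: "p' \<noteq> q'" and wU: "open_segment p' q' \<subseteq> U" using c by (auto simp: chord_def)
  have sZ: "side p' q' z = - c * det2 d (z - Z)" for z
    using side_diff[OF side_open_segment[OF c(2)], of z] c(4) by (simp add: det2_simps algebra_simps)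
  have g: "\<exists>e>0. ball Z e \<subseteq> K \<and> (\<forall>z\<in>ball Z e. side p' q' z < 0 \<longleftrightarrow> z \<in> body p q K)"
    using de c(3) by (intro exI[of _ e]) (auto simp: sZ zero_less_mult_iff)
  note good = window_good[OF c(1,2) g]
  have wK: "x \<in> K" "x \<notin> body p q K" if "x \<in> open_segment p' q'" for x
    using good[OF that] side_open_segment[OF that] centre_in_ball[of x] by (metis less_irrefl subsetD)+
  obtain e1 where e1: "e1 > 0" "ball Z e1 \<subseteq> K" "\<And>z. z \<in> ball Z e1 \<Longrightarrow> side p' q' z < 0 \<longleftrightarrow> z \<in> body p q K"
    using g by blast
  obtain z0 where z0: "z0 \<in> ball Z e1" "side p' q' z0 > 0"
    using side_pos_near[OF pq side_open_segment[OF c(2)] e1(1)] by blast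
  have KU: "K \<subseteq> U" using pocket_subset[OF pk] .
  have z0U: "z0 \<in> U - open_segment p' q'" using z0 e1 KU side_open_segment by fastforce
  define L where "L = connected_component_set (U - open_segment p' q') z0"
  have L: "L \<in> components (U - open_segment p' q')" "z0 \<in> L"
    using z0U by (auto simp: L_def componentsI)
  have half: "ball Z e1 \<inter> {z. side p' q' z > 0} \<subseteq> L"
  proof (rule components_maximal[OF L(1)])
    show "connected (ball Z e1 \<inter> {z. side p' q' z > 0})"
      by (intro convex_connected convex_Int convex_side_pos) auto
    show "ball Z e1 \<inter> {z. side p' q' z > 0} \<subseteq> U - open_segment p' q'"
      using e1(2) KU side_open_segment by fastforce
    show "L \<inter> (ball Z e1 \<inter> {z. side p' q' z > 0}) \<noteq> {}" using L(2) z0 by auto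
  qed
  have "\<not> pocket q' p' L"
  proof
    assume "pocket q' p' L"
    moreover have "Z \<in> open_segment q' p'" using c(2) by (simp add: open_segment_commute)
    ultimately obtain r where r: "r > 0" "\<And>z. z \<in> ball Z r \<Longrightarrow> side q' p' z > 0 \<longleftrightarrow> z \<in> L"
      using pocket_local by metis
    have "min r e1 > 0" using r e1 by simp
    then obtain z where z: "z \<in> ball Z (min r e1)" "side p' q' z > 0"
      using side_pos_near[OF pq side_open_segment[OF c(2)]] by blast
    then have "z \<in> L" using half by auto
    then show False using r(2)[of z] z side_swap[of q' p' z] by auto
  qed
  then have pL: "pocket p' q' L" using pocket_exists[OF c(1) L(1)] by blast
  have disj: "(body p q K \<union> open_segment p q) \<inter> open_segment p' q' = {}"
    using wK pocket_disj[OF pk] by blast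
  have BU: "body p q K \<union> open_segment p q \<subseteq> U"
    using body_subset[OF pk] KU pocket_chord_subset[OF pk] by blast
  have LB: "L \<inter> (body p q K \<union> open_segment p q) = {}"
  proof (rule ccontr)
    assume "L \<inter> (body p q K \<union> open_segment p q) \<noteq> {}"
    then obtain x where x: "x \<in> L" "x \<in> body p q K \<union> open_segment p q" by blast
    have sub: "body p q K \<union> open_segment p q \<subseteq> L"
      by (rule pocket_maximal[OF pL body_chord_connected[OF pk] BU disj x(2,1)])
    obtain r where r: "r > 0" "\<And>z. z \<in> ball Z r \<Longrightarrow> side p' q' z > 0 \<longleftrightarrow> z \<in> L"
      using pocket_local[OF pL c(2)] by metis
    have "min r e1 > 0" using r e1 by simp
    then obtain z where z: "z \<in> ball Z (min r e1)" "side p' q' z < 0"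
      using side_neg_near[OF pq side_open_segment[OF c(2)]] by blast
    then show False using e1(3)[of z] r(2)[of z] z sub by auto
  qed
  have "L \<subseteq> K"
    by (rule pocket_maximal[OF pk pocket_connected[OF pL] pocket_subset[OF pL], of z0])
      (use LB L(2) z0 e1 in auto)
  then have "child p q K p' q' L" unfolding child_def using pL LB good by blast
  then show thesis using that c(2) by blast
qed

text \<open>For \<open>B\<close> off the closure of the body, let \<open>D\<close> be its component
  in the pocket minus that closure. As \<open>K\<close> is connected, \<open>D\<close> reaches the
  frontier of the body at some \<open>Z\<close>; there it lies beyond the window through
  \<open>Z\<close>, which it cannot cross.\<close>

lemma child_cover:
  assumes B: "B \<in> K" "B \<notin> body p q K"
  obtains p' q' L where "child p q K p' q' L" "B \<in> L \<union> open_segment p' q'"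
proof (cases "B \<in> closure (body p q K)")
  case True
  then show thesis using child_exists[OF B(1) True B(2)] that by blast
next
  case False
  define V where "V = K - closure (body p q K)"
  have oV: "open V" unfolding V_def using pocket_open[OF pk] by (simp add: open_Diff)
  define D where "D = connected_component_set V B"
  have BV: "B \<in> V" using False B by (simp add: V_def)
  have D: "D \<in> components V" "B \<in> D" "open D" "connected D" "D \<subseteq> V"
    using BV oV by (auto simp: D_def componentsI open_connected_component connected_component_subset)
  have Db: "D \<inter> body p q K = {}" using D(5) closure_subset[of "body p q K"] by (auto simp: V_def)
  have "\<exists>Z. Z \<in> K \<and> Z \<in> closure D \<and> Z \<in> closure (body p q K)"
  proof (rule ccontr)
    assume no: "\<nexists>Z. Z \<in> K \<and> Z \<in> closure D \<and> Z \<in> closure (body p q K)"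
    have KD: "K \<inter> closure D \<subseteq> D"
      using closure_component[OF D(1)] no by (auto simp: V_def)
    then have "D \<inter> K = {} \<or> (- closure D) \<inter> K = {}"
      using connectedD[OF pocket_connected[OF pk] D(3), of "- closure D"] closure_subset[of D] by auto
    then have "K \<subseteq> D" using KD D(2) B by auto
    then show False using Db body_nonempty[OF pk] body_subset[OF pk] by blast
  qed
  then obtain Z where Z: "Z \<in> K" "Z \<in> closure D" "Z \<in> closure (body p q K)" by blast
  have "Z \<notin> body p q K"
    using Z(2) Db open_Int_closure_eq_empty[OF body_open[OF pk], of D] by auto
  then obtain p' q' L where c: "child p q K p' q' L" "Z \<in> open_segment p' q'"
    using child_exists Z by metis
  have pL: "pocket p' q' L" using c by (simp add: child_def)
  note wcl = child_chord(3)[OF c(1)]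
  obtain e where e: "e > 0" "\<And>z. z \<in> ball Z e \<Longrightarrow> side p' q' z < 0 \<longleftrightarrow> z \<in> body p q K" using c by (auto simp: child_def)
  obtain r where r: "r > 0" "\<And>z. z \<in> ball Z r \<Longrightarrow> side p' q' z > 0 \<longleftrightarrow> z \<in> L"
    "\<And>z. z \<in> ball Z r \<Longrightarrow> side p' q' z = 0 \<Longrightarrow> z \<in> open_segment p' q'"
    using pocket_local[OF pL c(2)] by metis
  have "min e r > 0" using e r by simp
  then obtain x where x: "x \<in> D" "dist x Z < min e r" using Z(2) unfolding closure_approachable by blast
  then have xb: "x \<in> ball Z e" "x \<in> ball Z r" by (auto simp: dist_commute)
  have xcl: "x \<notin> closure (body p q K)" using x D(5) by (auto simp: V_def)
  then have "x \<notin> body p q K" "x \<notin> open_segment p' q'" using closure_subset wcl by blast+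
  then have "\<not> side p' q' x < 0" "side p' q' x \<noteq> 0" using e(2)[OF xb(1)] r(3)[OF xb(2)] by auto
  then have "x \<in> L" using r(2)[OF xb(2)] by linarith
  moreover have "D \<inter> open_segment p' q' = {}" using wcl D(5) by (auto simp: V_def)
  moreover have "D \<subseteq> U" using D(5) pocket_subset[OF pk] by (auto simp: V_def)
  ultimately have "D \<subseteq> L" using pocket_maximal[OF pL D(4)] x(1) by blast
  then show thesis using that[OF c(1)] D(2) by blast
qed

end

end

section \<open>The tree of bodies\<close>

type_synonym node = "(real^2) \<times> (real^2) \<times> (real^2) set"

abbreviation nreg :: "node \<Rightarrow> (real^2) set" where "nreg n \<equiv> snd (snd n)"
abbreviation nchord :: "node \<Rightarrow> (real^2) set" where "nchord n \<equiv> open_segment (fst n) (fst (snd n))"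
abbreviation nside :: "node \<Rightarrow> real^2 \<Rightarrow> real" where "nside n \<equiv> side (fst n) (fst (snd n))"

lemma on_subline:
  assumes "u \<le> s" "s \<le> w"
  shows "A + s *\<^sub>R (B - A) \<in> closed_segment (A + u *\<^sub>R (B - A)) (A + w *\<^sub>R (B - A :: 'a::real_vector))"
proof (cases "u = w")
  case False
  define c where "c = (s - u) / (w - u)"
  have c: "0 \<le> c" "c \<le> 1" using assms False by (auto simp: c_def divide_le_eq)
  have "c * (w - u) = s - u" using False by (simp add: c_def)
  moreover have "(1 - c) *\<^sub>R (A + u *\<^sub>R (B - A)) + c *\<^sub>R (A + w *\<^sub>R (B - A)) = A + (u + c * (w - u)) *\<^sub>R (B - A)"
    by (simp add: algebra_simps)
  ultimately have "A + s *\<^sub>R (B - A) = (1 - c) *\<^sub>R (A + u *\<^sub>R (B - A)) + c *\<^sub>R (A + w *\<^sub>R (B - A))" by simp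
  then show ?thesis using c by (metis in_segment(1))
qed (use assms in simp)

context region
begin

abbreviation npocket :: "node \<Rightarrow> bool" where
  "npocket n \<equiv> pocket (fst n) (fst (snd n)) (nreg n)"
abbreviation nbody :: "node \<Rightarrow> (real^2) set" where
  "nbody n \<equiv> body (fst n) (fst (snd n)) (nreg n)"
abbreviation nchild :: "node \<Rightarrow> node \<Rightarrow> bool" where
  "nchild n n' \<equiv> child (fst n) (fst (snd n)) (nreg n) (fst n') (fst (snd n')) (nreg n')"

lemma pocket_not_swap:
  assumes "pocket p q K" shows "\<not> pocket q p K"
proof
  assume b: "pocket q p K"
  have m: "midpoint p q \<in> open_segment p q" "midpoint p q \<in> open_segment q p"
    using pocket_ne[OF assms] by (simp_all add: open_segment_commute)
  obtain e where e: "e > 0" "\<And>z. z \<in> ball (midpoint p q) e \<Longrightarrow> side p q z > 0 \<longleftrightarrow> z \<in> K"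
    using pocket_local[OF assms m(1)] by metis
  obtain r where r: "r > 0" "\<And>z. z \<in> ball (midpoint p q) r \<Longrightarrow> side q p z > 0 \<longleftrightarrow> z \<in> K"
    using pocket_local[OF b m(2)] by metis
  have "min e r > 0" using e r by simp
  then obtain z where z: "z \<in> ball (midpoint p q) (min e r)" "side p q z > 0"
    using side_pos_near[OF pocket_ne[OF assms] side_open_segment[OF m(1)]] by blast
  then show False using e(2)[of z] r(2)[of z] side_swap[of q p z] by auto
qed

lemma chord_in_closure:
  assumes "pocket p q K" shows "open_segment p q \<subseteq> closure K"
proof
  fix x assume x: "x \<in> open_segment p q"
  obtain e where e: "e > 0" "\<And>z. z \<in> ball x e \<Longrightarrow> side p q z > 0 \<longleftrightarrow> z \<in> K"
    using pocket_local[OF assms x] by metis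
  show "x \<in> closure K" unfolding closure_approachable
  proof (intro allI impI)
    fix r :: real assume "r > 0"
    then have "min e r > 0" using e by simp
    then obtain z where z: "z \<in> ball x (min e r)" "side p q z > 0"
      using side_pos_near[OF pocket_ne[OF assms] side_open_segment[OF x]] by blast
    then show "\<exists>y\<in>K. dist y x < r" using e(2)[of z] by (auto simp: dist_commute)
  qed
qed

text \<open>The chord is recovered as the part of the frontier of \<open>K\<close> inside
  \<open>U\<close>, its orientation by \<open>pocket_not_swap\<close>. Pockets can therefore stand
  for nodes in disjointness arguments.\<close>

lemma pocket_unique:
  assumes "pocket p q K" "pocket p' q' K" shows "p = p'" "q = q'"
proof -
  have e: "open_segment p q = U \<inter> closure K - K" if "pocket p q K" for p q
    using chord_in_closure[OF that] pocket_chord_subset[OF that] pocket_disj[OF that] pocket_closure[OF that] by blast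
  have "open_segment p q = open_segment p' q'" using e[OF assms(1)] e[OF assms(2)] by simp
  then have "{p, q} = {p', q'}" using pocket_ne[OF assms(1)] by (auto simp: open_segment_eq)
  then show "p = p'" "q = q'" using pocket_not_swap assms by (auto simp: doubleton_eq_iff)
qed

lemma child_pocket: "child p q K p' q' L \<Longrightarrow> pocket p' q' L"
  and child_subset: "child p q K p' q' L \<Longrightarrow> L \<subseteq> K"
  and child_body_disj: "child p q K p' q' L \<Longrightarrow> L \<inter> body p q K = {}"
  by (simp_all add: child_def)

text \<open>An open \<open>L1\<close> that misses the body misses its closure, hence the window of
  \<open>L2\<close>. Being connected and meeting \<open>L2\<close>, it stays inside
  \<open>L2\<close>; the converse inclusion is symmetric.\<close>

lemma children_disjoint:
  assumes "child p q K p1 q1 L1" "child p q K p2 q2 L2" "L1 \<inter> L2 \<noteq> {}"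
  shows "p1 = p2" "q1 = q2" "L1 = L2"
proof -
  have a: "L \<subseteq> L'" if c: "child p q K p1 q1 L" "child p q K p2 q2 L'" "L \<inter> L' \<noteq> {}" for p1 q1 L p2 q2 L'
  proof -
    obtain x where x: "x \<in> L" "x \<in> L'" using c(3) by auto
    have pL: "pocket p1 q1 L" "pocket p2 q2 L'" using c by (simp_all add: child_def)
    have "L \<inter> closure (body p q K) = {}"
      using child_body_disj[OF c(1)] open_Int_closure_eq_empty[OF pocket_open[OF pL(1)]] by blast
    then have "L \<inter> open_segment p2 q2 = {}" using child_chord(3)[OF c(2)] by blast
    then show ?thesis
      using pocket_maximal[OF pL(2) pocket_connected[OF pL(1)] pocket_subset[OF pL(1)] _ x] by blast
  qed
  show "L1 = L2" using a[OF assms] a[OF assms(2,1)] assms(3) by blast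
  then show "p1 = p2" "q1 = q2"
    using pocket_unique[OF child_pocket[OF assms(1)], of p2 q2] child_pocket[OF assms(2)] by auto
qed

text \<open>Reachability of the chord by a polygonal line of \<open>n\<close> segments in
  \<open>U\<close>: the measure that limits how deep a point has to be followed into the
  tree.\<close>

fun link :: "real^2 \<Rightarrow> real^2 \<Rightarrow> nat \<Rightarrow> real^2 \<Rightarrow> bool" where
  "link p q 0 A \<longleftrightarrow> A \<in> open_segment p q"
| "link p q (Suc n) A \<longleftrightarrow> (\<exists>B. sees A B \<and> link p q n B)"

text \<open>Nearby points see each other, so the points with some link number and those with none
  are both open in the connected \<open>U\<close>.\<close>

lemma link_exists:
  assumes "chord p q" "A \<in> U"
  obtains n where "link p q n A"
proof -
  define G where "G = {A \<in> U. \<exists>n. link p q n A}"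
  have seg: "x \<in> G \<longleftrightarrow> y \<in> G" if "e > 0" "ball x e \<subseteq> U" "y \<in> ball x e" for x y e
  proof -
    have "closed_segment x y \<subseteq> ball x e" using that by (intro closed_segment_subset) auto
    then have s: "sees x y" "sees y x" using that by (auto simp: closed_segment_commute)
    then have "x \<in> U" "y \<in> U" by auto
    moreover have "link p q (Suc n) x" if "link p q n y" for n using s that by auto
    moreover have "link p q (Suc n) y" if "link p q n x" for n using s that by auto
    ultimately show ?thesis unfolding G_def by blast
  qed
  have "open G"
    unfolding open_contains_ball
  proof
    fix x assume x: "x \<in> G"
    then have "x \<in> U" by (simp add: G_def)
    then obtain e where e: "e > 0" "ball x e \<subseteq> U" using open_U open_contains_ball by blast
    then have "ball x e \<subseteq> G" using seg[OF e] x by blast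
    then show "\<exists>e>0. ball x e \<subseteq> G" using e(1) by blast
  qed
  moreover have "open (U - G)"
    unfolding open_contains_ball
  proof
    fix x assume x: "x \<in> U - G"
    then obtain e where e: "e > 0" "ball x e \<subseteq> U" using open_U open_contains_ball by blast
    then have "ball x e \<subseteq> U - G" using seg[OF e] x by blast
    then show "\<exists>e>0. ball x e \<subseteq> U - G" using e(1) by blast
  qed
  ultimately have "G \<inter> U = {} \<or> (U - G) \<inter> U = {}"
    using connectedD[OF connected_U, of G "U - G"] by blast
  moreover have "midpoint p q \<in> G"
  proof -
    have "midpoint p q \<in> open_segment p q" using assms by (simp add: chord_def)
    moreover from this have "midpoint p q \<in> U" using assms by (auto simp: chord_def)
    moreover have "link p q 0 (midpoint p q)" using calculation by simp
    ultimately show ?thesis unfolding G_def by blast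
  qed
  ultimately have "A \<in> G" using assms(2) by (auto simp: G_def)
  then show thesis using that by (auto simp: G_def)
qed

text \<open>A polygonal line from the child to the base chord must pass the window. The segment that
  hits it is never the last one before the base chord, since its starting point would see the base
  and belong to the body; so at least one segment is saved.\<close>

lemma link_descend:
  assumes pk: "pocket p q K" and c: "child p q K p' q' L"
  shows "A \<in> L \<Longrightarrow> link p q n A \<Longrightarrow> \<exists>m<n. link p' q' m A"
proof (induction n arbitrary: A)
  case 0
  then show ?case using child_subset[OF c] pocket_disj[OF pk] by auto
next
  case (Suc n)
  then obtain B where B: "sees A B" "link p q n B" by auto
  note pL = child_pocket[OF c]
  have n0: "n \<noteq> 0"
  proof
    assume "n = 0"
    then have "A \<in> body p q K" using B Suc.prems child_subset[OF c] by (auto simp: body_def)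
    then show False using child_body_disj[OF c] Suc.prems by auto
  qed
  show ?case
  proof (cases "closed_segment A B \<inter> open_segment p' q' = {}")
    case True
    then have "B \<in> L" using pocket_maximal[OF pL _ B(1) True _ Suc.prems(1)] by auto
    then obtain m where "m < n" "link p' q' m B" using Suc.IH B(2) by blast
    then have "link p' q' (Suc m) A" "Suc m < Suc n" using B(1) by auto
    then show ?thesis by blast
  next
    case False
    then obtain X where X: "X \<in> closed_segment A B" "X \<in> open_segment p' q'" by auto
    then have "sees A X" using B(1) by (meson ends_in_segment(1) subset_closed_segment subset_trans)
    then have "link p' q' (Suc 0) A" using X by auto
    then show ?thesis using n0 by blast
  qed
qed

text \<open>A connected subset of \<open>U\<close> that meets \<open>K\<close> and avoids the chord
  stays in \<open>K\<close>, so the segment hits the chord; along it \<open>side p q\<close> is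
  affine, positive at \<open>A\<close> and zero at the hit.\<close>

lemma crossing:
  assumes pk: "pocket p q K" and A: "A \<in> K" and B: "B \<notin> K" and AB: "sees A B"
    and Bn: "B \<notin> open_segment p q"
  obtains t where "0 < t" "t < 1" "A + t *\<^sub>R (B - A) \<in> open_segment p q" "A \<in> body p q K"
    "side p q A > 0" "side p q B < 0" "(1 - t) * side p q A + t * side p q B = 0"
proof -
  have "closed_segment A B \<inter> open_segment p q \<noteq> {}"
  proof
    assume *: "closed_segment A B \<inter> open_segment p q = {}"
    have "closed_segment A B \<subseteq> K" using pocket_maximal[OF pk _ AB * _ A] by auto
    then show False using B by auto
  qed
  then obtain X where X: "X \<in> closed_segment A B" "X \<in> open_segment p q" by auto
  then obtain t where t: "0 \<le> t" "t \<le> 1" "X = (1 - t) *\<^sub>R A + t *\<^sub>R B" "side p q X = (1 - t) * side p q A + t * side p q B"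
    using side_segment by blast
  have AX: "sees A X" using X AB by (meson ends_in_segment(1) subset_closed_segment subset_trans)
  have Ab: "A \<in> body p q K" using A X AX by (auto simp: body_def)
  have sA: "side p q A > 0" using body_side[OF pk Ab] .
  have z: "(1 - t) * side p q A + t * side p q B = 0" using t(4) side_open_segment[OF X(2)] by simp
  have "t \<noteq> 0" using z sA by auto
  moreover have "t \<noteq> 1" using X(2) t(3) Bn by auto
  ultimately have t': "0 < t" "t < 1" using t by auto
  have "(1 - t) * side p q A > 0" using t' sA by simp
  then have "t * side p q B < 0" using z by linarith
  then have sB: "side p q B < 0" using t' by (simp add: mult_less_0_iff)
  have "A + t *\<^sub>R (B - A) = X" by (simp add: t algebra_simps)
  then show thesis using that[OF t' _ Ab sA sB z] X by simp
qed

text \<open>Just past the window \<open>side p' q'\<close> is negative, and close to the window the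
  negative side is the parent's body.\<close>

lemma near_cross:
  assumes c: "child p q K p' q' L" and X: "A + t *\<^sub>R (B - A) \<in> open_segment p' q'"
    and s: "side p' q' A > 0" "side p' q' B < 0" "(1 - t) * side p' q' A + t * side p' q' B = 0" and e: "e > 0"
  obtains u where "t < u" "u < t + e" "A + u *\<^sub>R (B - A) \<in> body p q K"
proof -
  obtain r where r: "r > 0" "\<And>z. z \<in> ball (A + t *\<^sub>R (B - A)) r \<Longrightarrow> side p' q' z < 0 \<longleftrightarrow> z \<in> body p q K"
    using c X by (auto simp: child_def)
  define N1 where "N1 = norm (B - A) + 1"
  define d where "d = min (e / 2) (r / (2 * N1))"
  have np: "N1 > 0" unfolding N1_def by (smt (verit) norm_ge_zero)
  have d: "0 < d" "d < e" using e r np by (auto simp: d_def)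
  have "dist (A + t *\<^sub>R (B - A)) (A + (t + d) *\<^sub>R (B - A)) = d * norm (B - A)"
    using d by (simp add: dist_norm algebra_simps flip: scaleR_diff_right)
  also have "\<dots> \<le> r / (2 * N1) * N1"
    using d by (intro mult_mono) (auto simp: d_def N1_def)
  also have "\<dots> < r" using r np by simp
  finally have b: "A + (t + d) *\<^sub>R (B - A) \<in> ball (A + t *\<^sub>R (B - A)) r" by simp
  have "A + (t + d) *\<^sub>R (B - A) = (1 - (t + d)) *\<^sub>R A + (t + d) *\<^sub>R B" by (simp add: algebra_simps)
  then have "side p' q' (A + (t + d) *\<^sub>R (B - A)) = (1 - (t + d)) * side p' q' A + (t + d) * side p' q' B"
    by (metis side_affine)
  also have "\<dots> = - d * side p' q' A + d * side p' q' B" using s(3) by (simp add: algebra_simps)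
  also have "\<dots> < 0" using d s mult_pos_pos[of d "side p' q' A"] mult_pos_neg[of d "side p' q' B"] by linarith
  finally have "A + (t + d) *\<^sub>R (B - A) \<in> body p q K" using r(2)[OF b] by simp
  then show thesis using that[of "t + d"] d by simp
qed

section \<open>The charging rules and the case analysis of a visible pair\<close>

definition beyond_chord :: "node \<Rightarrow> real^2 \<Rightarrow> real^2 \<Rightarrow> bool" where
  "beyond_chord n A B \<longleftrightarrow> B \<notin> nreg n \<and> - nside n B \<le> 3 * nside n A"

definition below_in_body :: "node \<Rightarrow> real^2 \<Rightarrow> real^2 \<Rightarrow> bool" where
  "below_in_body n A B \<longleftrightarrow> midpoint A B \<in> nbody n \<and> nside n (midpoint A B) \<le> nside n A"

text \<open>The factor 3 makes the segment cross the window at parameter at most 1/4; comparing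
  heights over the base of \<open>m\<close> decides which point is charged when both lie in
  children.\<close>

definition below_in_parent :: "node \<Rightarrow> node \<Rightarrow> real^2 \<Rightarrow> real^2 \<Rightarrow> bool" where
  "below_in_parent m n A B \<longleftrightarrow> nchild m n \<and> B \<notin> nreg n \<and> - nside n B \<ge> 3 * nside n A \<and> midpoint A B \<in> nbody m \<and> nside m B \<le> nside m A"

lemma midpoint_line: "midpoint A B = A + (1/2) *\<^sub>R (B - A :: real^2)"
  by (simp add: midpoint_def vec_eq_iff field_simps)

lemma side_midpoint: "side p q (midpoint A B) = (side p q A + side p q B) / 2"
proof -
  have "midpoint A B = (1 - 1/2) *\<^sub>R A + (1/2) *\<^sub>R B" by (simp add: midpoint_def algebra_simps)
  then show ?thesis by (simp only: side_affine) simp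
qed

text \<open>By \<open>body_segment\<close> a body meets a visible segment in an interval.\<close>

lemma body_between:
  assumes pk: "pocket p q K" and AB: "sees A B" and u: "0 \<le> u" "u \<le> s" "s \<le> w" "w \<le> 1"
    and b: "A + u *\<^sub>R (B - A) \<in> body p q K" "A + w *\<^sub>R (B - A) \<in> body p q K"
  shows "A + s *\<^sub>R (B - A) \<in> body p q K"
proof -
  have "A + u *\<^sub>R (B - A) \<in> closed_segment A B" "A + w *\<^sub>R (B - A) \<in> closed_segment A B"
    using on_subline[of 0 u 1 A B] on_subline[of 0 w 1 A B] u by auto
  then have "sees (A + u *\<^sub>R (B - A)) (A + w *\<^sub>R (B - A))" 
    using AB by (meson subset_closed_segment subset_trans)
  from body_segment[OF pk b this] show ?thesis using on_subline[OF u(2,3)] by blast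
qed

definition related :: "node \<Rightarrow> node \<Rightarrow> real^2 \<Rightarrow> real^2 \<Rightarrow> bool" where
  "related m n A B \<longleftrightarrow> A \<in> nbody n \<and> (beyond_chord n A B \<or> below_in_body n A B \<or> below_in_parent m n A B)"

text \<open>If \<open>beyond_chord\<close> fails for \<open>A\<close>, the window is crossed before
  the midpoint. The segment is in the parent's body just after the crossing and again at
  \<open>B\<close>, hence at the midpoint, and whichever of \<open>A\<close> and \<open>B\<close> is
  higher over the parent's base is charged.\<close>

lemma cross_child_body:
  assumes pk: "npocket n" and c: "nchild n l" and A: "A \<in> nreg l" and B: "B \<in> nbody n" 
    and AB: "sees A B"
  shows "related n l A B \<or> related m n B A"
proof -
  note pL = child_pocket[OF c]
  have Bl: "B \<notin> nreg l" using child_body_disj[OF c] B by auto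
  have Bw: "B \<notin> nchord l" using child_chord(2)[OF c] B by auto
  obtain t where t: "0 < t" "t < 1" "A + t *\<^sub>R (B - A) \<in> nchord l" "A \<in> nbody l"
    "nside l A > 0" "nside l B < 0" "(1 - t) * nside l A + t * nside l B = 0"
    using crossing[OF pL A Bl AB Bw] by metis
  show ?thesis
  proof (cases "- nside l B \<le> 3 * nside l A")
    case True
    then have "beyond_chord l A B" using Bl by (simp add: beyond_chord_def)
    then show ?thesis using t by (simp add: related_def)
  next
    case False
    have "t < 1/2"
    proof (rule ccontr)
      assume "\<not> t < 1/2"
      have "- (t * nside l B) = (1 - t) * nside l A" using t(7) by linarith
      also have "\<dots> \<le> t * nside l A" using \<open>\<not> t < 1/2\<close> t(5) by (intro mult_right_mono) auto
      finally have "t * (- nside l B) \<le> t * nside l A" by simp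
      then have "- nside l B \<le> nside l A" using t(1) by (metis mult_le_cancel_left_pos)
      then show False using False t(5) by linarith
    qed
    then obtain u where u: "t < u" "u < 1/2" "A + u *\<^sub>R (B - A) \<in> nbody n"
      using near_cross[OF c t(3,5,6,7), of "1/2 - t"] by auto
    have "A + 1 *\<^sub>R (B - A) \<in> nbody n" using B by simp
    then have N: "midpoint A B \<in> nbody n" unfolding midpoint_line
      using body_between[OF pk AB _ _ _ _ u(3), of "1/2" 1] u t by auto
    show ?thesis
    proof (cases "nside n B \<le> nside n A")
      case True
      then have "below_in_parent n l A B" using False c Bl N by (simp add: below_in_parent_def)
      then show ?thesis using t by (simp add: related_def)
    next
      case False
      then have "below_in_body n B A" using N by (simp add: below_in_body_def side_midpoint midpoint_sym[of B A])
      then show ?thesis using B by (simp add: related_def)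
    qed
  qed
qed

text \<open>If \<open>beyond_chord\<close> fails for both points, each window is crossed before the
  midpoint as seen from its own point. The parent's body then contains points of the segment on both
  sides of the midpoint.\<close>

lemma cross_two_children:
  assumes pk: "npocket n" and c: "nchild n l" "nchild n k" 
    and A: "A \<in> nreg l" "A \<notin> nreg k" "A \<notin> nchord k" and B: "B \<in> nreg k" "B \<notin> nreg l" "B \<notin> nchord l"
    and AB: "sees A B"
  shows "related n l A B \<or> related n k B A"
proof -
  obtain t where t: "0 < t" "t < 1" "A + t *\<^sub>R (B - A) \<in> nchord l" "A \<in> nbody l"
    "nside l A > 0" "nside l B < 0" "(1 - t) * nside l A + t * nside l B = 0"
    using crossing[OF child_pocket[OF c(1)] A(1) B(2) AB B(3)] by metis
  have BA: "sees B A" using AB by (simp add: closed_segment_commute)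
  obtain s where s: "0 < s" "s < 1" "B + s *\<^sub>R (A - B) \<in> nchord k" "B \<in> nbody k"
    "nside k B > 0" "nside k A < 0" "(1 - s) * nside k B + s * nside k A = 0"
    using crossing[OF child_pocket[OF c(2)] B(1) A(2) BA A(3)] by metis
  have half: "x < 1/2" if "0 < x" "(1 - x) * a + x * b = 0" "\<not> - b \<le> 3 * a" "a > 0" for x a b :: real
  proof (rule ccontr)
    assume "\<not> x < 1/2"
    have "- (x * b) = (1 - x) * a" using that by linarith
    also have "\<dots> \<le> x * a" using \<open>\<not> x < 1/2\<close> that by (intro mult_right_mono) auto
    finally have "x * (- b) \<le> x * a" by simp
    then have "- b \<le> a" using that(1) by (metis mult_le_cancel_left_pos)
    then show False using that by linarith
  qed
  consider "- nside l B \<le> 3 * nside l A" | "- nside k A \<le> 3 * nside k B" 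
    | "\<not> - nside l B \<le> 3 * nside l A" "\<not> - nside k A \<le> 3 * nside k B" by blast
  then show ?thesis
  proof cases
    case 1
    then have "beyond_chord l A B" using B by (simp add: beyond_chord_def)
    then show ?thesis using t by (simp add: related_def)
  next
    case 2
    then have "beyond_chord k B A" using A by (simp add: beyond_chord_def)
    then show ?thesis using s by (simp add: related_def)
  next
    case 3
    have "t < 1/2" "s < 1/2" using half[OF t(1,7) 3(1) t(5)] half[OF s(1,7) 3(2) s(5)] by auto
    then obtain u where u: "t < u" "u < 1/2" "A + u *\<^sub>R (B - A) \<in> nbody n"
      using near_cross[OF c(1) t(3,5,6,7), of "1/2 - t"] by auto
    obtain w where w: "s < w" "w < 1/2" "B + w *\<^sub>R (A - B) \<in> nbody n"
      using near_cross[OF c(2) s(3,5,6,7), of "1/2 - s"] \<open>s < 1/2\<close> by auto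
    have "B + w *\<^sub>R (A - B) = A + (1 - w) *\<^sub>R (B - A)" by (simp add: algebra_simps)
    then have w': "A + (1 - w) *\<^sub>R (B - A) \<in> nbody n" using w(3) by simp
    have N: "midpoint A B \<in> nbody n" unfolding midpoint_line
      using body_between[OF pk AB _ _ _ _ u(3) w', of "1/2"] u t w s by auto
    show ?thesis
    proof (cases "nside n B \<le> nside n A")
      case True
      then have "below_in_parent n l A B" using 3 c B N by (simp add: below_in_parent_def)
      then show ?thesis using t by (simp add: related_def)
    next
      case False
      then have "below_in_parent n k B A" using 3 c A N by (simp add: below_in_parent_def midpoint_sym[of B A])
      then show ?thesis using s by (simp add: related_def)
    qed
  qed
qed

text \<open>Triples of depth, parent and node. The root is entered as its own parent, a default
  value that \<open>below_in_parent\<close> rejects because no pocket is a child of itself.\<close>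

inductive_set nodes :: "node \<Rightarrow> (nat \<times> node \<times> node) set" for r :: node where
  root: "npocket r \<Longrightarrow> (0, r, r) \<in> nodes r"
| child: "(d, m, n) \<in> nodes r \<Longrightarrow> nchild n l \<Longrightarrow> (Suc d, n, l) \<in> nodes r"

lemma nodes_pocket: "(d, m, n) \<in> nodes r \<Longrightarrow> npocket n"
  by (induction rule: nodes.induct) (auto intro: child_pocket)

text \<open>The tree is descended as long as one child contains both points; the link number of
  \<open>A\<close> for the current base drops each time, so the descent ends. As both points avoid
  all windows, a point outside the body lies in a child.\<close>

lemma pair_cases:
  assumes "(d, m, n) \<in> nodes r" "A \<in> nreg n" "B \<in> nreg n" "sees A B"
    "link (fst n) (fst (snd n)) i A"
    "\<And>d m n. (d, m, n) \<in> nodes r \<Longrightarrow> A \<notin> nchord n \<and> B \<notin> nchord n"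
  shows "\<exists>d m n. (d, m, n) \<in> nodes r \<and> (related m n A B \<or> related m n B A)"
  using assms(1-3,5)
proof (induction i arbitrary: d m n rule: less_induct)
  case (less i)
  note pk = nodes_pocket[OF less.prems(1)]
  note AB = assms(4)
  have BA: "sees B A" using AB by (simp add: closed_segment_commute)
  have get: "\<exists>l. nchild n l \<and> x \<in> nreg l \<and> (Suc d, n, l) \<in> nodes r" if "x \<in> {A, B}" "x \<in> nreg n" "x \<notin> nbody n" for x
  proof -
    note x = that
    obtain p' q' L where c: "child (fst n) (fst (snd n)) (nreg n) p' q' L" "x \<in> L \<union> open_segment p' q'"
      using child_cover[OF pk x(2,3)] by metis
    define l :: node where "l = (p', q', L)"
    have l: "nchild n l" "x \<in> nreg l \<union> nchord l" using c by (auto simp: l_def)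
    have "(Suc d, n, l) \<in> nodes r" using nodes.child[OF less.prems(1) l(1)] .
    then show ?thesis using l assms(6) x(1) by blast
  qed
  have descend: ?case if l: "nchild n l" "A \<in> nreg l" "B \<in> nreg l" "(Suc d, n, l) \<in> nodes r" for l
  proof -
    obtain j where "j < i" "link (fst l) (fst (snd l)) j A"
      using link_descend[OF pk l(1,2) less.prems(4)] by blast
    then show ?thesis using less.IH l by blast
  qed
  consider "A \<in> nbody n" "B \<in> nbody n" | "A \<notin> nbody n" "B \<in> nbody n" | "A \<in> nbody n" "B \<notin> nbody n" | "A \<notin> nbody n" "B \<notin> nbody n"
    by blast
  then show ?case
  proof cases
    case 1
    have N: "midpoint A B \<in> nbody n" using body_segment[OF pk 1 AB] midpoint_in_closed_segment by blast
    then have "below_in_body n A B \<or> below_in_body n B A"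
      by (auto simp: below_in_body_def side_midpoint midpoint_sym[of B A])
    then show ?thesis using 1 less.prems(1) unfolding related_def by blast
  next
    case 2
    then obtain l where "nchild n l" "A \<in> nreg l" "(Suc d, n, l) \<in> nodes r" using get[of A] less.prems by auto
    then show ?thesis using cross_child_body[OF pk _ _ 2(2) AB] less.prems(1) by blast
  next
    case 3
    then obtain l where "nchild n l" "B \<in> nreg l" "(Suc d, n, l) \<in> nodes r" using get[of B] less.prems by auto
    then show ?thesis using cross_child_body[OF pk _ _ 3(1) BA] less.prems(1) by blast
  next
    case 4
    obtain l where l: "nchild n l" "A \<in> nreg l" "(Suc d, n, l) \<in> nodes r" using get[of A] 4 less.prems by auto
    obtain k where k: "nchild n k" "B \<in> nreg k" "(Suc d, n, k) \<in> nodes r" using get[of B] 4 less.prems by auto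
    consider "B \<in> nreg l" | "A \<in> nreg k" | "B \<notin> nreg l" "A \<notin> nreg k" by blast
    then show ?thesis
    proof cases
      case 1 
      then show ?thesis using descend l by blast
    next
      case 2
      then show ?thesis using descend k by blast
    next
      case 3
      then show ?thesis using cross_two_children[OF pk l(1) k(1) l(2) 3(2) _ k(2) 3(1) _ AB] assms(6) l(3) k(3) by blast
    qed
  qed
qed

end

section \<open>Areas of triangles and covering trapezoids\<close>

lemma emeasure_triangle:
  fixes x y z :: "real^2"
  shows "emeasure lborel (convex hull {x, y, z}) = ennreal (\<bar>det2 (y - x) (z - x)\<bar> / 2)"
proof -
  have "compact (convex hull {x, y, z})" by (intro finite_imp_compact_convex_hull) auto
  then have "emeasure lborel (convex hull {x, y, z}) = ennreal (measure lborel (convex hull {x, y, z}))"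
    using emeasure_compact_finite[of "convex hull {x, y, z}"] by (intro emeasure_eq_ennreal_measure) (auto simp: less_top)
  also have "measure lborel (convex hull {x, y, z}) = \<bar>det2 (y - x) (z - x)\<bar> / 2"
    by (subst content_triangle) (simp add: det2_def abs_minus_commute mult.commute)
  finally show ?thesis .
qed

text \<open>The trapezoid has half-widths \<open>w1\<close> at height \<open>a\<close> and
  \<open>w2\<close> at height \<open>b\<close> and is cut into two triangles. A Borel cover is
  returned instead of a bound on \<open>T\<close>, whose measurability is not assumed.\<close>

lemma trapezoid_cover:
  fixes O' u v :: "real^2"
  assumes uv: "det2 u v = 1" and ab: "a < b" and w: "0 \<le> w1" "0 \<le> w2"
    and T: "\<And>B. B \<in> T \<Longrightarrow> \<exists>x y. B = O' + x *\<^sub>R u + y *\<^sub>R v \<and> a \<le> y \<and> y \<le> b \<and> 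
        \<bar>x\<bar> * (b - a) \<le> (b - y) * w1 + (y - a) * w2"
  obtains H where "H \<in> sets borel" "T \<subseteq> H" "emeasure lborel H \<le> ennreal ((w1 + w2) * (b - a))"
proof -
  define P1 where "P1 = O' - w1 *\<^sub>R u + a *\<^sub>R v"
  define P2 where "P2 = O' + w1 *\<^sub>R u + a *\<^sub>R v"
  define P3 where "P3 = O' + w2 *\<^sub>R u + b *\<^sub>R v"
  define P4 where "P4 = O' - w2 *\<^sub>R u + b *\<^sub>R v"
  note P = P1_def P2_def P3_def P4_def
  define H1 where "H1 = convex hull {P1, P2, P3}"
  define H2 where "H2 = convex hull {P1, P3, P4}"
  have vu: "det2 v u = -1" using uv det2_swap[of v u] by simp
  have d: "P2 - P1 = (2 * w1) *\<^sub>R u" "P3 - P1 = (w1 + w2) *\<^sub>R u + (b - a) *\<^sub>R v" 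
    "P4 - P1 = (w1 - w2) *\<^sub>R u + (b - a) *\<^sub>R v"
    by (simp_all add: P vec_eq_iff algebra_simps)
  have "det2 (P2 - P1) (P3 - P1) = 2 * w1 * (b - a)" unfolding d by (simp add: det2_simps uv vu)
  then have m1: "emeasure lborel H1 = ennreal (w1 * (b - a))" using w ab by (simp add: H1_def emeasure_triangle)
  have "det2 (P3 - P1) (P4 - P1) = 2 * w2 * (b - a)" unfolding d by (simp add: det2_simps uv vu algebra_simps)
  then have m2: "emeasure lborel H2 = ennreal (w2 * (b - a))" using w ab by (simp add: H2_def emeasure_triangle)
  have H: "H1 \<in> sets borel" "H2 \<in> sets borel"
    unfolding H1_def H2_def by (intro borel_compact finite_imp_compact_convex_hull; simp)+
  have "T \<subseteq> H1 \<union> H2"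
  proof
    fix B assume "B \<in> T"
    then obtain x y where B: "B = O' + x *\<^sub>R u + y *\<^sub>R v" "a \<le> y" "y \<le> b" 
        "\<bar>x\<bar> * (b - a) \<le> (b - y) * w1 + (y - a) * w2" using T by blast
    define s where "s = (y - a) / (b - a)"
    have s: "0 \<le> s" "s \<le> 1" "s * (b - a) = y - a" using B ab by (auto simp: s_def)
    have y: "y = (1 - s) * a + s * b" using s by (simp add: algebra_simps)
    define W where "W = (1 - s) * w1 + s * w2"
    have "W * (b - a) = (b - a) * w1 - (s * (b - a)) * w1 + (s * (b - a)) * w2" by (simp add: W_def algebra_simps)
    then have "W * (b - a) = (b - y) * w1 + (y - a) * w2" unfolding s(3) by (simp add: algebra_simps)
    then have xW: "\<bar>x\<bar> \<le> W" using B(4) ab by (metis mult_le_cancel_right_pos diff_gt_0_iff_gt)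
    \<comment> \<open>\<open>D\<close> is the point of the common side \<open>P1 P3\<close> at the
      height of \<open>B\<close>; on which side of \<open>D\<close> the point \<open>B\<close> lies
      decides its triangle.\<close>
    define D where "D = (1 - s) *\<^sub>R P1 + s *\<^sub>R P3"
    define xD where "xD = s * w2 - (1 - s) * w1"
    have D: "D = O' + xD *\<^sub>R u + y *\<^sub>R v" by (simp add: D_def P y xD_def algebra_simps)
    have hc: "(1 - s) *\<^sub>R x + s *\<^sub>R y \<in> convex hull S" if "x \<in> S" "y \<in> S" for x y :: "real^2" and S
      using convexD_alt[OF convex_convex_hull hull_inc[OF that(1)] hull_inc[OF that(2)] s(1,2)] .
    have D1: "D \<in> H1" "D \<in> H2" unfolding D_def H1_def H2_def by (auto intro!: hc)
    have mid: "z \<in> closed_segment (O' + c *\<^sub>R u + y *\<^sub>R v) (O' + d *\<^sub>R u + y *\<^sub>R v)" 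
      if "z = O' + x *\<^sub>R u + y *\<^sub>R v" "c \<le> x" "x \<le> d" for z c d
      using on_subline[of c x d "O' + y *\<^sub>R v" "O' + y *\<^sub>R v + u"] that by (simp add: algebra_simps)
    show "B \<in> H1 \<union> H2"
    proof (cases "xD \<le> x")
      case True
      have "(1 - s) *\<^sub>R P2 + s *\<^sub>R P3 \<in> H1" unfolding H1_def by (auto intro!: hc)
      moreover have "(1 - s) *\<^sub>R P2 + s *\<^sub>R P3 = O' + W *\<^sub>R u + y *\<^sub>R v" by (simp add: P y W_def algebra_simps)
      ultimately have "closed_segment D (O' + W *\<^sub>R u + y *\<^sub>R v) \<subseteq> H1" using D1
        unfolding H1_def by (intro closed_segment_subset) auto
      moreover have "B \<in> closed_segment D (O' + W *\<^sub>R u + y *\<^sub>R v)"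
        unfolding D by (rule mid[OF B(1) True]) (use xW in auto)
      ultimately show ?thesis by blast
    next
      case False
      have "(1 - s) *\<^sub>R P1 + s *\<^sub>R P4 \<in> H2" unfolding H2_def by (auto intro!: hc)
      moreover have "(1 - s) *\<^sub>R P1 + s *\<^sub>R P4 = O' + (- W) *\<^sub>R u + y *\<^sub>R v" by (simp add: P y W_def algebra_simps)
      ultimately have "closed_segment (O' + (- W) *\<^sub>R u + y *\<^sub>R v) D \<subseteq> H2" using D1
        unfolding H2_def by (intro closed_segment_subset) auto
      moreover have "- W \<le> x" "x \<le> xD" using xW False by auto
      moreover from this have "B \<in> closed_segment (O' + (- W) *\<^sub>R u + y *\<^sub>R v) D"
        unfolding D by (intro mid[OF B(1)])
      ultimately show ?thesis by blast
    qed
  qed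
  moreover have "emeasure lborel (H1 \<union> H2) \<le> ennreal ((w1 + w2) * (b - a))"
  proof -
    have "emeasure lborel (H1 \<union> H2) \<le> emeasure lborel H1 + emeasure lborel H2"
      by (intro emeasure_subadditive) (use H in auto)
    also have "\<dots> = ennreal ((w1 + w2) * (b - a))"
      unfolding m1 m2 distrib_right by (rule ennreal_plus[symmetric]) (use w ab in auto)
    finally show ?thesis .
  qed
  ultimately show thesis using that[of "H1 \<union> H2"] H by blast
qed

context region
begin

section \<open>Disjointness and countability of the bodies\<close>

lemma nodes_reg_root: "(d, m, n) \<in> nodes r \<Longrightarrow> nreg n \<subseteq> nreg r"
  by (induction rule: nodes.induct) (use child_subset in blast)+

lemma nodes_zero: "(0, m, n) \<in> nodes r \<longleftrightarrow> npocket r \<and> m = r \<and> n = r"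
  by (auto elim: nodes.cases intro: nodes.intros)

lemma nodes_Suc: "(Suc d, n, l) \<in> nodes r \<longleftrightarrow> nchild n l \<and> (\<exists>m. (d, m, n) \<in> nodes r)"
proof
  assume "(Suc d, n, l) \<in> nodes r"
  then show "nchild n l \<and> (\<exists>m. (d, m, n) \<in> nodes r)" by (cases rule: nodes.cases) blast
qed (blast intro: nodes.child)

text \<open>Distinct children of one node are disjoint by \<open>children_disjoint\<close>; children
  of distinct nodes inherit disjointness from their parents.\<close>

lemma nodes_same_level:
  "(d, m, n) \<in> nodes r \<Longrightarrow> (d, m', n') \<in> nodes r \<Longrightarrow> (m, n) = (m', n') \<or> nreg n \<inter> nreg n' = {}"
proof (induction d arbitrary: m n m' n')
  case 0
  then show ?case by (simp add: nodes_zero)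
next
  case (Suc d)
  obtain k where k: "nchild m n" "(d, k, m) \<in> nodes r" using Suc.prems by (auto simp: nodes_Suc)
  obtain k' where k': "nchild m' n'" "(d, k', m') \<in> nodes r" using Suc.prems by (auto simp: nodes_Suc)
  from Suc.IH[OF k(2) k'(2)] show ?case
  proof
    assume "nreg m \<inter> nreg m' = {}"
    then show ?thesis using child_subset[OF k(1)] child_subset[OF k'(1)] by blast
  next
    assume e: "(k, m) = (k', m')"
    then show ?thesis using children_disjoint[OF k(1), of "fst n'" "fst (snd n')" "nreg n'"] k'(1)
      by (metis prod.collapse prod.inject)
  qed
qed

text \<open>Bodies of different depth are compared by replacing the deeper node with its ancestor at
  the other depth, whose body the deeper pocket avoids.\<close>

lemma nodes_ancestor:
  "(d', m', n') \<in> nodes r \<Longrightarrow> d \<le> d' \<Longrightarrow> 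
    \<exists>m n. (d, m, n) \<in> nodes r \<and> nreg n' \<subseteq> nreg n \<and> (d = d' \<longrightarrow> m = m' \<and> n = n') \<and> (d < d' \<longrightarrow> nreg n' \<inter> nbody n = {})"
proof (induction d' arbitrary: m' n')
  case 0
  then show ?case by (intro exI[of _ m'] exI[of _ n']) auto
next
  case (Suc e)
  obtain k where k: "nchild m' n'" "(e, k, m') \<in> nodes r" using Suc.prems by (auto simp: nodes_Suc)
  consider "d = Suc e" | "d = e" | "d < e" using Suc.prems by linarith
  then show ?case
  proof cases
    case 1
    then show ?thesis using Suc.prems by (intro exI[of _ m'] exI[of _ n']) auto
  next
    case 2
    then show ?thesis using k(2) child_subset[OF k(1)] child_body_disj[OF k(1)]
      by (intro exI[of _ k] exI[of _ m'] conjI impI) simp_all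
  next
    case 3
    then obtain m n where "(d, m, n) \<in> nodes r" "nreg m' \<subseteq> nreg n" "nreg m' \<inter> nbody n = {}"
      using Suc.IH[OF k(2)] by auto
    then show ?thesis using 3 child_subset[OF k(1)] by (intro exI[of _ m] exI[of _ n]) auto
  qed
qed

lemma bodies_disjoint_aux:
  assumes "(d, m, n) \<in> nodes r" "(d', m', n') \<in> nodes r" "(d, m, n) \<noteq> (d', m', n')" "d \<le> d'"
  shows "nbody n \<inter> nbody n' = {}"
proof -
  obtain k l where kl: "(d, k, l) \<in> nodes r" "nreg n' \<subseteq> nreg l" "d = d' \<longrightarrow> k = m' \<and> l = n'" "d < d' \<longrightarrow> nreg n' \<inter> nbody l = {}"
    using nodes_ancestor[OF assms(2,4)] by blast
  have sub: "nbody n \<subseteq> nreg n" "nbody n' \<subseteq> nreg n'" 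
    using body_subset nodes_pocket assms(1,2) by blast+
  from nodes_same_level[OF assms(1) kl(1)] show ?thesis
  proof
    assume "(m, n) = (k, l)"
    then show ?thesis using kl assms sub by (cases "d = d'") auto
  next
    assume "nreg n \<inter> nreg l = {}"
    then show ?thesis using kl sub by blast
  qed
qed

lemma bodies_disjoint:
  assumes "(d, m, n) \<in> nodes r" "(d', m', n') \<in> nodes r" "(d, m, n) \<noteq> (d', m', n')"
  shows "nbody n \<inter> nbody n' = {}"
  using bodies_disjoint_aux[OF assms] bodies_disjoint_aux[OF assms(2,1)] assms(3)
  by (metis inf_commute nat_le_linear)

text \<open>Both orientations are needed because the first chord has pockets on either side.\<close>

definition all_nodes :: "real^2 \<Rightarrow> real^2 \<Rightarrow> (nat \<times> node \<times> node) set" where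
  "all_nodes p q = (\<Union>r\<in>{r. npocket r \<and> (fst r, fst (snd r)) \<in> {(p, q), (q, p)}}. nodes r)"

lemma all_nodes_disjoint:
  assumes "(d, m, n) \<in> all_nodes p q" "(d', m', n') \<in> all_nodes p q" "(d, m, n) \<noteq> (d', m', n')"
  shows "nbody n \<inter> nbody n' = {}"
proof -
  obtain r where r: "npocket r" "(fst r, fst (snd r)) \<in> {(p, q), (q, p)}" "(d, m, n) \<in> nodes r"
    using assms(1) by (auto simp: all_nodes_def)
  obtain s where s: "npocket s" "(fst s, fst (snd s)) \<in> {(p, q), (q, p)}" "(d', m', n') \<in> nodes s"
    using assms(2) by (auto simp: all_nodes_def)
  have sub: "nbody n \<subseteq> nreg r" "nbody n' \<subseteq> nreg s"
    using body_subset nodes_pocket nodes_reg_root r(3) s(3) by blast+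
  have e: "nchord r = nchord s" using r(2) s(2) by (auto simp: open_segment_commute)
  have "nreg r \<in> components (U - nchord r)" using pocket_comp[OF r(1)] .
  moreover have "nreg s \<in> components (U - nchord r)" unfolding e using pocket_comp[OF s(1)] .
  ultimately  have "nreg r = nreg s \<or> nreg r \<inter> nreg s = {}" using components_nonoverlap by blast
  then show ?thesis
  proof
    assume e: "nreg r = nreg s"
    then have "r = s" using pocket_unique[OF r(1), of "fst s" "fst (snd s)"] s(1) by (metis prod.collapse)
    then show ?thesis using bodies_disjoint r(3) s(3) assms(3) by blast
  qed (use sub in blast)
qed

lemma all_nodes_pocket: "(d, m, n) \<in> all_nodes p q \<Longrightarrow> npocket n"
  by (auto simp: all_nodes_def nodes_pocket)

text \<open>The bodies are nonempty, open and pairwise disjoint, and the plane has room for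
  countably many such sets.\<close>

lemma countable_all_nodes: "countable (all_nodes p q)"
proof -
  define f where "f = (\<lambda>x::nat \<times> node \<times> node. nbody (snd (snd x)))"
  have ne: "f x \<noteq> {}" if "x \<in> all_nodes p q" for x
    using body_nonempty[OF all_nodes_pocket[of "fst x" "fst (snd x)" "snd (snd x)"]] that by (simp add: f_def)
  have dis: "f x \<inter> f y = {}" if "x \<in> all_nodes p q" "y \<in> all_nodes p q" "x \<noteq> y" for x y
    using all_nodes_disjoint[of "fst x" "fst (snd x)" "snd (snd x)" p q "fst y" "fst (snd y)" "snd (snd y)"] that
    by (simp add: f_def)
  have "inj_on f (all_nodes p q)" 
  proof (rule inj_onI)
    fix x y assume "x \<in> all_nodes p q" "y \<in> all_nodes p q" "f x = f y"
    then show "x = y" using ne[of x] dis[of x y] by auto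
  qed
  moreover have "countable (f ` all_nodes p q)"
  proof (rule countable_disjoint_open_subsets)
    show "open S" if "S \<in> f ` all_nodes p q" for S
      using that body_open[OF all_nodes_pocket] by (auto simp: f_def)
    show "disjoint (f ` all_nodes p q)"
    proof (rule pairwiseI)
      fix S T assume S: "S \<in> f ` all_nodes p q" and T: "T \<in> f ` all_nodes p q" and ne: "S \<noteq> T"
      from S obtain x where x: "x \<in> all_nodes p q" "S = f x" by (rule imageE)
      from T obtain y where y: "y \<in> all_nodes p q" "T = f y" by (rule imageE)
      have "x \<noteq> y" using ne x(2) y(2) by blast
      then show "disjnt S T" unfolding disjnt_def x(2) y(2) by (rule dis[OF x(1) y(1)])
    qed
  qed
  ultimately show ?thesis by (simp add: countable_image_inj_eq)
qed

text \<open>Points of one root pocket are handled by \<open>pair_cases\<close>. Points of different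
  root pockets lie on opposite sides of the first chord, where at least one is within three times
  the distance of the other.\<close>

lemma visible_pair_related:
  assumes c: "chord p q" and AB: "sees A B" 
    and r: "A \<notin> open_segment p q" "B \<notin> open_segment p q"
    and av: "\<And>d m n. (d, m, n) \<in> all_nodes p q \<Longrightarrow> A \<notin> nchord n \<and> B \<notin> nchord n"
  shows "\<exists>d m n. (d, m, n) \<in> all_nodes p q \<and> (related m n A B \<or> related m n B A)"
proof -
  have "\<exists>s. npocket s \<and> (fst s, fst (snd s)) \<in> {(p, q), (q, p)} \<and> x \<in> nreg s" if x: "x \<in> U" "x \<notin> open_segment p q" for x
  proof -
    define K where "K = connected_component_set (U - open_segment p q) x"
    have K: "K \<in> components (U - open_segment p q)" "x \<in> K" using x by (auto simp: K_def componentsI)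
    from pocket_exists[OF c K(1)] show ?thesis
    proof
      assume "pocket p q K"
      then show ?thesis using K(2) by (intro exI[of _ "(p, q, K)"]) simp
    next
      assume "pocket q p K"
      then show ?thesis using K(2) by (intro exI[of _ "(q, p, K)"]) simp
    qed
  qed note get = this
  have AU: "A \<in> U" "B \<in> U" using AB by auto
  obtain a where a: "npocket a" "(fst a, fst (snd a)) \<in> {(p, q), (q, p)}" "A \<in> nreg a" using get[OF AU(1) r(1)] by blast
  obtain b where b: "npocket b" "(fst b, fst (snd b)) \<in> {(p, q), (q, p)}" "B \<in> nreg b" using get[OF AU(2) r(2)] by blast
  have an: "(0, a, a) \<in> nodes a" "(0, b, b) \<in> nodes b" using a b by (auto intro: nodes.root)
  have sub: "nodes a \<subseteq> all_nodes p q" "nodes b \<subseteq> all_nodes p q" using a b by (auto simp: all_nodes_def)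
  show ?thesis
  proof (cases "B \<in> nreg a")
    case True
    obtain i where "link (fst a) (fst (snd a)) i A"
      using link_exists[OF pocket_chord[OF a(1)], of A] AB by auto
    then show ?thesis using pair_cases[OF an(1) a(3) True AB] av sub(1) by blast
  next
    case False
    have ch: "nchord a = open_segment p q" "nchord b = open_segment p q" using a(2) b(2) by (auto simp: open_segment_commute)
    have cc: "nreg a \<in> components (U - open_segment p q)" "nreg b \<in> components (U - open_segment p q)"
      using pocket_comp[OF a(1)] pocket_comp[OF b(1)] unfolding ch .
    have Ab: "A \<notin> nreg b"
      using components_nonoverlap[OF cc] a(3) b(3) False by blast
    obtain t where t: "A \<in> nbody a" "nside a A > 0" "nside a B < 0"
      using crossing[OF a(1) a(3) False AB] r(2) ch(1) by metis
    have BA: "sees B A" using AB by (simp add: closed_segment_commute)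
    obtain s where s: "B \<in> nbody b" "nside b B > 0" "nside b A < 0"
      using crossing[OF b(1) b(3) Ab BA] r(1) ch(2) by metis
    have "nside b = nside a \<or> (\<forall>z. nside b z = - nside a z)"
      using a(2) b(2) side_swap[of p q] side_swap[of q p] by auto
    then have e: "nside b z = - nside a z" for z using t s by auto
    show ?thesis
    proof (cases "- nside a B \<le> 3 * nside a A")
      case True
      then have "related a a A B" using t False by (simp add: related_def beyond_chord_def)
      then show ?thesis using an sub by blast
    next
      case F: False
      then have "beyond_chord b B A" using e t Ab by (simp add: beyond_chord_def)
      then have "related b b B A" using s by (simp add: related_def)
      then show ?thesis using an sub by blast
    qed
  qed
qed

text \<open>A body point close to the window has a line of sight that stays in the body for a fixed
  length both ways. It must be almost parallel to the window and therefore hits the base close to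
  the line of the window.\<close>

lemma child_approx:
  assumes pk: "pocket p q K" and c: "child p q K p' q' L" and X: "X \<in> open_segment p' q'" and \<delta>: "\<delta> > 0"
  obtains X' y where "X' \<in> body p q K" "y \<in> open_segment p q" "sees X' y" "dist X' X < \<delta>" "\<bar>side p' q' y\<bar> < \<delta>"
proof -
  obtain e where e: "e > 0" "ball X e \<subseteq> K" "\<And>z. z \<in> ball X e \<Longrightarrow> side p' q' z < 0 \<longleftrightarrow> z \<in> body p q K"
    using c X by (auto simp: child_def)
  have pq': "p' \<noteq> q'" using pocket_ne[OF child_pocket[OF c]] .
  obtain R where R: "\<And>x y. x \<in> U \<Longrightarrow> y \<in> U \<Longrightarrow> dist x y \<le> R"
    using bounded_U unfolding bounded_two_points by blast
  \<comment> \<open>\<open>C\<close> bounds the ratio of the distances of \<open>y\<close> and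
    \<open>X'\<close> from the line of the window, uniformly in \<open>X'\<close>.\<close>
  define C where "C = 1 + 2 * \<bar>R\<bar> / e"
  have C: "C > 0" using e by (simp add: C_def add_pos_nonneg)
  have "isCont (side p' q') X" unfolding side_def det2_def by (intro continuous_intros)
  then obtain r where r: "r > 0" "\<And>z. dist z X < r \<Longrightarrow> \<bar>side p' q' z\<bar> < \<delta> / C"
    using \<delta> C side_open_segment[OF X] unfolding continuous_at_eps_delta
    by (metis diff_zero divide_pos_pos real_norm_def dist_real_def)
  have "min r (min (e/2) \<delta>) > 0" using r e \<delta> by simp
  then obtain X' where X': "X' \<in> ball X (min r (min (e/2) \<delta>))" and sX': "side p' q' X' < 0"
    using side_neg_near[OF pq' side_open_segment[OF X]] by blast
  have d3: "dist X' X < e/2" "dist X' X < r" "dist X' X < \<delta>" using X' by (auto simp: dist_commute)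
  then have "dist X' X < e" using e(1) by linarith
  then have X'e: "X' \<in> ball X e" "dist X' X < e/2" "dist X' X < r" "dist X' X < \<delta>" using d3 by (auto simp: dist_commute)
  have Xb: "X' \<in> body p q K" using e(3)[OF X'e(1)] sX' by simp
  then obtain y where y: "y \<in> open_segment p q" "sees X' y" by (auto simp: body_def)
  have X'K: "X' \<in> K" using Xb by (simp add: body_def)
  define l where "l = norm (y - X')"
  have l: "l > 0" using y(1) X'K pocket_disj[OF pk] by (auto simp: l_def)
  have lR: "l \<le> \<bar>R\<bar>" using R[of y X'] y by (force simp: l_def dist_norm)
  define s where "s = (e/2) / l"
  have s: "s > 0" using e l by (simp add: s_def)
  \<comment> \<open>An affine function that is negative at both ends of a stretch centred at
    \<open>X'\<close> has its slope bounded by its value at \<open>X'\<close>; \<open>s\<close> is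
    the half-length \<open>e / 2\<close> in units of the distance from \<open>X'\<close> to
    \<open>y\<close>.\<close>
  have neg: "(1 - \<tau>) * side p' q' X' + \<tau> * side p' q' y < 0" if "\<bar>\<tau>\<bar> = s" for \<tau>
  proof -
    have "norm (\<tau> *\<^sub>R (y - X')) = e / 2" using that l e by (simp add: s_def l_def)
    then have "dist X (X' + \<tau> *\<^sub>R (y - X')) < e"
      using X'e(2) norm_triangle_ineq[of "X' - X" "\<tau> *\<^sub>R (y - X')"] 
      by (simp add: dist_norm norm_minus_commute algebra_simps)
    then have b: "X' + \<tau> *\<^sub>R (y - X') \<in> ball X e" by simp
    have "X' + \<tau> *\<^sub>R (y - X') \<in> body p q K" by (rule body_disk_chord[OF pk e(2) X'e(1) X'K y b])
    then have "side p' q' (X' + \<tau> *\<^sub>R (y - X')) < 0" using e(3)[OF b] by simp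
    moreover have "X' + \<tau> *\<^sub>R (y - X') = (1 - \<tau>) *\<^sub>R X' + \<tau> *\<^sub>R y" by (simp add: algebra_simps)
    ultimately show ?thesis by (metis side_affine)
  qed
  define \<sigma> where "\<sigma> = side p' q' X'"
  define \<eta> where "\<eta> = side p' q' y"
  have "s * \<bar>\<eta> - \<sigma>\<bar> < - \<sigma>" using neg[of s] neg[of "-s"] s
    unfolding \<sigma>_def[symmetric] \<eta>_def[symmetric] by (auto simp: abs_if algebra_simps)
  then have "\<bar>\<eta> - \<sigma>\<bar> < - \<sigma> / s" unfolding pos_less_divide_eq[OF s] by (simp add: mult.commute)
  also have "- \<sigma> / s = - \<sigma> * (2 * l / e)" using e l by (simp add: s_def field_simps)
  also have "\<dots> \<le> - \<sigma> * (2 * \<bar>R\<bar> / e)" using lR e sX' by (intro mult_left_mono divide_right_mono) (auto simp: \<sigma>_def)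
  finally have "\<bar>\<eta> - \<sigma>\<bar> < - \<sigma> * (2 * \<bar>R\<bar> / e)" .
  moreover have "- \<sigma> * C = - \<sigma> + - \<sigma> * (2 * \<bar>R\<bar> / e)" unfolding C_def by (simp only: distrib_left mult_1_right)
  ultimately have "\<bar>\<eta>\<bar> < - \<sigma> * C" using sX' unfolding \<sigma>_def[symmetric] by linarith
  also have "- \<sigma> < \<delta> / C" using r(2)[OF X'e(3)] unfolding \<sigma>_def by linarith
  then have "- \<sigma> * C < \<delta>" unfolding pos_less_divide_eq[OF C] .
  finally show thesis using that[OF Xb y X'e(4)] by (simp add: \<eta>_def)
qed

text \<open>The line of a window meets the base line of its parent in a point that need not lie in the region;
  it is a limit of base points seen from the body.\<close>

lemma child_line:
  assumes pk: "pocket p q K" and c: "child p q K p' q' L" and X: "X \<in> open_segment p' q'"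
  obtains X' y Y where "\<And>n::nat. X' n \<in> body p q K" "\<And>n. y n \<in> open_segment p q" "\<And>n. sees (X' n) (y n)" 
    "X' \<longlonglongrightarrow> X" "y \<longlonglongrightarrow> Y" "side p q Y = 0" "side p' q' Y = 0"
proof -
  have "\<exists>X' y. X' \<in> body p q K \<and> y \<in> open_segment p q \<and> sees X' y \<and> dist X' X < 1 / Suc n \<and> \<bar>side p' q' y\<bar> < 1 / Suc n" for n
    using child_approx[OF pk c X, of "1 / Suc n"] by (metis of_nat_0_less_iff zero_less_Suc zero_less_divide_1_iff)
  then obtain Z w where Z: "\<And>n::nat. Z n \<in> body p q K" "\<And>n. w n \<in> open_segment p q" "\<And>n. sees (Z n) (w n)" 
    "\<And>n. dist (Z n) X < 1 / Suc n" "\<And>n. \<bar>side p' q' (w n)\<bar> < 1 / Suc n" by metis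
  have lim0: "f \<longlonglongrightarrow> 0" if "\<And>n. \<bar>f n\<bar> < 1 / Suc n" for f :: "nat \<Rightarrow> real"
    by (rule Lim_null_comparison[OF _ LIMSEQ_inverse_real_of_nat]) (use that in \<open>auto simp: inverse_eq_divide less_imp_le\<close>)
  have "(\<lambda>n. dist (Z n) X) \<longlonglongrightarrow> 0" by (rule lim0) (use Z(4) in simp)
  then have ZX: "Z \<longlonglongrightarrow> X" by (rule tendsto_dist_iff[THEN iffD2])
  have s0: "(\<lambda>n. side p' q' (w n)) \<longlonglongrightarrow> 0" by (rule lim0) (use Z(5) in simp)
  \<comment> \<open>The limit is taken in the closed segment: \<open>Y\<close> may be an endpoint,
    hence outside \<open>U\<close>, and only its position on the two lines is recorded.\<close>
  have "\<forall>n. w n \<in> closed_segment p q" using Z(2) by (auto simp: open_segment_def)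
  then obtain Y \<sigma> where Y: "Y \<in> closed_segment p q" "strict_mono (\<sigma>::nat\<Rightarrow>nat)" "(w \<circ> \<sigma>) \<longlonglongrightarrow> Y"
    using compact_segment[of p q] unfolding compact_def by metis
  have "(\<lambda>n. side p' q' ((w \<circ> \<sigma>) n)) \<longlonglongrightarrow> side p' q' Y"
    unfolding side_def by (intro tendsto_intros Y(3))
  moreover have "(\<lambda>n. side p' q' ((w \<circ> \<sigma>) n)) \<longlonglongrightarrow> 0"
    using LIMSEQ_subseq_LIMSEQ[OF s0 Y(2)] by (simp add: o_def)
  ultimately have "side p' q' Y = 0" using LIMSEQ_unique by blast
  moreover have "side p q Y = 0" using Y(1) by (auto simp: in_segment side_affine)
  ultimately show thesis
    using that[of "Z \<circ> \<sigma>" "w \<circ> \<sigma>" Y] Z(1-3) LIMSEQ_subseq_LIMSEQ[OF ZX Y(2)] Y(3) by simp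
qed

end

section \<open>Area bounds\<close>

locale bounded_region = region +
  fixes M :: real
  assumes area: "\<And>a b c. convex hull {a, b, c} \<subseteq> U \<Longrightarrow> \<bar>det2 (b - a) (c - a)\<bar> \<le> 2 * M"
    and M_nonneg: "0 \<le> M"
begin

text \<open>Coordinates \<open>(x, y)\<close> with \<open>A'\<close> as origin, \<open>A\<close> at \<open>(0, 1)\<close> and the base chord horizontal,
  normalised to area one.\<close>

lemma node_coords:
  assumes pk: "npocket n" and A: "A \<in> nbody n"
  obtains A' u where "A' \<in> nchord n" "sees A A'" "det2 u (A - A') = 1"
    "\<And>B. B = A' + det2 (B - A') (A - A') *\<^sub>R u + (nside n B / nside n A) *\<^sub>R (A - A')"
proof -
  obtain A' where A': "A' \<in> nchord n" "sees A A'" using A by (auto simp: body_def)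
  have s: "nside n A > 0" using body_side[OF pk A] .
  define u where "u = (fst (snd n) - fst n) /\<^sub>R nside n A"
  have uu: "det2 (B - A') (A - A') *\<^sub>R u = (det2 (B - A') (A - A') / nside n A) *\<^sub>R (fst (snd n) - fst n)" for B
    by (simp add: u_def divide_inverse)
  note bc = body_coords[OF side_open_segment[OF A'(1)] s pocket_ne[OF pk]]
  have "det2 u (A - A') = 1" unfolding u_def det2_simps(5) using bc(1) s by simp
  moreover have "B = A' + det2 (B - A') (A - A') *\<^sub>R u + (nside n B / nside n A) *\<^sub>R (A - A')" for B
    unfolding uu by (rule bc(2))
  ultimately show thesis using that[OF A'] by blast
qed

text \<open>For a partner at \<open>(x, h)\<close> the triangle of \<open>A\<close>,
  \<open>A'\<close> and the crossing gives \<open>t * \<bar>x\<bar> \<le> 2 * M\<close>, and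
  \<open>t * (1 - h) = 1\<close>, so \<open>\<bar>x\<bar> \<le> 2 * M * (1 - h)\<close>. The
  half-width grows from 2 M at height 0 to 8 M at height -3.\<close>

lemma beyond_chord_area:
  assumes pk: "npocket n" and A: "A \<in> nbody n"
  obtains H where "H \<in> sets borel" "{B. sees A B \<and> beyond_chord n A B} \<subseteq> H" "emeasure lborel H \<le> ennreal (30 * M)"
proof -
  obtain A' u where A': "A' \<in> nchord n" "sees A A'" and u: "det2 u (A - A') = 1"
    and co: "\<And>B. B = A' + det2 (B - A') (A - A') *\<^sub>R u + (nside n B / nside n A) *\<^sub>R (A - A')"
    using node_coords[OF pk A] by metis
  have s: "nside n A > 0" using body_side[OF pk A] .
  have AK: "A \<in> nreg n" using A body_subset[OF pk] by auto
  obtain H where "H \<in> sets borel" "{B. sees A B \<and> beyond_chord n A B} \<subseteq> H" 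
    "emeasure lborel H \<le> ennreal ((8 * M + 2 * M) * (0 - (-3)))"
  proof (rule trapezoid_cover[of u "A - A'" "-3" 0 "8 * M" "2 * M" "{B. sees A B \<and> beyond_chord n A B}" A'])
    fix B assume "B \<in> {B. sees A B \<and> beyond_chord n A B}"
    then have B: "sees A B" "B \<notin> nreg n" "- nside n B \<le> 3 * nside n A" by (auto simp: beyond_chord_def)
    define h where "h = nside n B / nside n A"
    define x where "x = det2 (B - A') (A - A')"
    have Bxh: "B = A' + x *\<^sub>R u + h *\<^sub>R (A - A')" unfolding x_def h_def by (rule co)
    have h3: "-3 \<le> h" using B(3) s by (simp add: h_def pos_le_divide_eq)
    \<comment> \<open>A partner outside the pocket may lie on the chord itself; then the crossing is
      \<open>B\<close> and \<open>t\<close> is 1.\<close>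
    have "\<exists>t. 0 < t \<and> t \<le> 1 \<and> A + t *\<^sub>R (B - A) \<in> nchord n \<and> nside n B \<le> 0 \<and> (1 - t) * nside n A + t * nside n B = 0"
    proof (cases "B \<in> nchord n")
      case True
      then show ?thesis using side_open_segment[OF True] by (intro exI[of _ 1]) simp
    next
      case False
      obtain t where "0 < t" "t < 1" "A + t *\<^sub>R (B - A) \<in> nchord n" "nside n B < 0" "(1 - t) * nside n A + t * nside n B = 0"
        using crossing[OF pk AK B(2,1) False] by metis
      then show ?thesis by (intro exI[of _ t]) simp
    qed
    then obtain t where t: "0 < t" "t \<le> 1" "A + t *\<^sub>R (B - A) \<in> nchord n" "nside n B \<le> 0" "(1 - t) * nside n A + t * nside n B = 0" by blast
    have h0: "h \<le> 0" using t(4) s by (simp add: h_def divide_nonpos_pos)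
    have th: "(1 - t) + t * h = 0" 
    proof -
      have "((1 - t) + t * h) * nside n A = 0" using t(5) s by (simp add: h_def algebra_simps)
      then show ?thesis using s by simp
    qed
    define X where "X = A + t *\<^sub>R (B - A)"
    have "X = A' + (t * x) *\<^sub>R u + ((1 - t) + t * h) *\<^sub>R (A - A')"
      unfolding X_def by (subst Bxh) (simp add: algebra_simps)
    then have X: "X = A' + (t * x) *\<^sub>R u" using th by simp
    have "X \<in> closed_segment A B" unfolding in_segment X_def using t(1,2)
      by (intro exI[of _ t]) (simp add: algebra_simps)
    then have AX: "sees A X" using B(1) by (meson ends_in_segment(1) subset_closed_segment subset_trans)
    have "closed_segment A' X \<subseteq> nchord n" using open_segment_sub A'(1) t(3) by (simp add: X_def)
    then have "sees A' X" using pocket_chord_subset[OF pk] by blast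
    then have "convex hull {A, A', X} \<subseteq> U"
      using A'(2) AX by (intro triangle_subset) (simp_all add: closed_segment_commute)
    from area[OF this] have "\<bar>det2 (A' - A) (X - A)\<bar> \<le> 2 * M" .
    moreover have "det2 (A' - A) (X - A) = t * x"
    proof -
      have e: "A' - A = - (A - A')" "X - A = (t * x) *\<^sub>R u - (A - A')" by (simp_all add: X)
      have *: "det2 (- a) (c *\<^sub>R u - a) = c * det2 u a" for a c by (simp add: det2_simps det2_swap[of a u])
      show ?thesis by (simp only: e * u mult_1_right)
    qed
    ultimately have tx: "t * \<bar>x\<bar> \<le> 2 * M" using t(1) by (simp add: abs_mult)
    have t1: "t * (1 - h) = 1" using th by (simp add: algebra_simps)
    have "(t * \<bar>x\<bar>) * (1 - h) = \<bar>x\<bar> * (t * (1 - h))" by simp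
    then have "\<bar>x\<bar> = (t * \<bar>x\<bar>) * (1 - h)" unfolding t1 by simp
    also have "\<dots> \<le> 2 * M * (1 - h)" using tx h0 by (intro mult_right_mono) auto
    finally have "\<bar>x\<bar> \<le> 2 * M * (1 - h)" .
    then have "\<bar>x\<bar> * (0 - - 3) \<le> (0 - h) * (8 * M) + (h - - 3) * (2 * M)" by (simp add: algebra_simps)
    then show "\<exists>x y. B = A' + x *\<^sub>R u + y *\<^sub>R (A - A') \<and> - 3 \<le> y \<and> y \<le> 0 \<and> \<bar>x\<bar> * (0 - - 3) \<le> (0 - y) * (8 * M) + (y - - 3) * (2 * M)"
      using Bxh h3 h0 by blast
  qed (use u M_nonneg in auto)
  then show thesis using that by simp
qed

text \<open>The midpoint at height \<open>h\<close> is at horizontal distance at most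
  \<open>(1 + h) * (2 * M)\<close>. Since \<open>B\<close> is twice the midpoint minus
  \<open>A\<close>, its height is \<open>2 * h - 1\<close> and its half-width twice that, from 4 M
  at height -1 to 8 M at height 1.\<close>

lemma below_in_body_area:
  assumes pk: "npocket n" and A: "A \<in> nbody n"
  obtains H where "H \<in> sets borel" "{B. sees A B \<and> below_in_body n A B} \<subseteq> H" "emeasure lborel H \<le> ennreal (24 * M)"
proof -
  obtain A' u where A': "A' \<in> nchord n" "sees A A'" and u: "det2 u (A - A') = 1"
    and co: "\<And>B. B = A' + det2 (B - A') (A - A') *\<^sub>R u + (nside n B / nside n A) *\<^sub>R (A - A')"
    using node_coords[OF pk A] by metis
  have s: "nside n A > 0" using body_side[OF pk A] .
  have coA: "A = A' + (A - A')" by simp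
  obtain H where "H \<in> sets borel" "{B. sees A B \<and> below_in_body n A B} \<subseteq> H" 
    "emeasure lborel H \<le> ennreal ((4 * M + 8 * M) * (1 - (-1)))"
  proof (rule trapezoid_cover[of u "A - A'" "-1" 1 "4 * M" "8 * M" "{B. sees A B \<and> below_in_body n A B}" A'])
    fix B assume "B \<in> {B. sees A B \<and> below_in_body n A B}"
    then have B: "sees A B" "midpoint A B \<in> nbody n" "nside n (midpoint A B) \<le> nside n A" by (auto simp: below_in_body_def)
    define N where "N = midpoint A B"
    have sN: "nside n N > 0" using body_side[OF pk B(2)] by (simp add: N_def)
    obtain N' where N': "N' \<in> nchord n" "sees N N'" using B(2) by (auto simp: body_def N_def)
    define h where "h = nside n N / nside n A"
    define x where "x = det2 (N - A') (A - A')"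
    have h: "0 < h" "h \<le> 1" using sN s B(3) by (auto simp: h_def N_def)
    have Nxh: "N = A' + x *\<^sub>R u + h *\<^sub>R (A - A')" unfolding x_def h_def by (rule co)
    have N'b: "N' = A' + det2 (N' - A') (A - A') *\<^sub>R u" using co[of N'] side_open_segment[OF N'(1)] by simp
    have "N \<in> closed_segment A B" by (simp add: N_def)
    then have AN: "sees A N" using B(1) by (meson ends_in_segment(1) subset_closed_segment subset_trans)
    have "closed_segment A' N' \<subseteq> nchord n" using open_segment_sub A'(1) N'(1) by blast
    then have A'N': "sees A' N'" using pocket_chord_subset[OF pk] by blast
    have "\<bar>x\<bar> * \<bar>det2 u (A - A')\<bar> \<le> (1 + h) * (2 * M)"
      by (rule visible_pair_over_base(1)[OF A'(2) N'(2) AN A'N' coA N'b Nxh h _ area]) (use u in auto)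
    then have xb: "\<bar>x\<bar> \<le> (1 + h) * (2 * M)" using u by simp
    have "B = 2 *\<^sub>R N - A" by (simp add: N_def midpoint_def)
    also have "\<dots> = A' + (2 * x) *\<^sub>R u + (2 * h - 1) *\<^sub>R (A - A')" 
      by (subst Nxh) (simp add: vec_eq_iff algebra_simps)
    finally have Bc: "B = A' + (2 * x) *\<^sub>R u + (2 * h - 1) *\<^sub>R (A - A')" .
    have "\<bar>2 * x\<bar> * (1 - - 1) \<le> (1 - (2 * h - 1)) * (4 * M) + ((2 * h - 1) - - 1) * (8 * M)"
      using xb by (simp add: abs_mult algebra_simps)
    moreover have "-1 \<le> 2 * h - 1" "2 * h - 1 \<le> 1" using h by auto
    ultimately show "\<exists>x y. B = A' + x *\<^sub>R u + y *\<^sub>R (A - A') \<and> - 1 \<le> y \<and> y \<le> 1 \<and> \<bar>x\<bar> * (1 - - 1) \<le> (1 - y) * (4 * M) + (y - - 1) * (8 * M)"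
      using Bc by blast
  qed (use u M_nonneg in auto)
  then show thesis using that by simp
qed

text \<open>\<open>visible_pair_over_base\<close> is applied to body points \<open>X' i\<close>
  tending to \<open>X\<close> with base points tending to \<open>Y\<close>, and the bound survives
  in the limit. The factor \<open>1 + h\<close> is at most 2, whence 4 M.\<close>

lemma window_width:
  assumes pk: "npocket m" and c: "nchild m n" and X: "X \<in> nchord n" and N: "N \<in> nbody m"
    and NX: "sees N X" and le: "nside m N \<le> nside m X"
  obtains Y where "nside m Y = 0" "nside n Y = 0" "\<bar>det2 (N - Y) (X - Y)\<bar> \<le> 4 * M"
proof -
  obtain X' y Y where l: "\<And>i::nat. X' i \<in> nbody m" "\<And>i. y i \<in> nchord m" "\<And>i. sees (X' i) (y i)" 
    "X' \<longlonglongrightarrow> X" "y \<longlonglongrightarrow> Y" "nside m Y = 0" "nside n Y = 0"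
    using child_line[OF pk c X] by metis
  have sX: "nside m X > 0" using body_side[OF pk N] le by simp
  have pq: "fst m \<noteq> fst (snd m)" using pocket_ne[OF pk] .
  define g where "g = X - Y"
  have sg: "det2 (fst (snd m) - fst m) g = nside m X" using side_diff[OF l(6), of X] by (simp add: g_def)
  \<comment> \<open>\<open>N\<close> may be as high as \<open>X\<close>, but it has to be lower than
    the approximating \<open>X' i\<close>. Moving it by a small multiple of \<open>X - Y\<close>
    lowers it strictly and leaves the determinant with \<open>X - Y\<close> unchanged.\<close>
  have "((\<lambda>e. N - e *\<^sub>R g) \<longlongrightarrow> N - 0 *\<^sub>R g) (at_right 0)" by (intro tendsto_intros)
  then have tl: "((\<lambda>e. N - e *\<^sub>R g) \<longlongrightarrow> N) (at_right 0)" by simp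
  have "eventually (\<lambda>e. N - e *\<^sub>R g \<in> nbody m) (at_right 0)"
    using topological_tendstoD[OF tl body_open[OF pk] N] .
  moreover have "eventually (\<lambda>e. (N - e *\<^sub>R g, X) \<in> {(A, B). sees A B}) (at_right 0)"
    by (rule topological_tendstoD[OF _ open_visible_pairs[OF open_U]]) (use NX in \<open>auto intro!: tendsto_intros tl\<close>)
  moreover have "eventually (\<lambda>e::real. e > 0) (at_right 0)" by (simp add: eventually_at_right_less)
  ultimately have "eventually (\<lambda>e. e > 0 \<and> N - e *\<^sub>R g \<in> nbody m \<and> sees (N - e *\<^sub>R g) X) (at_right 0)"
    by eventually_elim auto
  then obtain e where e: "e > 0" "N - e *\<^sub>R g \<in> nbody m" "sees (N - e *\<^sub>R g) X"
    using eventually_happens[of _ "at_right (0::real)"] by auto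
  define P where "P = N - e *\<^sub>R g"
  have "nside m P = nside m N - e * nside m X"
  proof -
    have "nside m P = det2 (fst (snd m) - fst m) (P - Y)" using side_diff[OF l(6)] .
    also have "\<dots> = det2 (fst (snd m) - fst m) (N - Y) - e * det2 (fst (snd m) - fst m) g"
      by (simp add: P_def det2_simps)
    finally show ?thesis using side_diff[OF l(6), of N] sg by simp
  qed
  moreover have "e * nside m X > 0" using e(1) sX by simp
  ultimately have lt: "nside m P < nside m X" using le by linarith
  have sP: "nside m P > 0" using body_side[OF pk] e(2) by (simp add: P_def)
  obtain P' where P': "P' \<in> nchord m" "sees P P'" using e(2) by (auto simp: body_def P_def)
  have "(\<lambda>i. nside m (X' i)) \<longlonglongrightarrow> nside m X" unfolding side_def by (intro tendsto_intros l(4))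
  then have e1: "eventually (\<lambda>i. nside m P < nside m (X' i)) sequentially" using lt by (rule order_tendstoD)
  have e2: "eventually (\<lambda>i. (P, X' i) \<in> {(A, B). sees A B}) sequentially"
    by (rule topological_tendstoD[OF _ open_visible_pairs[OF open_U]]) (use e(3) in \<open>auto intro!: tendsto_intros l(4) simp: P_def\<close>)
  have "eventually (\<lambda>i. \<bar>det2 (P - y i) (X' i - y i)\<bar> \<le> 4 * M) sequentially"
    using e1 e2
  proof eventually_elim
    case (elim i)
    have sX': "nside m (X' i) > 0" using elim sP by simp
    note bc = body_coords[OF side_open_segment[OF l(2)[of i]] sX' pq]
    obtain b where b: "P' = y i + b *\<^sub>R (fst (snd m) - fst m)"
      using line_coords[OF side_open_segment[OF l(2)] side_open_segment[OF P'(1)] pq] .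
    have "closed_segment (y i) P' \<subseteq> nchord m" using open_segment_sub l(2) P'(1) by blast
    then have yP: "sees (y i) P'" using pocket_chord_subset[OF pk] by blast
    have XP: "sees (X' i) P" using elim by (simp add: closed_segment_commute)
    have X'e: "X' i = y i + (X' i - y i)" by simp
    have h: "0 < nside m P / nside m (X' i)" "nside m P / nside m (X' i) \<le> 1" using sP sX' elim by auto
    have "\<bar>det2 (P - y i) (X' i - y i) / nside m (X' i)\<bar> * \<bar>det2 (fst (snd m) - fst m) (X' i - y i)\<bar>
        \<le> (1 + nside m P / nside m (X' i)) * (2 * M)"
      by (rule visible_pair_over_base(1)[OF l(3) P'(2) XP yP X'e b bc(2) h _ area]) (use bc(1) sX' in auto)
    also have "\<dots> \<le> 2 * (2 * M)" using h M_nonneg by (intro mult_right_mono) auto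
    finally show ?case using bc(1) sX' by (simp add: abs_mult)
  qed
  moreover have "(\<lambda>i. \<bar>det2 (P - y i) (X' i - y i)\<bar>) \<longlonglongrightarrow> \<bar>det2 (P - Y) (X - Y)\<bar>"
    by (intro tendsto_intros l(4,5))
  ultimately have "\<bar>det2 (P - Y) (X - Y)\<bar> \<le> 4 * M"
    by (intro tendsto_upperbound) auto
  moreover have "det2 (P - Y) (X - Y) = det2 (N - Y) (X - Y)"
    by (simp add: P_def g_def[symmetric] det2_simps)
  ultimately show thesis using that l(6,7) by metis
qed

text \<open>The origin is the point \<open>Y\<close> where the line of the window meets the base
  line of the parent; the axes follow these two lines, and \<open>A\<close> has height 1. The
  crossing has height at least 1/2, so \<open>window_width\<close> gives the midpoint a first
  coordinate of size at most 8 M, of sign opposite to that of \<open>A\<close>. Doubling leaves the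
  partner an interval of length 16 M, at heights from -1 to 1.\<close>

lemma below_in_parent_area:
  assumes pk: "npocket m" and pn: "npocket n" and A: "A \<in> nbody n"
  obtains H where "H \<in> sets borel" "{B. sees A B \<and> below_in_parent m n A B} \<subseteq> H" "emeasure lborel H \<le> ennreal (32 * M)"
proof (cases "\<exists>B. sees A B \<and> below_in_parent m n A B")
  case False
  then show thesis using that[of "{}"] by auto
next
  case True
  define w where "w = fst (snd m) - fst m"
  define z where "z = fst (snd n) - fst n"
  have sA: "nside n A > 0" using body_side[OF pn A] .
  have AK: "A \<in> nreg n" using A body_subset[OF pn] by auto
  have key: "\<exists>Y t. nside m Y = 0 \<and> nside n Y = 0 \<and> 0 < t \<and> t \<le> 1/4 \<and> nside n (A + t *\<^sub>R (B - A)) = 0 \<and>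
      nside m (A + t *\<^sub>R (B - A)) > 0 \<and> \<bar>det2 (midpoint A B - Y) (A + t *\<^sub>R (B - A) - Y)\<bar> \<le> 4 * M \<and>
      nside m B \<le> nside m A \<and> nside m (midpoint A B) > 0 \<and> nside n B \<le> - 3 * nside n A"
    if B: "sees A B" "below_in_parent m n A B" for B
  proof -
    have c: "nchild m n" "B \<notin> nreg n" "- nside n B \<ge> 3 * nside n A" "midpoint A B \<in> nbody m" "nside m B \<le> nside m A"
      using B(2) by (auto simp: below_in_parent_def)
    have "B \<notin> nchord n" using c(3) sA side_open_segment by fastforce
    then obtain t where t: "0 < t" "t < 1" "A + t *\<^sub>R (B - A) \<in> nchord n" "(1 - t) * nside n A + t * nside n B = 0"
      using crossing[OF pn AK c(2) B(1)] by metis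
    have "t * (3 * nside n A) \<le> t * (- nside n B)" using t(1) c(3) by (intro mult_left_mono) auto
    also have "\<dots> = (1 - t) * nside n A" using t(4) by simp
    finally have "nside n A * (4 * t) \<le> nside n A * 1" by (simp add: algebra_simps)
    then have t4: "t \<le> 1/4" using sA by simp
    define X where "X = A + t *\<^sub>R (B - A)"
    have Xe: "X = (1 - t) *\<^sub>R A + t *\<^sub>R B" by (simp add: X_def algebra_simps)
    have sN: "nside m (midpoint A B) > 0" using body_side[OF pk c(4)] .
    \<comment> \<open>Heights over the parent's base do not increase from \<open>A\<close> to
      \<open>B\<close>, and the crossing comes before the midpoint.\<close>
    have "(t - 1/2) * (nside m B - nside m A) \<ge> 0" using t4 c(5) by (intro mult_nonpos_nonpos) auto
    moreover have "(1 - t) * nside m A + t * nside m B - (nside m A + nside m B) / 2 = (t - 1/2) * (nside m B - nside m A)"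
      by (simp add: field_simps)
    ultimately have le: "nside m (midpoint A B) \<le> nside m X"
      unfolding Xe side_affine side_midpoint by linarith
    have "X \<in> closed_segment A B" unfolding in_segment Xe using t by (intro exI[of _ t]) auto
    then have "closed_segment (midpoint A B) X \<subseteq> closed_segment A B"
      by (simp add: closed_segment_subset)
    then have NX: "sees (midpoint A B) X" using B(1) by blast
    obtain Y where Y: "nside m Y = 0" "nside n Y = 0" "\<bar>det2 (midpoint A B - Y) (X - Y)\<bar> \<le> 4 * M"
      using window_width[OF pk c(1) _ c(4) NX le] t(3) by (auto simp: X_def)
    have "nside n X = 0" using side_open_segment t(3) by (simp add: X_def)
    then show ?thesis using Y t t4 le sN c by (intro exI[of _ Y] exI[of _ t]) (auto simp: X_def)
  qed
  obtain B0 where B0: "sees A B0" "below_in_parent m n A B0" using True by blast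
  obtain Y t0 where Y: "nside m Y = 0" "nside n Y = 0" 
    and t0: "0 < t0" "t0 \<le> 1/4" "nside n (A + t0 *\<^sub>R (B0 - A)) = 0" "nside m (A + t0 *\<^sub>R (B0 - A)) > 0" 
      "nside m B0 \<le> nside m A" "nside n B0 \<le> - 3 * nside n A"
    using key[OF B0] by blast
  define X0 where "X0 = A + t0 *\<^sub>R (B0 - A)"
  have wX0: "det2 w (X0 - Y) > 0" using side_diff[OF Y(1), of X0] t0(4) by (simp add: w_def X0_def)
  \<comment> \<open>The two lines are not parallel: the line of the window contains \<open>Y\<close>
    at height 0 and \<open>X0\<close> at positive height over the parent's base.\<close>
  have zw: "det2 w z \<noteq> 0"
  proof -
    obtain b where "X0 = Y + b *\<^sub>R z" 
      using line_coords[OF Y(2) t0(3) pocket_ne[OF pn]] by (auto simp: X0_def z_def)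
    then show ?thesis using wX0 by (auto simp: det2_simps)
  qed
  \<comment> \<open>All partners share the same \<open>Y\<close>, so one coordinate system serves
    the whole set.\<close>
  have uniq: "Y' = Y" if Y': "nside m Y' = 0" "nside n Y' = 0" for Y'
  proof -
    obtain b where b: "Y' = Y + b *\<^sub>R z" 
      using line_coords[OF Y(2) Y'(2) pocket_ne[OF pn]] by (auto simp: z_def)
    have "det2 w (Y' - Y) = 0" using side_diff[OF Y(1), of Y'] Y'(1) by (simp add: w_def)
    then have "b = 0" using zw by (simp add: b det2_simps)
    then show ?thesis using b by simp
  qed
  have sm: "nside m Z = det2 w (Z - Y)" and sn: "nside n Z = det2 z (Z - Y)" for Z
    using side_diff[OF Y(1)] side_diff[OF Y(2)] by (simp_all add: w_def z_def)
  define s where "s = nside m A"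
  have s0: "s > 0"
  proof -
    have "X0 = (1 - t0) *\<^sub>R A + t0 *\<^sub>R B0" by (simp add: X0_def algebra_simps)
    then have "nside m X0 = (1 - t0) * nside m A + t0 * nside m B0" by (simp only: side_affine)
    also have "\<dots> \<le> (1 - t0) * s + t0 * s" unfolding s_def using t0 by (intro add_mono mult_left_mono) auto
    finally have "nside m X0 \<le> s" by (simp add: algebra_simps)
    then show ?thesis using t0(4) by (simp add: X0_def)
  qed
  define v where "v = (s / det2 w z) *\<^sub>R z"
  define u where "u = w /\<^sub>R s"
  have uv: "det2 u v = 1" using zw s0 by (simp add: u_def v_def det2_simps)
  have vv: "det2 v Z = (s / det2 w z) * det2 z Z" for Z by (simp add: v_def det2_simps)
  have uu: "det2 u Z = det2 w Z / s" for Z by (simp add: u_def det2_simps divide_inverse)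
  define X where "X = (\<lambda>Z. det2 (Z - Y) v)"
  define H where "H = (\<lambda>Z. nside m Z / s)"
  have co: "Z = Y + X Z *\<^sub>R u + H Z *\<^sub>R v" for Z
    using basis_decomp[of u v "Z - Y"] uv by (simp add: X_def H_def sm uu algebra_simps)
  define k where "k = - (s / det2 w z)"
  have XZ: "X Z = k * nside n Z" for Z
    unfolding X_def sn k_def using det2_swap[of "Z - Y" v] vv[of "Z - Y"] by simp
  define e where "e = X A"
  have HA: "H A = 1" using s0 by (simp add: H_def s_def)
  \<comment> \<open>The first coordinate of the partner is twice that of the midpoint minus
    \<open>e\<close>; with the sign known, its interval is centred at
    \<open>- e - sgn e * (8 * M)\<close>.\<close>
  obtain Hs where "Hs \<in> sets borel" "{B. sees A B \<and> below_in_parent m n A B} \<subseteq> Hs" 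
    "emeasure lborel Hs \<le> ennreal ((8 * M + 8 * M) * (1 - (-1)))"
  proof (rule trapezoid_cover[of u v "-1" 1 "8 * M" "8 * M" "{B. sees A B \<and> below_in_parent m n A B}" "Y + (- e - sgn e * (8 * M)) *\<^sub>R u"])
    fix B assume "B \<in> {B. sees A B \<and> below_in_parent m n A B}"
    then obtain Y' t where Y': "nside m Y' = 0" "nside n Y' = 0" 
      and t: "0 < t" "t \<le> 1/4" "nside n (A + t *\<^sub>R (B - A)) = 0" 
        "\<bar>det2 (midpoint A B - Y') (A + t *\<^sub>R (B - A) - Y')\<bar> \<le> 4 * M"
        "nside m B \<le> nside m A" "nside m (midpoint A B) > 0" "nside n B \<le> - 3 * nside n A"
      using key[of B] by blast
    have [simp]: "Y' = Y" using uniq Y' .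
    define N where "N = midpoint A B"
    have XN: "X N = (e + X B) / 2" unfolding XZ e_def N_def side_midpoint by (simp add: algebra_simps)
    have HN: "H N = (1 + H B) / 2" unfolding N_def H_def side_midpoint using HA by (simp add: H_def add_divide_distrib)
    have "H N > 0" using t(6) s0 by (simp add: H_def N_def)
    then have y1: "-1 < H B" using HN by simp
    have y2: "H B \<le> 1" using t(5) s0 by (simp add: H_def s_def)
    define Q where "Q = A + t *\<^sub>R (B - A)"
    have Qe: "Q = (1 - t) *\<^sub>R A + t *\<^sub>R B" by (simp add: Q_def algebra_simps)
    have XQ: "X Q = 0" using t(3) by (simp add: XZ Q_def)
    have HQ: "H Q = 1 - t * (1 - H B)"
      unfolding Qe H_def side_affine using s0 HA by (simp add: H_def s_def field_simps)
    have "t * (1 - H B) \<le> (1/4) * 2" using t y1 y2 by (intro mult_mono) auto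
    then have HQ2: "H Q \<ge> 1/2" unfolding HQ by simp
    have QY: "Q - Y = H Q *\<^sub>R v" using co[of Q] XQ by (simp add: algebra_simps)
    have "det2 (N - Y) (Q - Y) = X N * H Q" unfolding QY by (simp add: det2_simps(6) X_def)
    then have "\<bar>X N\<bar> * H Q \<le> 4 * M" using t(4) HQ2 by (simp add: N_def Q_def[symmetric] abs_mult)
    moreover have "\<bar>X N\<bar> * (1/2) \<le> \<bar>X N\<bar> * H Q" using HQ2 by (intro mult_left_mono) auto
    ultimately have XN8: "\<bar>X N\<bar> \<le> 8 * M" by simp
    have "nside n N < 0" using t(7) sA unfolding N_def side_midpoint by simp
    have "X N * e \<le> 0"
    proof -
      have "X N * e = (k * k) * (nside n N * nside n A)" by (simp add: XZ e_def)
      moreover have "nside n N * nside n A \<le> 0" using \<open>nside n N < 0\<close> sA by (simp add: mult_nonpos_nonneg)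
      ultimately show ?thesis by (simp add: mult_nonneg_nonpos)
    qed
    have e0: "e \<noteq> 0"
      unfolding e_def XZ k_def using zw s0 sA by simp
    have "\<bar>X B + e + sgn e * (8 * M)\<bar> \<le> 8 * M"
    proof -
      have eB: "X B + e = 2 * X N" using XN by simp
      show ?thesis
      proof (cases "e > 0")
        case True
        then have "X N \<le> 0" using \<open>X N * e \<le> 0\<close> by (simp add: mult_le_0_iff)
        then show ?thesis using XN8 True unfolding eB by simp
      next
        case False
        then have "e < 0" using e0 by simp
        then have "X N \<ge> 0" using \<open>X N * e \<le> 0\<close> by (simp add: mult_le_0_iff)
        then show ?thesis using XN8 \<open>e < 0\<close> unfolding eB by simp
      qed
    qed
    then have "\<bar>X B + e + sgn e * (8 * M)\<bar> * (1 - - 1) \<le> (1 - H B) * (8 * M) + (H B - - 1) * (8 * M)"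
      by (simp add: algebra_simps)
    moreover have "B = Y + (- e - sgn e * (8 * M)) *\<^sub>R u + (X B + e + sgn e * (8 * M)) *\<^sub>R u + H B *\<^sub>R v"
      by (subst co[of B]) (simp add: algebra_simps)
    ultimately show "\<exists>x y. B = Y + (- e - sgn e * (8 * M)) *\<^sub>R u + x *\<^sub>R u + y *\<^sub>R v \<and> - 1 \<le> y \<and> y \<le> 1 \<and> 
        \<bar>x\<bar> * (1 - - 1) \<le> (1 - y) * (8 * M) + (y - - 1) * (8 * M)"
      using y1 y2 by (intro exI[of _ "X B + e + sgn e * (8 * M)"] exI[of _ "H B"]) auto
  qed (use uv M_nonneg in auto)
  then show thesis using that by simp
qed

lemma related_area:
  assumes "npocket m" "npocket n" "A \<in> nbody n"
  obtains H where "H \<in> sets borel" "{B. sees A B \<and> related m n A B} \<subseteq> H" "emeasure lborel H \<le> ennreal (86 * M)"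
proof -
  obtain H2 where H2: "H2 \<in> sets borel" "{B. sees A B \<and> beyond_chord n A B} \<subseteq> H2" "emeasure lborel H2 \<le> ennreal (30 * M)"
    by (rule beyond_chord_area[OF assms(2,3)])
  obtain H3 where H3: "H3 \<in> sets borel" "{B. sees A B \<and> below_in_body n A B} \<subseteq> H3" "emeasure lborel H3 \<le> ennreal (24 * M)"
    by (rule below_in_body_area[OF assms(2,3)])
  obtain H5 where H5: "H5 \<in> sets borel" "{B. sees A B \<and> below_in_parent m n A B} \<subseteq> H5" "emeasure lborel H5 \<le> ennreal (32 * M)"
    by (rule below_in_parent_area[OF assms])
  have "emeasure lborel (H2 \<union> H3 \<union> H5) \<le> emeasure lborel (H2 \<union> H3) + emeasure lborel H5"
    by (intro emeasure_subadditive) (use H2 H3 H5 in auto)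
  also have "\<dots> \<le> (emeasure lborel H2 + emeasure lborel H3) + emeasure lborel H5"
    by (intro add_right_mono emeasure_subadditive) (use H2 H3 H5 in auto)
  also have "\<dots> \<le> (ennreal (30 * M) + ennreal (24 * M)) + ennreal (32 * M)"
    by (intro add_mono H2 H3 H5)
  also have "\<dots> = ennreal (30 * M + 24 * M + 32 * M)"
    using M_nonneg by (simp only: ennreal_plus mult_nonneg_nonneg zero_le_numeral add_nonneg_nonneg)
  finally have "emeasure lborel (H2 \<union> H3 \<union> H5) \<le> ennreal (86 * M)" by simp
  moreover have "{B. sees A B \<and> related m n A B} \<subseteq> H2 \<union> H3 \<union> H5"
    using H2(2) H3(2) H5(2) by (auto simp: related_def)
  ultimately show thesis using that[of "H2 \<union> H3 \<union> H5"] H2 H3 H5 by auto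
qed

end

lemma open_segment_null:
  fixes p q :: "real^2"
  shows "open_segment p q \<in> null_sets lborel"
proof -
  have "emeasure lborel (closed_segment p q) = 0"
    using emeasure_triangle[of p q q] by (simp add: segment_convex_hull)
  then have "closed_segment p q \<in> null_sets lborel" by (auto simp: null_sets_def)
  moreover have "open_segment p q \<in> sets lborel" by (simp add: open_segment_def)
  ultimately show ?thesis by (rule null_sets_subset) (auto simp: open_segment_def)
qed

context bounded_region
begin

section \<open>Integration\<close>

lemma related_measurable: "{z. fst z \<in> nbody n \<and> (beyond_chord n (fst z) (snd z) \<or> below_in_body n (fst z) (snd z) \<or> below_in_parent m n (fst z) (snd z))} \<in> sets borel"
  if pk: "npocket n" "npocket m"
proof -
  have c: "continuous_on UNIV (fst :: (real^2) \<times> (real^2) \<Rightarrow> _)" "continuous_on UNIV (snd :: (real^2) \<times> (real^2) \<Rightarrow> _)"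
    by (intro continuous_intros)+
  have cm: "continuous_on UNIV (\<lambda>z :: (real^2) \<times> (real^2). midpoint (fst z) (snd z))"
    unfolding midpoint_def by (intro continuous_intros)
  have o: "{z. f z \<in> W} \<in> sets borel" "{z. f z \<notin> W} \<in> sets borel" if "open W" "continuous_on UNIV f" 
    for f :: "(real^2) \<times> (real^2) \<Rightarrow> real^2" and W
  proof -
    have "open {z. f z \<in> W}" using open_vimage[OF that] by (simp add: vimage_def)
    then show "{z. f z \<in> W} \<in> sets borel" by simp
    then have "- {z. f z \<in> W} \<in> sets borel" by (rule borel_comp)
    then show "{z. f z \<notin> W} \<in> sets borel" by (simp add: Collect_neg_eq)
  qed
  have k: "{z. f z \<le> g z} \<in> sets borel" if "continuous_on UNIV f" "continuous_on UNIV g" for f g :: "(real^2) \<times> (real^2) \<Rightarrow> real"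
    using closed_Collect_le[OF that] by simp
  have s1: "continuous_on UNIV (\<lambda>z :: (real^2) \<times> (real^2). side a b (fst z))" 
    "continuous_on UNIV (\<lambda>z :: (real^2) \<times> (real^2). side a b (snd z))" for a b
    by (intro continuous_intros)+
  have sm: "continuous_on UNIV (\<lambda>z :: (real^2) \<times> (real^2). side a b (midpoint (fst z) (snd z)))" for a b
    by (intro continuous_intros cm)
  have m2: "{z. beyond_chord n (fst z) (snd z)} \<in> sets borel"
    unfolding beyond_chord_def Collect_conj_eq
    by (intro sets.Int o(2)[OF pocket_open[OF pk(1)] c(2)] k continuous_intros)
  have m3: "{z. below_in_body n (fst z) (snd z)} \<in> sets borel"
    unfolding below_in_body_def Collect_conj_eq
    by (intro sets.Int o(1)[OF body_open[OF pk(1)] cm] k sm s1)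
  have m5: "{z. below_in_parent m n (fst z) (snd z)} \<in> sets borel"
    unfolding below_in_parent_def Collect_conj_eq
    by (intro sets.Int o(1)[OF body_open[OF pk(2)] cm] o(2)[OF pocket_open[OF pk(1)] c(2)] k continuous_intros) auto
  show ?thesis unfolding Collect_conj_eq Collect_disj_eq
    by (intro sets.Int sets.Un o(1)[OF body_open[OF pk(1)] c(1)] m2 m3 m5)
qed

text \<open>Up to a null set a visible pair is charged to its first or its second point, so
  \<open>Seg U\<close> is covered by \<open>E\<close> and its mirror image \<open>E'\<close>, whose
  sections have measure at most 86 M.\<close>

lemma Seg_area: "emeasure lborel (Seg U) \<le> ennreal (172 * M) * emeasure lborel U"
proof (cases "U = {}")
  case True
  then show ?thesis by (simp add: Seg_def)
next
  case False
  then obtain Z where Z: "Z \<in> U" by blast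
  have "axis 1 1 \<noteq> (0 :: real^2)" by (simp add: axis_eq_0_iff)
  then obtain p q where c: "chord p q" using chord_through[OF Z] by metis
  define N where "N = all_nodes p q"
  have cN: "countable N" unfolding N_def by (rule countable_all_nodes)
  have par: "npocket n" "npocket m" if "(d, m, n) \<in> N" for d m n
  proof -
    have "\<exists>r. (d, m, n) \<in> nodes r" using that unfolding N_def all_nodes_def by blast
    then obtain r where r: "(d, m, n) \<in> nodes r" ..
    show "npocket n" using nodes_pocket[OF r] .
    from r show "npocket m" by (cases rule: nodes.cases) (auto dest: nodes_pocket)
  qed
  define E where "E = Seg U \<inter> (\<Union>x\<in>N. {z. related (fst (snd x)) (snd (snd x)) (fst z) (snd z)})"
  have E: "E \<in> sets borel"
  proof -
    have "{z. related (fst (snd x)) (snd (snd x)) (fst z) (snd z)} \<in> sets borel" if "x \<in> N" for x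
      using related_measurable[OF par[of "fst x" "fst (snd x)" "snd (snd x)"]] that by (simp add: related_def)
    then show ?thesis unfolding E_def
      by (intro sets.Int sets.countable_UN' cN borel_open open_Seg open_U) auto
  qed
  have EA: "emeasure lborel (Pair A -` E) \<le> ennreal (86 * M) * indicator U A" for A
  proof (cases "A \<in> U \<and> (\<exists>x\<in>N. A \<in> nbody (snd (snd x)))")
    case False
    have "Pair A -` E = {}" using False by (auto simp: E_def Seg_def related_def)
    then show ?thesis by simp
  next
    case True
    then obtain d m n where x: "(d, m, n) \<in> N" "A \<in> nbody n" by auto
    \<comment> \<open>The bodies are disjoint, so \<open>A\<close> belongs to a single node and its
      section is bounded by one application of \<open>related_area\<close>.\<close>
    have u: "y = (d, m, n)" if y: "y \<in> N" "A \<in> nbody (snd (snd y))" for y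
    proof (rule ccontr)
      assume "y \<noteq> (d, m, n)"
      moreover obtain d' m' n' where y': "y = (d', m', n')" by (cases y)
      ultimately have "nbody n \<inter> nbody n' = {}" using all_nodes_disjoint x(1) y(1) unfolding N_def by blast
      then show False using x(2) y(2) y' by auto
    qed
    obtain H where H: "H \<in> sets borel" "{B. sees A B \<and> related m n A B} \<subseteq> H" "emeasure lborel H \<le> ennreal (86 * M)"
      by (rule related_area[OF par(2)[OF x(1)] par(1)[OF x(1)] x(2)])
    have "Pair A -` E \<subseteq> H"
    proof
      fix B assume "B \<in> Pair A -` E"
      then obtain y where y: "y \<in> N" "sees A B" "related (fst (snd y)) (snd (snd y)) A B"
        by (auto simp: E_def Seg_def)
      then have "y = (d, m, n)" using u by (simp add: related_def)
      then show "B \<in> H" using y H(2) by auto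
    qed
    then have "emeasure lborel (Pair A -` E) \<le> emeasure lborel H" using H by (intro emeasure_mono) auto
    then show ?thesis using H(3) True by simp
  qed
  have sE: "E \<in> sets (lborel \<Otimes>\<^sub>M lborel)" unfolding lborel_prod using E by simp
  have "emeasure lborel E = (\<integral>\<^sup>+A. emeasure lborel (Pair A -` E) \<partial>lborel)"
    using lborel.emeasure_pair_measure_alt[OF sE] by (simp add: lborel_prod)
  also have "\<dots> \<le> (\<integral>\<^sup>+A. ennreal (86 * M) * indicator U A \<partial>lborel)" by (intro nn_integral_mono EA)
  also have "\<dots> = ennreal (86 * M) * emeasure lborel U"
    using open_U by (intro nn_integral_cmult_indicator) simp
  finally have mE: "emeasure lborel E \<le> ennreal (86 * M) * emeasure lborel U" .
  define E' where "E' = prod.swap -` E"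
  have "prod.swap \<in> borel_measurable (borel :: ((real^2) \<times> (real^2)) measure)"
    by (intro borel_measurable_continuous_onI continuous_on_swap)
  then have E': "E' \<in> sets borel" using measurable_sets[of prod.swap borel borel E] E by (simp add: E'_def)
  have sE': "E' \<in> sets (lborel \<Otimes>\<^sub>M lborel)" unfolding lborel_prod using E' by simp
  have "emeasure lborel E' = (\<integral>\<^sup>+B. emeasure lborel ((\<lambda>A. (A, B)) -` E') \<partial>lborel)"
    using lborel_pair.emeasure_pair_measure_alt2[OF sE'] by (simp add: lborel_prod)
  also have "\<dots> = (\<integral>\<^sup>+A. emeasure lborel (Pair A -` E) \<partial>lborel)"
    by (intro nn_integral_cong arg_cong[where f = "emeasure lborel"]) (auto simp: E'_def)
  also have "\<dots> \<le> (\<integral>\<^sup>+A. ennreal (86 * M) * indicator U A \<partial>lborel)" by (intro nn_integral_mono EA)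
  also have "\<dots> = ennreal (86 * M) * emeasure lborel U"
    using open_U by (intro nn_integral_cmult_indicator) simp
  finally have mE': "emeasure lborel E' \<le> ennreal (86 * M) * emeasure lborel U" .
  \<comment> \<open>The case analysis leaves out points on the first chord or on a window; these are
    countably many segments, so the pairs involved form a null set.\<close>
  define Z where "Z = open_segment p q \<union> (\<Union>x\<in>N. nchord (snd (snd x)))"
  have Zn: "Z \<in> null_sets lborel"
    unfolding Z_def by (intro null_sets.Un open_segment_null null_sets_UN' cN)
  have Zb: "Z \<in> sets lborel" and Z0: "emeasure lborel Z = 0" using Zn by auto
  have "emeasure lborel (Z \<times> (UNIV :: (real^2) set)) = 0" "emeasure lborel ((UNIV :: (real^2) set) \<times> Z) = 0"
    using lborel.emeasure_pair_measure_Times[OF Zb, of UNIV] lborel.emeasure_pair_measure_Times[of UNIV lborel Z] Z0 Zb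
    by (simp_all add: lborel_prod)
  moreover have ZU: "Z \<times> (UNIV :: (real^2) set) \<in> sets borel" "(UNIV :: (real^2) set) \<times> Z \<in> sets borel"
    using Zb by (simp_all add: borel_Times)
  ultimately have mZ: "emeasure lborel (Z \<times> UNIV \<union> UNIV \<times> Z) = 0" and sZ: "Z \<times> UNIV \<union> UNIV \<times> Z \<in> sets borel"
    using emeasure_Un_null_set[of "Z \<times> UNIV" lborel "UNIV \<times> Z"] by (auto simp: null_sets_def)
  have "Seg U \<subseteq> E \<union> E' \<union> (Z \<times> UNIV \<union> UNIV \<times> Z)"
  proof
    fix z assume "z \<in> Seg U"
    then obtain A B where z: "z = (A, B)" "sees A B" by (auto simp: Seg_eq)
    show "z \<in> E \<union> E' \<union> (Z \<times> UNIV \<union> UNIV \<times> Z)"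
    proof (cases "A \<in> Z \<or> B \<in> Z")
      case False
      have "\<exists>d m n. (d, m, n) \<in> N \<and> (related m n A B \<or> related m n B A)"
        unfolding N_def
      proof (rule visible_pair_related[OF c z(2)])
        show "A \<notin> nchord n \<and> B \<notin> nchord n" if "(d, m, n) \<in> all_nodes p q" for d m n
          using False that by (force simp: Z_def N_def)
      qed (use False in \<open>auto simp: Z_def\<close>)
      then obtain d m n where "(d, m, n) \<in> N" "related m n A B \<or> related m n B A" by blast
      then have "(\<exists>x\<in>N. related (fst (snd x)) (snd (snd x)) A B) \<or> (\<exists>x\<in>N. related (fst (snd x)) (snd (snd x)) B A)" by force
      then show ?thesis using z(2) by (auto simp: E_def E'_def Seg_eq z(1) closed_segment_commute)
    qed (use z in auto)
  qed
  then have "emeasure lborel (Seg U) \<le> emeasure lborel (E \<union> E' \<union> (Z \<times> UNIV \<union> UNIV \<times> Z))"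
    using E E' sZ by (intro emeasure_mono) auto
  also have "\<dots> \<le> emeasure lborel (E \<union> E') + emeasure lborel (Z \<times> UNIV \<union> UNIV \<times> Z)"
    using E E' sZ by (intro emeasure_subadditive) auto
  also have "\<dots> \<le> emeasure lborel E + emeasure lborel E'"
    using E E' mZ emeasure_subadditive[of E lborel E'] by simp
  also have "\<dots> \<le> ennreal (86 * M) * emeasure lborel U + ennreal (86 * M) * emeasure lborel U"
    by (intro add_mono mE mE')
  also have "\<dots> = (ennreal (86 * M) + ennreal (86 * M)) * emeasure lborel U" by (simp add: distrib_right)
  also have "ennreal (86 * M) + ennreal (86 * M) = ennreal (172 * M)"
    using M_nonneg by (subst ennreal_plus[symmetric]) auto
  finally show ?thesis .
qed

end

section \<open>From bounded open regions to the given set\<close>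

lemma emeasure_Seg_open:
  fixes S :: "(real^2) set"
  assumes S: "p_componentwise_simply_connected S" "S \<in> lmeasurable"
  shows "emeasure lborel (Seg (interior S)) \<le> ennreal (172 * smc S) * emeasure lborel (interior S)"
proof -
  define M where "M = smc S"
  have bdd: "bdd_above (measure lebesgue ` {C. convex C \<and> C \<subseteq> S})" using smc_bdd_above[OF S(2)] .
  have up: "measure lebesgue C \<le> M" if "convex C" "C \<subseteq> S" for C
    unfolding M_def smc_def using that bdd by (intro cSUP_upper) auto
  have M0: "0 \<le> M" using up[of "{}"] by simp
  have triangle_bound: "\<bar>det2 (b - a) (c - a)\<bar> \<le> 2 * M" if "convex hull {a, b, c} \<subseteq> S" for a b c
  proof -
    have "convex hull {a, b, c} \<in> sets borel"
      by (intro borel_compact finite_imp_compact_convex_hull) simp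
    then have "measure lebesgue (convex hull {a, b, c}) = \<bar>det2 (b - a) (c - a)\<bar> / 2"
      using emeasure_triangle[of a b c] by (simp add: measure_def)
    then show ?thesis using up[of "convex hull {a, b, c}"] that by simp
  qed
  \<comment> \<open>The locale requires bounded regions; every segment of the interior lies in one
    of these disks.\<close>
  define U where "U = (\<lambda>n::nat. interior S \<inter> ball 0 (real n))"
  have oU: "open (U n)" for n by (simp add: U_def open_Int)
  have n: "emeasure lborel (Seg (U n)) \<le> ennreal (172 * M) * emeasure lborel (U n)" for n
  proof -
    define I where "I = components (U n)"
    have oC: "open C" if "C \<in> I" for C using that oU open_components by (auto simp: I_def)
    have cI: "countable I"
      using pairwise_disjoint_components[of "U n"] oC
      by (intro countable_disjoint_open_subsets) (auto simp: I_def pairwise_def disjnt_def)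
    have disC: "disjoint_family_on (\<lambda>C. C) I"
      using pairwise_disjoint_components[of "U n"] by (auto simp: I_def disjoint_family_on_def pairwise_def)
    have disS: "disjoint_family_on Seg I"
      using disC by (fastforce simp: disjoint_family_on_def Seg_def)
    have un: "U n = (\<Union>C\<in>I. C)" by (simp add: I_def)
    \<comment> \<open>A segment is connected and stays in one component, so visible pairs split over
      the components just as the area does.\<close>
    have su: "Seg (U n) = (\<Union>C\<in>I. Seg C)"
    proof (intro equalityI subsetI)
      fix z assume "z \<in> Seg (U n)"
      then obtain A B where z: "z = (A, B)" "closed_segment A B \<subseteq> U n" by (auto simp: Seg_eq)
      define C where "C = connected_component_set (U n) A"
      have "A \<in> U n" using z by auto
      then have "C \<in> I" by (simp add: C_def I_def componentsI)
      moreover have "closed_segment A B \<subseteq> C" unfolding C_def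
        by (rule connected_component_maximal) (use z in auto)
      ultimately show "z \<in> (\<Union>C\<in>I. Seg C)" using z by (auto simp: Seg_eq)
    next
      fix z assume "z \<in> (\<Union>C\<in>I. Seg C)"
      then show "z \<in> Seg (U n)" using in_components_subset unfolding I_def Seg_eq by fastforce
    qed
    have br: "emeasure lborel (Seg C) \<le> ennreal (172 * M) * emeasure lborel C" if C: "C \<in> I" for C
    proof -
      have CU: "C \<subseteq> U n" using C in_components_subset by (auto simp: I_def)
      have CS: "C \<subseteq> S" using CU interior_subset by (auto simp: U_def)
      interpret bounded_region C M
      proof
        show "open C" using oC C .
        show "bounded C" using CU bounded_subset[OF bounded_ball] by (auto simp: U_def)
        show "simply_connected C"
          by (rule simply_connected_component[OF S(1), of "ball 0 (real n)"]) (use C in \<open>auto simp: I_def U_def\<close>)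
        show "\<bar>det2 (b - a) (c - a)\<bar> \<le> 2 * M" if "convex hull {a, b, c} \<subseteq> C" for a b c
          using triangle_bound that CS by blast
      qed (rule M0)
      show ?thesis by (rule Seg_area)
    qed
    have "emeasure lborel (Seg (U n)) = (\<integral>\<^sup>+C. emeasure lborel (Seg C) \<partial>count_space I)"
      unfolding su using oC open_Seg by (intro emeasure_UN_countable cI disS) auto
    also have "\<dots> \<le> (\<integral>\<^sup>+C. ennreal (172 * M) * emeasure lborel C \<partial>count_space I)"
      using br by (intro nn_integral_mono) auto
    also have "\<dots> = ennreal (172 * M) * (\<integral>\<^sup>+C. emeasure lborel C \<partial>count_space I)"
      by (rule nn_integral_cmult) simp
    also have "(\<integral>\<^sup>+C. emeasure lborel C \<partial>count_space I) = emeasure lborel (U n)"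
      unfolding un using oC by (intro emeasure_UN_countable[symmetric] cI disC) auto
    finally show ?thesis .
  qed
  have Sn: "(\<Union>k. Seg (U k)) = Seg (interior S)"
  proof (intro equalityI subsetI)
    fix z assume "z \<in> Seg (interior S)"
    then obtain A B where z: "z = (A, B)" "closed_segment A B \<subseteq> interior S" by (auto simp: Seg_eq)
    obtain k :: nat where "max (norm A) (norm B) < k" using reals_Archimedean2 by blast
    then have "closed_segment A B \<subseteq> ball 0 k" by (intro closed_segment_subset) auto
    then show "z \<in> (\<Union>k. Seg (U k))" using z by (auto simp: Seg_eq U_def)
  qed (auto simp: Seg_eq U_def)
  have "incseq (\<lambda>k. Seg (U k))" by (rule monoI) (force simp: Seg_eq U_def)
  then have "emeasure lborel (Seg (interior S)) = (SUP k. emeasure lborel (Seg (U k)))"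
    using SUP_emeasure_incseq[of "\<lambda>k. Seg (U k)" lborel] oU open_Seg by (simp add: Sn image_subset_iff)
  also have "\<dots> \<le> ennreal (172 * M) * emeasure lborel (interior S)"
  proof (rule SUP_least)
    fix k
    have "emeasure lborel (U k) \<le> emeasure lborel (interior S)" by (intro emeasure_mono) (auto simp: U_def)
    then show "emeasure lborel (Seg (U k)) \<le> ennreal (172 * M) * emeasure lborel (interior S)"
      using n[of k] by (meson mult_left_mono order_trans zero_le)
  qed
  finally show ?thesis by (simp add: M_def)
qed

theorem theorem1p3:
  fixes S :: "(real^2) set"
  assumes "p_componentwise_simply_connected S"
    and "beer_index_defined S"
  shows "beer_index S \<le> 180 * convexity_ratio S"
proof -
  have S: "S \<in> lmeasurable" "measure lebesgue S > 0" "Seg S \<in> sets lebesgue"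
    using assms(2) by (auto simp: beer_index_defined_def)
  have M0: "0 \<le> smc S" 
  proof -
    have "measure lebesgue {} \<le> smc S"
      using cSUP_upper[OF _ smc_bdd_above[OF S(1)], of "{}"] by (simp add: smc_def)
    then show ?thesis by simp
  qed
  \<comment> \<open>\<open>W\<close> is known to be null only for \<open>lebesgue\<close>, so the
    comparison is made there before passing to \<open>lborel\<close> for the open part.\<close>
  define W where "W = Seg S - Seg (interior S)"
  have oS: "Seg (interior S) \<in> sets borel" using open_Seg[of "interior S"] by simp
  have W: "W \<in> null_sets lebesgue"
    using negligible_Seg_diff_interior[OF assms(1) S(3)] by (simp add: W_def negligible_iff_null_sets)
  have "Seg S \<subseteq> Seg (interior S) \<union> W" by (auto simp: W_def)
  then have "emeasure lebesgue (Seg S) \<le> emeasure lebesgue (Seg (interior S) \<union> W)"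
    using W oS by (intro emeasure_mono) auto
  also have "\<dots> = emeasure lebesgue (Seg (interior S))"
    using W oS by (intro emeasure_Un_null_set) auto
  also have "\<dots> = emeasure lborel (Seg (interior S))" using oS by simp
  also have "\<dots> \<le> ennreal (172 * smc S) * emeasure lborel (interior S)"
    by (rule emeasure_Seg_open[OF assms(1) S(1)])
  also have "\<dots> = ennreal (172 * smc S) * emeasure lebesgue (interior S)" by simp
  also have "\<dots> \<le> ennreal (172 * smc S) * emeasure lebesgue S"
    using S(1) interior_subset[of S] by (intro mult_left_mono emeasure_mono) (auto intro: fmeasurableD)
  also have "\<dots> = ennreal (172 * smc S * measure lebesgue S)"
    using S(1) M0 by (simp add: emeasure_eq_measure2 ennreal_mult)
  finally have le: "emeasure lebesgue (Seg S) \<le> ennreal (172 * smc S * measure lebesgue S)" .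
  have "measure lebesgue (Seg S) \<le> 172 * smc S * measure lebesgue S"
    using enn2real_mono[OF le] M0 by (simp add: measure_def)
  \<comment> \<open>The argument yields 172; the slack up to the stated constant is given away
    here.\<close>
  also have "\<dots> \<le> 180 * smc S * measure lebesgue S" using M0 by (intro mult_right_mono) auto
  finally have "measure lebesgue (Seg S) \<le> 180 * smc S * measure lebesgue S" .
  then have "measure lebesgue (Seg S) / (measure lebesgue S)\<^sup>2 \<le> 180 * smc S * measure lebesgue S / (measure lebesgue S)\<^sup>2"
    by (intro divide_right_mono) auto
  also have "\<dots> = 180 * (smc S / measure lebesgue S)" using S(2) by (simp add: power2_eq_square)
  finally show ?thesis by (simp add: beer_index_def convexity_ratio_def)
qed

end
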